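(* Let $\Omega\subset\mathbb{R}^2$ be a square or a rectangle, let $-\Delta$ be the Dirichlet Laplacian on $\Omega$, and let $1<p<\infty$. Then for every $z\in\mathbb{C}$ outside the spectrum of $-\Delta^{-1}$, the resolvent $(-\Delta^{-1}-z)^{-1}$ is bounded from $L^p(\Omega)$ to $L^p(\Omega)$.
   Context: $-\Delta^{-1}$ denotes the inverse of the Dirichlet Laplacian $-\Delta$, a compact self-adjoint operator on $L^2(\Omega)$ whose spectrum is understood in $L^2(\Omega)$. Boundedness on $L^p$ means that $(-\Delta^{-1}-z)^{-1}$, defined on $L^2(\Omega)\cap L^p(\Omega)$ through the eigenfunction expansion, satisfies $\|(-\Delta^{-1}-z)^{-1}u\|_{L^p(\Omega)}\le C\|u\|_{L^p(\Omega)}$ with $C$ independent of $u$ (so it extends to a bounded operator on $L^p(\Omega)$). *)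

theory Defs
  imports "HOL-Analysis.Analysis"
begin

text \<open>Elements of the Lebesgue spaces are represented by complex-valued functions, and two
  functions that agree almost everywhere on the domain stand for the same element.  Unbounded
  operators are represented by their graphs.\<close>

definition Lp :: "real \<Rightarrow> 'a::euclidean_space set \<Rightarrow> ('a \<Rightarrow> complex) set" where
  "Lp p \<Omega> = {f. f \<in> borel_measurable (lebesgue_on \<Omega>) \<and>
                integrable (lebesgue_on \<Omega>) (\<lambda>x. norm (f x) powr p)}"

definition Lp_norm :: "real \<Rightarrow> 'a::euclidean_space set \<Rightarrow> ('a \<Rightarrow> complex) \<Rightarrow> real" where
  "Lp_norm p \<Omega> f = (\<integral>x. norm (f x) powr p \<partial>lebesgue_on \<Omega>) powr (1 / p)"

abbreviation L2 :: "'a::euclidean_space set \<Rightarrow> ('a \<Rightarrow> complex) set" where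
  "L2 \<equiv> Lp 2"

abbreviation L2_norm :: "'a::euclidean_space set \<Rightarrow> ('a \<Rightarrow> complex) \<Rightarrow> real" where
  "L2_norm \<equiv> Lp_norm 2"

definition L2_inner :: "'a::euclidean_space set \<Rightarrow> ('a \<Rightarrow> complex) \<Rightarrow> ('a \<Rightarrow> complex) \<Rightarrow> complex" where
  "L2_inner \<Omega> f g = (\<integral>x. f x * cnj (g x) \<partial>lebesgue_on \<Omega>)"

definition partial :: "'a::euclidean_space \<Rightarrow> ('a \<Rightarrow> complex) \<Rightarrow> 'a \<Rightarrow> complex" where
  "partial b f x = frechet_derivative f (at x) b"

primrec k_times_cont_diff :: "nat \<Rightarrow> ('a::euclidean_space \<Rightarrow> complex) \<Rightarrow> bool" where
  "k_times_cont_diff 0 f \<longleftrightarrow> continuous_on UNIV f"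
| "k_times_cont_diff (Suc k) f \<longleftrightarrow>
     (\<forall>x. f differentiable (at x)) \<and> (\<forall>b\<in>Basis. k_times_cont_diff k (partial b f))"

text \<open>The space \<open>C\<^sub>c\<^sup>\<infinity>(\<Omega>)\<close>; its elements are extended by zero to the whole space.\<close>

definition test_functions :: "'a::euclidean_space set \<Rightarrow> ('a \<Rightarrow> complex) set" where
  "test_functions \<Omega> = {\<phi>. (\<forall>k. k_times_cont_diff k \<phi>) \<and>
     (\<exists>K. compact K \<and> K \<subseteq> \<Omega> \<and> (\<forall>x. x \<notin> K \<longrightarrow> \<phi> x = 0))}"

text \<open>\<open>H10 \<Omega> u g\<close>: the function \<open>u\<close> lies in \<open>H\<^sup>1\<^sub>0(\<Omega>)\<close>, the closure of
  \<open>C\<^sub>c\<^sup>\<infinity>(\<Omega>)\<close> in the norm of \<open>H\<^sup>1(\<Omega>)\<close>, and \<open>g b\<close> is its weak partial derivative in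
  direction \<open>b\<close>.  An \<open>L\<^sup>2\<close> limit of gradients of test functions converging to \<open>u\<close> in
  \<open>L\<^sup>2\<close> is automatically the weak gradient of \<open>u\<close>.\<close>

definition H10 :: "'a::euclidean_space set \<Rightarrow> ('a \<Rightarrow> complex) \<Rightarrow> ('a \<Rightarrow> 'a \<Rightarrow> complex) \<Rightarrow> bool" where
  "H10 \<Omega> u g \<longleftrightarrow> u \<in> L2 \<Omega> \<and> (\<forall>b\<in>Basis. g b \<in> L2 \<Omega>) \<and>
     (\<exists>\<phi> :: nat \<Rightarrow> 'a \<Rightarrow> complex. (\<forall>n. \<phi> n \<in> test_functions \<Omega>) \<and>
        (\<lambda>n. L2_norm \<Omega> (\<lambda>x. \<phi> n x - u x)) \<longlonglongrightarrow> 0 \<and>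
        (\<forall>b\<in>Basis. (\<lambda>n. L2_norm \<Omega> (\<lambda>x. partial b (\<phi> n) x - g b x)) \<longlonglongrightarrow> 0))"

text \<open>\<open>minus_laplacian \<Omega> u f\<close>: \<open>u\<close> belongs to the domain
  \<open>{u \<in> H\<^sup>1\<^sub>0(\<Omega>). \<Delta>u \<in> L\<^sup>2(\<Omega>)}\<close> of the Dirichlet Laplacian and \<open>-\<Delta>u = f\<close>.\<close>

definition minus_laplacian ::
    "'a::euclidean_space set \<Rightarrow> ('a \<Rightarrow> complex) \<Rightarrow> ('a \<Rightarrow> complex) \<Rightarrow> bool" where
  "minus_laplacian \<Omega> u f \<longleftrightarrow> f \<in> L2 \<Omega> \<and>
     (\<exists>g. H10 \<Omega> u g \<and> (\<forall>\<phi>\<in>test_functions \<Omega>.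
        (\<Sum>b\<in>Basis. L2_inner \<Omega> (g b) (partial b \<phi>)) = L2_inner \<Omega> f \<phi>))"

definition inverse_laplacian ::
    "'a::euclidean_space set \<Rightarrow> ('a \<Rightarrow> complex) \<Rightarrow> ('a \<Rightarrow> complex) \<Rightarrow> bool" where
  "inverse_laplacian \<Omega> f u \<longleftrightarrow> minus_laplacian \<Omega> u f"

text \<open>\<open>inverse_laplacian_minus \<Omega> z v w\<close>: applying the inverse of \<open>-\<Delta>\<close>, minus \<open>z\<close> times
  the identity, to \<open>v \<in> L\<^sup>2(\<Omega>)\<close> gives \<open>w\<close>.\<close>

definition inverse_laplacian_minus ::
    "'a::euclidean_space set \<Rightarrow> complex \<Rightarrow> ('a \<Rightarrow> complex) \<Rightarrow> ('a \<Rightarrow> complex) \<Rightarrow> bool" where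
  "inverse_laplacian_minus \<Omega> z v w \<longleftrightarrow> v \<in> L2 \<Omega> \<and> w \<in> L2 \<Omega> \<and>
     (\<exists>u. inverse_laplacian \<Omega> v u \<and> (AE x in lebesgue_on \<Omega>. w x = u x - z * v x))"

text \<open>Complement of the set of \<open>z\<close> for which the operator above maps \<open>L\<^sup>2(\<Omega>)\<close> bijectively
  onto \<open>L\<^sup>2(\<Omega>)\<close> with bounded inverse.  The norm bound contains injectivity.\<close>

definition spectrum_inverse_laplacian :: "'a::euclidean_space set \<Rightarrow> complex set" where
  "spectrum_inverse_laplacian \<Omega> = - {z.
     (\<forall>w\<in>L2 \<Omega>. \<exists>v. inverse_laplacian_minus \<Omega> z v w) \<and>
     (\<exists>C. \<forall>v w. inverse_laplacian_minus \<Omega> z v w \<longrightarrow> L2_norm \<Omega> v \<le> C * L2_norm \<Omega> w)}"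

text \<open>An orthonormal basis of \<open>L\<^sup>2(\<Omega>)\<close> of eigenfunctions \<open>e k\<close> of \<open>-\<Delta>\<close>, with
  eigenvalues \<open>ev k\<close> repeated according to multiplicity.\<close>

definition laplacian_eigenbasis ::
    "'a::euclidean_space set \<Rightarrow> (nat \<Rightarrow> 'a \<Rightarrow> complex) \<Rightarrow> (nat \<Rightarrow> real) \<Rightarrow> bool" where
  "laplacian_eigenbasis \<Omega> e ev \<longleftrightarrow>
     (\<forall>k. minus_laplacian \<Omega> (e k) (\<lambda>x. of_real (ev k) * e k x)) \<and>
     (\<forall>j k. L2_inner \<Omega> (e j) (e k) = (if j = k then 1 else 0)) \<and>
     (\<forall>f\<in>L2 \<Omega>. (\<forall>k. L2_inner \<Omega> f (e k) = 0) \<longrightarrow> (AE x in lebesgue_on \<Omega>. f x = 0))"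

text \<open>\<open>v\<close> is the value at \<open>u\<close> of the resolvent at \<open>z\<close> of the inverse of \<open>-\<Delta>\<close>:  the
  inverse has the eigenvalues \<open>1 / ev k\<close>, and the series converges in \<open>L\<^sup>2(\<Omega>)\<close>.\<close>

definition resolvent_inverse_laplacian ::
    "'a::euclidean_space set \<Rightarrow> complex \<Rightarrow> ('a \<Rightarrow> complex) \<Rightarrow> ('a \<Rightarrow> complex) \<Rightarrow> bool" where
  "resolvent_inverse_laplacian \<Omega> z u v \<longleftrightarrow> v \<in> L2 \<Omega> \<and>
     (\<exists>e ev. laplacian_eigenbasis \<Omega> e ev \<and>
        (\<lambda>n. L2_norm \<Omega> (\<lambda>x.
            (\<Sum>k<n. L2_inner \<Omega> u (e k) / (of_real (1 / ev k) - z) * e k x) - v x)) \<longlonglongrightarrow> 0)"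

text \<open>Nondegenerate open rectangles in arbitrary position and orientation; squares are the
  case of equal side lengths.\<close>

definition open_rectangle :: "(real^2) set \<Rightarrow> bool" where
  "open_rectangle \<Omega> \<longleftrightarrow> (\<exists>c d1 d2 a b. norm d1 = 1 \<and> norm d2 = 1 \<and> d1 \<bullet> d2 = 0 \<and> 0 < a \<and> 0 < b \<and>
     \<Omega> = {c + s *\<^sub>R d1 + t *\<^sub>R d2 | s t. 0 < s \<and> s < a \<and> 0 < t \<and> t < b})"

end

theory Submission
  imports Defs "HOL-Computational_Algebra.Polynomial"
begin

text \<open>
  Write \<open>A\<close> for the inverse of \<open>-\<Delta>\<close>.  If \<open>v = (A - z)\<^sup>-\<^sup>1 u\<close>, then \<open>v = (A v - u) / z\<close>, so an \<open>L\<^sup>p\<close> bound is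
  needed only for the smoothing part \<open>w = A v = A (A - z)\<^sup>-\<^sup>1 u\<close>.  In two dimensions the numbers \<open>1/ev k\<close> are square
  summable, and on a rectangle the normalized eigenfunctions, products of sines, are bounded uniformly.
  The coefficients of \<open>w\<close> are those of \<open>u\<close> times \<open>(1/ev k) / (1/ev k - z)\<close>, hence \<open>w\<close> is bounded by a constant times
  \<open>\<parallel>u\<parallel>\<^sub>2\<close>, and \<open>\<parallel>w\<parallel>\<^sub>2\<close> is at most a constant times \<open>\<parallel>u\<parallel>\<^sub>1\<close>.  As the rectangle has finite measure, the first
  bound gives the claim for \<open>p \<ge> 2\<close> and the second for \<open>p < 2\<close>
  (\<open>resolvent_multiplier_Lp_bounded\<close>).  The distance of \<open>z\<close> to the points \<open>1/ev k\<close> is positive because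
  eigenfunctions can be inserted into the norm bound that defines the resolvent set
  (\<open>eigenvalue_bound\<close>); as these points tend to 0, it follows that \<open>z \<noteq> 0\<close>.

  That the sines belong to \<open>H\<^sup>1\<^sub>0\<close> is shown by smooth cutoffs, whose large derivatives the zeros of the
  sine compensate (\<open>sine_product_H10\<close>).  Integration by parts and the orthogonality relations both rest on
  the vanishing of the integral of a directional derivative, a consequence of translation invariance
  (\<open>integral_directional_derivative_zero\<close>); this also avoids coordinate changes for rotated
  rectangles.  Completeness of the sines follows from the Stone--Weierstrass theorem
  (\<open>basis_complete\<close>).

  The resolvent is described through an arbitrary eigenbasis.  Since eigenfunctions of one basis are
  orthogonal to those of another one unless the eigenvalues agree, every eigenbasis yields the same
  coefficients with respect to the sines (\<open>resolvent_coefficient\<close>), and the series converges by the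
  Riesz--Fischer theorem (\<open>resolvent_exists\<close>).
\<close>

section \<open>Square-integrable functions\<close>

lemma powr_two: "norm (x::complex) powr 2 = (norm x)\<^sup>2"
  by (simp add: powr_numeral)

lemma L2_iff: "f \<in> L2 \<Omega> \<longleftrightarrow> f \<in> borel_measurable (lebesgue_on \<Omega>) \<and> integrable (lebesgue_on \<Omega>) (\<lambda>x. (norm (f x))\<^sup>2)"
  by (simp add: Lp_def powr_two)

lemma Lp_measurable: "f \<in> Lp p \<Omega> \<Longrightarrow> f \<in> borel_measurable (lebesgue_on \<Omega>)"
  by (simp add: Lp_def)

lemma L2_integrable_sq: "f \<in> L2 \<Omega> \<Longrightarrow> integrable (lebesgue_on \<Omega>) (\<lambda>x. (norm (f x))\<^sup>2)"
  by (simp add: L2_iff)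

lemma L2_norm_sqrt: "L2_norm \<Omega> f = sqrt (\<integral>x. (norm (f x))\<^sup>2 \<partial>lebesgue_on \<Omega>)"
  by (simp add: Lp_norm_def powr_two powr_half_sqrt)

lemma L2_norm_power2: "(L2_norm \<Omega> f)\<^sup>2 = (\<integral>x. (norm (f x))\<^sup>2 \<partial>lebesgue_on \<Omega>)"
  by (simp add: L2_norm_sqrt)

lemma L2_norm_nonneg: "0 \<le> L2_norm \<Omega> f"
  by (simp add: L2_norm_sqrt)

lemma L2_norm_tendsto_0_iff:
  "((\<lambda>n. L2_norm \<Omega> (f n)) \<longlonglongrightarrow> 0) \<longleftrightarrow> ((\<lambda>n. \<integral>x. (norm (f n x))\<^sup>2 \<partial>lebesgue_on \<Omega>) \<longlonglongrightarrow> 0)"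
proof
  assume "(\<lambda>n. L2_norm \<Omega> (f n)) \<longlonglongrightarrow> 0"
  then have "(\<lambda>n. (L2_norm \<Omega> (f n))\<^sup>2) \<longlonglongrightarrow> 0\<^sup>2" by (intro tendsto_power)
  then show "(\<lambda>n. \<integral>x. (norm (f n x))\<^sup>2 \<partial>lebesgue_on \<Omega>) \<longlonglongrightarrow> 0" by (simp add: L2_norm_power2)
next
  assume "(\<lambda>n. \<integral>x. (norm (f n x))\<^sup>2 \<partial>lebesgue_on \<Omega>) \<longlonglongrightarrow> 0"
  then have "(\<lambda>n. sqrt (\<integral>x. (norm (f n x))\<^sup>2 \<partial>lebesgue_on \<Omega>)) \<longlonglongrightarrow> sqrt 0" by (intro tendsto_real_sqrt)
  then show "(\<lambda>n. L2_norm \<Omega> (f n)) \<longlonglongrightarrow> 0" by (simp add: L2_norm_sqrt)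
qed

lemma norm_add_square_le: "(norm (a + b))\<^sup>2 \<le> 2 * (norm a)\<^sup>2 + 2 * (norm (b::'a::real_normed_vector))\<^sup>2"
proof -
  have "(norm (a + b))\<^sup>2 \<le> (norm a + norm b)\<^sup>2" by (simp add: norm_triangle_ineq power_mono)
  also have "\<dots> \<le> 2 * (norm a)\<^sup>2 + 2 * (norm b)\<^sup>2" using sum_squares_bound[of "norm a" "norm b"] by (simp add: power2_sum)
  finally show ?thesis .
qed

lemma L2_add: assumes "f \<in> L2 \<Omega>" "g \<in> L2 \<Omega>" shows "(\<lambda>x. f x + g x) \<in> L2 \<Omega>"
  unfolding L2_iff
proof
  have [measurable]: "f \<in> borel_measurable (lebesgue_on \<Omega>)" "g \<in> borel_measurable (lebesgue_on \<Omega>)"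
    using assms by (auto dest: Lp_measurable)
  show "(\<lambda>x. f x + g x) \<in> borel_measurable (lebesgue_on \<Omega>)" by measurable
  show "integrable (lebesgue_on \<Omega>) (\<lambda>x. (norm (f x + g x))\<^sup>2)"
  proof (rule Bochner_Integration.integrable_bound)
    show "integrable (lebesgue_on \<Omega>) (\<lambda>x. 2 * (norm (f x))\<^sup>2 + 2 * (norm (g x))\<^sup>2)"
      using assms by (auto dest!: L2_integrable_sq)
  qed (use norm_add_square_le in auto)
qed

lemma L2_scale: assumes "f \<in> L2 \<Omega>" shows "(\<lambda>x. c * f x) \<in> L2 \<Omega>"
  using assms by (auto simp: L2_iff norm_mult power_mult_distrib)

lemma cnj_measurable [measurable]: "cnj \<in> borel_measurable borel"
  by (intro borel_measurable_continuous_onI continuous_intros)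

lemma L2_cnj: assumes "f \<in> L2 \<Omega>" shows "(\<lambda>x. cnj (f x)) \<in> L2 \<Omega>"
proof -
  have [measurable]: "f \<in> borel_measurable (lebesgue_on \<Omega>)" using assms by (auto dest: Lp_measurable)
  show ?thesis using assms by (simp add: L2_iff)
qed

lemma L2_diff: assumes "f \<in> L2 \<Omega>" "g \<in> L2 \<Omega>" shows "(\<lambda>x. f x - g x) \<in> L2 \<Omega>"
  using L2_add[OF assms(1) L2_scale[OF assms(2), of "-1"]] by simp

lemma L2_zero: "(\<lambda>x. 0) \<in> L2 \<Omega>"
  by (simp add: L2_iff)

lemma L2_sum: "(\<And>i. i \<in> I \<Longrightarrow> f i \<in> L2 \<Omega>) \<Longrightarrow> (\<lambda>x. \<Sum>i\<in>I. f i x) \<in> L2 \<Omega>"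
  by (induction I rule: infinite_finite_induct) (auto intro: L2_add L2_zero)

lemma L2_mult_integrable:
  assumes "f \<in> L2 \<Omega>" "g \<in> L2 \<Omega>"
  shows "integrable (lebesgue_on \<Omega>) (\<lambda>x. f x * g x)"
proof (rule Bochner_Integration.integrable_bound)
  have [measurable]: "f \<in> borel_measurable (lebesgue_on \<Omega>)" "g \<in> borel_measurable (lebesgue_on \<Omega>)"
    using assms by (auto dest: Lp_measurable)
  show "integrable (lebesgue_on \<Omega>) (\<lambda>x. (norm (f x))\<^sup>2 + (norm (g x))\<^sup>2)"
    using assms by (auto dest!: L2_integrable_sq)
  show "(\<lambda>x. f x * g x) \<in> borel_measurable (lebesgue_on \<Omega>)" by measurable
  have "norm (f x) * norm (g x) \<le> (norm (f x))\<^sup>2 + (norm (g x))\<^sup>2" for x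
    using sum_squares_bound[of "norm (f x)" "norm (g x)"] mult_nonneg_nonneg[OF norm_ge_zero[of "f x"] norm_ge_zero[of "g x"]]
    by linarith
  then show "AE x in lebesgue_on \<Omega>. norm (f x * g x) \<le> norm ((norm (f x))\<^sup>2 + (norm (g x))\<^sup>2)"
    by (simp add: norm_mult)
qed

lemma L2_inner_integrable:
  assumes "f \<in> L2 \<Omega>" "g \<in> L2 \<Omega>"
  shows "integrable (lebesgue_on \<Omega>) (\<lambda>x. f x * cnj (g x))"
  by (rule L2_mult_integrable[OF assms(1) L2_cnj[OF assms(2)]])

lemma L2_inner_commute: "L2_inner \<Omega> g f = cnj (L2_inner \<Omega> f g)"
  unfolding L2_inner_def
  by (subst Bochner_Integration.integral_cnj[symmetric]) (simp add: mult.commute del: Bochner_Integration.integral_cnj)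

lemma L2_inner_scale_left: "L2_inner \<Omega> (\<lambda>x. c * f x) g = c * L2_inner \<Omega> f g"
  by (simp add: L2_inner_def mult.assoc)

lemma L2_inner_scale_right: "L2_inner \<Omega> f (\<lambda>x. c * g x) = cnj c * L2_inner \<Omega> f g"
  by (simp add: L2_inner_def mult.left_commute)

lemma L2_inner_add_left:
  assumes "f \<in> L2 \<Omega>" "g \<in> L2 \<Omega>" "h \<in> L2 \<Omega>"
  shows "L2_inner \<Omega> (\<lambda>x. f x + g x) h = L2_inner \<Omega> f h + L2_inner \<Omega> g h"
  using assms by (simp add: L2_inner_def ring_distribs L2_inner_integrable)

lemma L2_inner_diff_left:
  assumes "f \<in> L2 \<Omega>" "g \<in> L2 \<Omega>" "h \<in> L2 \<Omega>"
  shows "L2_inner \<Omega> (\<lambda>x. f x - g x) h = L2_inner \<Omega> f h - L2_inner \<Omega> g h"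
  using assms by (simp add: L2_inner_def ring_distribs L2_inner_integrable)

lemma L2_inner_sum_left:
  assumes "\<And>i. i \<in> I \<Longrightarrow> f i \<in> L2 \<Omega>" "h \<in> L2 \<Omega>"
  shows "L2_inner \<Omega> (\<lambda>x. \<Sum>i\<in>I. f i x) h = (\<Sum>i\<in>I. L2_inner \<Omega> (f i) h)"
  unfolding L2_inner_def sum_distrib_right
  by (rule Bochner_Integration.integral_sum) (use assms in \<open>auto intro: L2_inner_integrable\<close>)

lemma L2_inner_self: "L2_inner \<Omega> f f = of_real ((L2_norm \<Omega> f)\<^sup>2)"
  by (simp add: L2_inner_def L2_norm_power2 complex_norm_square[symmetric] flip: integral_complex_of_real)

lemma L2_norm_cong_AE:
  assumes "f \<in> borel_measurable (lebesgue_on \<Omega>)" "f' \<in> borel_measurable (lebesgue_on \<Omega>)"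
    and "AE x in lebesgue_on \<Omega>. f x = f' x"
  shows "L2_norm \<Omega> f = L2_norm \<Omega> f'"
proof -
  have "(\<integral>x. (norm (f x))\<^sup>2 \<partial>lebesgue_on \<Omega>) = (\<integral>x. (norm (f' x))\<^sup>2 \<partial>lebesgue_on \<Omega>)"
    by (rule integral_cong_AE) (use assms in auto)
  then show ?thesis by (simp add: L2_norm_sqrt)
qed

lemma L2_norm_scale: "L2_norm \<Omega> (\<lambda>x. c * f x) = norm c * L2_norm \<Omega> f"
  by (simp add: L2_norm_sqrt norm_mult power_mult_distrib real_sqrt_mult)

text \<open>Expanding \<open>0 \<le> \<parallel>B f - c g\<parallel>\<^sup>2\<close> with \<open>B = \<parallel>g\<parallel>\<^sup>2\<close> and \<open>c = \<langle>f, g\<rangle>\<close> gives the squared inequality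
  times \<open>\<parallel>g\<parallel>\<^sup>2\<close>; if \<open>\<parallel>g\<parallel> = 0\<close>, then \<open>g = 0\<close> almost everywhere.\<close>

lemma L2_Cauchy_Schwarz:
  assumes f: "f \<in> L2 \<Omega>" and g: "g \<in> L2 \<Omega>"
  shows "norm (L2_inner \<Omega> f g) \<le> L2_norm \<Omega> f * L2_norm \<Omega> g"
proof (cases "L2_norm \<Omega> g = 0")
  case True
  then have "(\<integral>x. (norm (g x))\<^sup>2 \<partial>lebesgue_on \<Omega>) = 0" by (simp add: L2_norm_sqrt)
  then have "AE x in lebesgue_on \<Omega>. (norm (g x))\<^sup>2 = 0"
    using integral_nonneg_eq_0_iff_AE[OF L2_integrable_sq[OF g]] by simp
  then have "AE x in lebesgue_on \<Omega>. f x * cnj (g x) = 0" by auto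
  then have "L2_inner \<Omega> f g = 0" unfolding L2_inner_def by (rule integral_eq_zero_AE)
  then show ?thesis by (simp add: True)
next
  case False
  define B where "B = (L2_norm \<Omega> g)\<^sup>2"
  define A where "A = (L2_norm \<Omega> f)\<^sup>2"
  define c where "c = L2_inner \<Omega> f g"
  have B: "B > 0" using False by (simp add: B_def)
  define h where "h = (\<lambda>x. of_real B * f x - c * g x)"
  have h: "h \<in> L2 \<Omega>" unfolding h_def by (intro L2_diff L2_scale f g)
  have "L2_inner \<Omega> h h = of_real B * L2_inner \<Omega> f h - c * L2_inner \<Omega> g h"
    using L2_inner_diff_left[OF L2_scale[OF f, of "of_real B"] L2_scale[OF g, of c] h]
    unfolding L2_inner_scale_left h_def .
  moreover have "L2_inner \<Omega> f h = cnj (of_real B * L2_inner \<Omega> f f - c * L2_inner \<Omega> g f)"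
    by (subst L2_inner_commute) (simp add: h_def L2_inner_diff_left L2_scale f g L2_inner_scale_left)
  moreover have "L2_inner \<Omega> g h = cnj (of_real B * L2_inner \<Omega> f g - c * L2_inner \<Omega> g g)"
    by (subst L2_inner_commute) (simp add: h_def L2_inner_diff_left L2_scale f g L2_inner_scale_left)
  moreover have "L2_inner \<Omega> g f = cnj c" "L2_inner \<Omega> f g = c" "L2_inner \<Omega> g g = of_real B" "L2_inner \<Omega> f f = of_real A"
    unfolding c_def B_def A_def L2_inner_self by (rule L2_inner_commute | rule refl)+
  ultimately have "L2_inner \<Omega> h h = of_real (B * (B * A - (norm c)\<^sup>2))"
    by (simp add: right_diff_distrib complex_norm_square mult.commute mult.left_commute del: of_real_power)
  then have "(L2_norm \<Omega> h)\<^sup>2 = B * (B * A - (norm c)\<^sup>2)"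
    unfolding L2_inner_self of_real_eq_iff by simp
  then have "0 \<le> B * (B * A - (norm c)\<^sup>2)" by (metis zero_le_power2)
  then have "(norm c)\<^sup>2 \<le> B * A" using B by (simp add: zero_le_mult_iff)
  then have "(norm c)\<^sup>2 \<le> (L2_norm \<Omega> f * L2_norm \<Omega> g)\<^sup>2" by (simp add: A_def B_def power_mult_distrib mult.commute)
  then show ?thesis unfolding c_def by (rule power2_le_imp_le) (simp add: L2_norm_nonneg)
qed

lemma L2_inner_tendsto:
  assumes f: "\<And>n. f n \<in> L2 \<Omega>" "f' \<in> L2 \<Omega>" and g: "g \<in> L2 \<Omega>"
    and lim: "(\<lambda>n. L2_norm \<Omega> (\<lambda>x. f n x - f' x)) \<longlonglongrightarrow> 0"
  shows "(\<lambda>n. L2_inner \<Omega> (f n) g) \<longlonglongrightarrow> L2_inner \<Omega> f' g"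
proof -
  have "(\<lambda>n. L2_norm \<Omega> (\<lambda>x. f n x - f' x) * L2_norm \<Omega> g) \<longlonglongrightarrow> 0"
    using tendsto_mult_right[OF lim, of "L2_norm \<Omega> g"] by simp
  then have "(\<lambda>n. L2_inner \<Omega> (f n) g - L2_inner \<Omega> f' g) \<longlonglongrightarrow> 0"
  proof (rule Lim_null_comparison[rotated], intro always_eventually allI)
    fix n
    show "norm (L2_inner \<Omega> (f n) g - L2_inner \<Omega> f' g) \<le> L2_norm \<Omega> (\<lambda>x. f n x - f' x) * L2_norm \<Omega> g"
      using L2_Cauchy_Schwarz[OF L2_diff[OF f(1)[of n] f(2)] g] by (simp add: L2_inner_diff_left f g)
  qed
  then show ?thesis by (simp add: LIM_zero_iff)
qed

lemma L2_inner_tendsto_right: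
  assumes f: "\<And>n. f n \<in> L2 \<Omega>" "f' \<in> L2 \<Omega>" and g: "g \<in> L2 \<Omega>"
    and lim: "(\<lambda>n. L2_norm \<Omega> (\<lambda>x. f n x - f' x)) \<longlonglongrightarrow> 0"
  shows "(\<lambda>n. L2_inner \<Omega> g (f n)) \<longlonglongrightarrow> L2_inner \<Omega> g f'"
  using tendsto_cnj[OF L2_inner_tendsto[OF assms]] by (simp flip: L2_inner_commute)

lemma finite_measure_lebesgue_on: "\<Omega> \<in> lmeasurable \<Longrightarrow> finite_measure (lebesgue_on \<Omega>)"
  by (rule finite_measureI) (auto simp: emeasure_restrict_space fmeasurable_def less_top)

lemma Lp_bounded:
  assumes "\<Omega> \<in> lmeasurable" "0 \<le> p" "f \<in> borel_measurable (lebesgue_on \<Omega>)" "\<And>x. x \<in> \<Omega> \<Longrightarrow> norm (f x) \<le> B"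
  shows "f \<in> Lp p \<Omega>"
proof -
  interpret finite_measure "lebesgue_on \<Omega>" by (rule finite_measure_lebesgue_on[OF assms(1)])
  have "integrable (lebesgue_on \<Omega>) (\<lambda>x. norm (f x) powr p)"
    by (rule integrable_const_bound[where B="B powr p"])
       (use assms in \<open>auto simp: powr_mono2\<close>)
  then show ?thesis using assms by (simp add: Lp_def)
qed

lemma L2_tendsto_dominated:
  fixes f :: "nat \<Rightarrow> 'a::euclidean_space \<Rightarrow> complex"
  assumes \<Omega>: "\<Omega> \<in> lmeasurable" and f: "\<And>n. f n \<in> borel_measurable (lebesgue_on \<Omega>)" 
    and g: "g \<in> borel_measurable (lebesgue_on \<Omega>)"
    and B: "\<And>n x. x \<in> \<Omega> \<Longrightarrow> norm (f n x - g x) \<le> B"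
    and lim: "AE x in lebesgue_on \<Omega>. (\<lambda>n. f n x) \<longlonglongrightarrow> g x"
  shows "(\<lambda>n. L2_norm \<Omega> (\<lambda>x. f n x - g x)) \<longlonglongrightarrow> 0"
proof -
  interpret finite_measure "lebesgue_on \<Omega>" by (rule finite_measure_lebesgue_on[OF \<Omega>])
  have "(\<lambda>n. \<integral>x. (norm (f n x - g x))\<^sup>2 \<partial>lebesgue_on \<Omega>) \<longlonglongrightarrow> (\<integral>x. 0 \<partial>lebesgue_on \<Omega>)"
  proof (rule integral_dominated_convergence[where w="\<lambda>x. B\<^sup>2"])
    show "AE x in lebesgue_on \<Omega>. (\<lambda>n. (norm (f n x - g x))\<^sup>2) \<longlonglongrightarrow> 0"
      using lim by eventually_elim (use LIM_zero tendsto_norm_zero tendsto_power[where n=2] in fastforce)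
    show "AE x in lebesgue_on \<Omega>. norm ((norm (f n x - g x))\<^sup>2) \<le> B\<^sup>2" for n
      by (auto intro!: AE_I2 power_mono B)
  qed (use f g in auto)
  then show ?thesis by (simp add: L2_norm_tendsto_0_iff)
qed

section \<open>Orthonormal systems\<close>

definition orthonormal_L2 :: "'a::euclidean_space set \<Rightarrow> (nat \<Rightarrow> 'a \<Rightarrow> complex) \<Rightarrow> bool" where
  "orthonormal_L2 \<Omega> e \<longleftrightarrow> (\<forall>k. e k \<in> L2 \<Omega>) \<and> (\<forall>j k. L2_inner \<Omega> (e j) (e k) = (if j = k then 1 else 0))"

definition complete_L2 :: "'a::euclidean_space set \<Rightarrow> (nat \<Rightarrow> 'a \<Rightarrow> complex) \<Rightarrow> bool" where
  "complete_L2 \<Omega> e \<longleftrightarrow> (\<forall>f\<in>L2 \<Omega>. (\<forall>k. L2_inner \<Omega> f (e k) = 0) \<longrightarrow> (AE x in lebesgue_on \<Omega>. f x = 0))"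

lemma orthonormal_L2_mem: "orthonormal_L2 \<Omega> e \<Longrightarrow> (\<lambda>x. \<Sum>k\<in>I. a k * e k x) \<in> L2 \<Omega>"
  by (intro L2_sum L2_scale) (simp add: orthonormal_L2_def)

lemma orthonormal_inner_sum_left:
  assumes e: "orthonormal_L2 \<Omega> e" and "finite I" and g: "g \<in> L2 \<Omega>"
  shows "L2_inner \<Omega> (\<lambda>x. \<Sum>k\<in>I. a k * e k x) g = (\<Sum>k\<in>I. a k * L2_inner \<Omega> (e k) g)"
  using e g by (subst L2_inner_sum_left) (auto simp: orthonormal_L2_def L2_scale L2_inner_scale_left)

lemma orthonormal_coeff_sum:
  assumes e: "orthonormal_L2 \<Omega> e" and I: "finite I"
  shows "L2_inner \<Omega> (\<lambda>x. \<Sum>k\<in>I. a k * e k x) (e j) = (if j \<in> I then a j else 0)"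
proof -
  have "L2_inner \<Omega> (\<lambda>x. \<Sum>k\<in>I. a k * e k x) (e j) = (\<Sum>k\<in>I. a k * (if k = j then 1 else 0))"
    using e by (subst orthonormal_inner_sum_left[OF e I]) (auto simp: orthonormal_L2_def)
  also have "\<dots> = (\<Sum>k\<in>I. if k = j then a k else 0)" by (rule sum.cong) auto
  finally show ?thesis using I by (simp add: sum.delta')
qed

lemma orthonormal_norm_sum:
  assumes e: "orthonormal_L2 \<Omega> e" and I: "finite I"
  shows "(L2_norm \<Omega> (\<lambda>x. \<Sum>k\<in>I. a k * e k x))\<^sup>2 = (\<Sum>k\<in>I. (norm (a k))\<^sup>2)"
proof -
  let ?s = "\<lambda>x. \<Sum>k\<in>I. a k * e k x"
  have s: "?s \<in> L2 \<Omega>" by (rule orthonormal_L2_mem[OF e])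
  have "complex_of_real ((L2_norm \<Omega> ?s)\<^sup>2) = (\<Sum>k\<in>I. a k * L2_inner \<Omega> (e k) ?s)"
    unfolding L2_inner_self[symmetric] by (rule orthonormal_inner_sum_left[OF e I s])
  also have "\<dots> = (\<Sum>k\<in>I. complex_of_real ((norm (a k))\<^sup>2))"
  proof (rule sum.cong)
    fix k assume "k \<in> I"
    then have "L2_inner \<Omega> (e k) ?s = cnj (a k)"
      by (subst L2_inner_commute) (simp add: orthonormal_coeff_sum[OF e I])
    then show "a k * L2_inner \<Omega> (e k) ?s = complex_of_real ((norm (a k))\<^sup>2)"
      by (simp only: complex_norm_square)
  qed simp
  finally show ?thesis by (simp only: of_real_sum[symmetric] of_real_eq_iff)
qed

text \<open>With \<open>s\<close> the partial sum of the expansion, \<open>\<parallel>s\<parallel>\<^sup>2 = \<langle>s, f\<rangle> \<le> \<parallel>s\<parallel> \<parallel>f\<parallel>\<close>.\<close>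

lemma Bessel:
  assumes e: "orthonormal_L2 \<Omega> e" and f: "f \<in> L2 \<Omega>"
  shows "(\<Sum>k<n. (norm (L2_inner \<Omega> f (e k)))\<^sup>2) \<le> (L2_norm \<Omega> f)\<^sup>2"
proof -
  define s where "s = (\<lambda>x. \<Sum>k<n. L2_inner \<Omega> f (e k) * e k x)"
  define B where "B = (\<Sum>k<n. (norm (L2_inner \<Omega> f (e k)))\<^sup>2)"
  have s: "s \<in> L2 \<Omega>" unfolding s_def by (rule orthonormal_L2_mem[OF e])
  have "L2_inner \<Omega> s f = (\<Sum>k<n. L2_inner \<Omega> f (e k) * L2_inner \<Omega> (e k) f)"
    unfolding s_def by (rule orthonormal_inner_sum_left[OF e _ f]) simp
  also have "\<dots> = (\<Sum>k<n. of_real ((norm (L2_inner \<Omega> f (e k)))\<^sup>2))"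
    by (rule sum.cong[OF refl], subst L2_inner_commute) (simp only: complex_norm_square)
  also have "\<dots> = of_real B" unfolding B_def by simp
  finally have "norm (L2_inner \<Omega> s f) = \<bar>B\<bar>" by simp
  moreover have "(L2_norm \<Omega> s)\<^sup>2 = B" unfolding s_def B_def by (rule orthonormal_norm_sum[OF e]) simp
  moreover have "norm (L2_inner \<Omega> s f) \<le> L2_norm \<Omega> s * L2_norm \<Omega> f" by (rule L2_Cauchy_Schwarz[OF s f])
  ultimately have "L2_norm \<Omega> s * L2_norm \<Omega> s \<le> L2_norm \<Omega> s * L2_norm \<Omega> f" by (simp add: power2_eq_square)
  then have "L2_norm \<Omega> s \<le> L2_norm \<Omega> f"
    using L2_norm_nonneg[of \<Omega> s] L2_norm_nonneg[of \<Omega> f] by (cases "L2_norm \<Omega> s = 0") auto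
  then have "(L2_norm \<Omega> s)\<^sup>2 \<le> (L2_norm \<Omega> f)\<^sup>2" by (intro power_mono L2_norm_nonneg)
  then show ?thesis using \<open>(L2_norm \<Omega> s)\<^sup>2 = B\<close> by (simp add: B_def)
qed

lemma Bessel_summable:
  assumes e: "orthonormal_L2 \<Omega> e" and f: "f \<in> L2 \<Omega>"
  shows "summable (\<lambda>k. (norm (L2_inner \<Omega> f (e k)))\<^sup>2)"
  by (rule summableI_nonneg_bounded[where x="(L2_norm \<Omega> f)\<^sup>2"]) (auto intro: Bessel[OF e f])

lemma L1_le_L2_norm:
  assumes \<Omega>: "\<Omega> \<in> lmeasurable" and f: "f \<in> L2 \<Omega>"
  shows "integrable (lebesgue_on \<Omega>) f" "(\<integral>x. norm (f x) \<partial>lebesgue_on \<Omega>) \<le> sqrt (measure lebesgue \<Omega>) * L2_norm \<Omega> f"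
proof -
  have one: "(\<lambda>x. 1) \<in> L2 \<Omega>" by (rule Lp_bounded[OF \<Omega>, where B=1]) auto
  show "integrable (lebesgue_on \<Omega>) f" using L2_mult_integrable[OF one f] by simp
  have nf: "(\<lambda>x. complex_of_real (norm (f x))) \<in> L2 \<Omega>" using f by (auto simp: L2_iff)
  have n1: "L2_norm \<Omega> (\<lambda>x. 1) = sqrt (measure lebesgue \<Omega>)"
    using \<Omega> by (auto simp: L2_norm_sqrt measure_restrict_space fmeasurableD)
  have "L2_inner \<Omega> (\<lambda>x. complex_of_real (norm (f x))) (\<lambda>x. 1) = of_real (\<integral>x. norm (f x) \<partial>lebesgue_on \<Omega>)"
    by (simp add: L2_inner_def)
  then have "\<bar>\<integral>x. norm (f x) \<partial>lebesgue_on \<Omega>\<bar> \<le> L2_norm \<Omega> (\<lambda>x. complex_of_real (norm (f x))) * L2_norm \<Omega> (\<lambda>x. 1)"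
    using L2_Cauchy_Schwarz[OF nf one] by simp
  moreover have "L2_norm \<Omega> (\<lambda>x. complex_of_real (norm (f x))) = L2_norm \<Omega> f" by (simp add: L2_norm_sqrt)
  ultimately show "(\<integral>x. norm (f x) \<partial>lebesgue_on \<Omega>) \<le> sqrt (measure lebesgue \<Omega>) * L2_norm \<Omega> f"
    by (simp add: n1 mult.commute)
qed

text \<open>A subsequence of partial sums whose increments have \<open>L\<^sup>2\<close> norm at most \<open>2\<^sup>-\<^sup>i\<close> converges
  absolutely almost everywhere, because the increments are summable in \<open>L\<^sup>1\<close>; Fatou's lemma
  then bounds the distance of the pointwise limit to each partial sum by the tail of \<open>a\<close>.\<close>

theorem Riesz_Fischer:
  assumes \<Omega>: "\<Omega> \<in> lmeasurable" and e: "orthonormal_L2 \<Omega> e" and a: "summable (\<lambda>k. (norm (a k))\<^sup>2)"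
  shows "\<exists>f\<in>L2 \<Omega>. (\<lambda>n. L2_norm \<Omega> (\<lambda>x. (\<Sum>k<n. a k * e k x) - f x)) \<longlonglongrightarrow> 0"
proof -
  define t where "t = (\<lambda>n. \<Sum>k<n. (norm (a k))\<^sup>2)"
  define s where "s = (\<Sum>k. (norm (a k))\<^sup>2)"
  have t_lim: "t \<longlonglongrightarrow> s" unfolding t_def s_def using a by (rule summable_LIMSEQ)
  have t_le: "t n \<le> s" for n unfolding t_def s_def by (rule sum_le_suminf[OF a]) auto
  define S where "S = (\<lambda>n x. \<Sum>k<n. a k * e k x)"
  have S: "S n \<in> L2 \<Omega>" for n unfolding S_def by (rule orthonormal_L2_mem[OF e])
  have S_meas[measurable]: "S n \<in> borel_measurable (lebesgue_on \<Omega>)" for n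
    using S by (rule Lp_measurable)
  have S_diff: "S n x - S m x = (\<Sum>k\<in>{m..<n}. a k * e k x)" if "m \<le> n" for m n x
    unfolding S_def using sum_diff_nat_ivl[of 0 m n "\<lambda>k. a k * e k x"] that by (simp add: lessThan_atLeast0)
  have t_diff: "t n - t m = (\<Sum>k\<in>{m..<n}. (norm (a k))\<^sup>2)" if "m \<le> n" for m n
    unfolding t_def using sum_diff_nat_ivl[of 0 m n "\<lambda>k. (norm (a k))\<^sup>2"] that by (simp add: lessThan_atLeast0)
  have S_norm: "(L2_norm \<Omega> (\<lambda>x. S n x - S m x))\<^sup>2 \<le> s - t m" if "m \<le> n" for m n
  proof -
    have "(L2_norm \<Omega> (\<lambda>x. S n x - S m x))\<^sup>2 = t n - t m"
      unfolding S_diff[OF that] t_diff[OF that] by (rule orthonormal_norm_sum[OF e]) simp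
    then show ?thesis using t_le[of n] by simp
  qed
  have "\<exists>N. \<forall>n\<ge>N. s - t n \<le> (1/4)^i" for i
  proof -
    have "eventually (\<lambda>n. s - (1/4)^i < t n) sequentially"
      by (rule order_tendstoD(1)[OF t_lim]) simp
    then obtain N where N: "\<And>n. n \<ge> N \<Longrightarrow> s - (1/4)^i < t n" unfolding eventually_sequentially by blast
    have "s - t n \<le> (1/4)^i" if "n \<ge> N" for n using N[OF that] by linarith
    then show ?thesis by blast
  qed
  then obtain R where R: "s - t n \<le> (1/4)^i" if "n \<ge> R i" for i n by metis
  \<comment> \<open>the sum makes \<open>r\<close> increasing and at least \<open>R\<close>, the last summand makes it unbounded\<close>
  define r where "r = (\<lambda>i. (\<Sum>j\<le>i. R j) + i)"
  have r_ge: "r i \<ge> R i" "r i \<ge> i" for i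
    unfolding r_def using member_le_sum[of i "{..i}" R] by auto
  have r_mono: "r i \<le> r (Suc i)" for i unfolding r_def by simp
  define D where "D = (\<lambda>i x. S (r (Suc i)) x - S (r i) x)"
  have D: "D i \<in> L2 \<Omega>" for i unfolding D_def by (intro L2_diff S)
  have D_meas[measurable]: "D i \<in> borel_measurable (lebesgue_on \<Omega>)" for i
    using D by (rule Lp_measurable)
  define K where "K = sqrt (measure lebesgue \<Omega>)"
  have D_norm: "(\<integral>x. norm (D i x) \<partial>lebesgue_on \<Omega>) \<le> K * (1/2)^i" for i
  proof -
    have "(L2_norm \<Omega> (D i))\<^sup>2 \<le> (1/4)^i"
      using S_norm[OF r_mono] R[OF r_ge(1)] unfolding D_def by (rule order_trans)
    also have "(1/4::real)^i = ((1/2)^i)\<^sup>2" by (simp add: power2_eq_square flip: power_mult_distrib)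
    finally have "L2_norm \<Omega> (D i) \<le> (1/2)^i" by (rule power2_le_imp_le) simp
    then show ?thesis using L1_le_L2_norm(2)[OF \<Omega> D[of i]]
      by (smt (verit) K_def mult_left_mono measure_nonneg real_sqrt_ge_zero)
  qed
  have AE_sum: "AE x in lebesgue_on \<Omega>. summable (\<lambda>i. norm (D i x))"
  proof -
    have "(\<integral>\<^sup>+x. (\<Sum>i. ennreal (norm (D i x))) \<partial>lebesgue_on \<Omega>) = (\<Sum>i. \<integral>\<^sup>+x. ennreal (norm (D i x)) \<partial>lebesgue_on \<Omega>)"
      by (rule nn_integral_suminf) measurable
    also have "\<dots> \<le> (\<Sum>i. ennreal (K * (1/2)^i))"
    proof (rule suminf_le)
      fix i
      have "(\<integral>\<^sup>+x. ennreal (norm (D i x)) \<partial>lebesgue_on \<Omega>) = ennreal (\<integral>x. norm (D i x) \<partial>lebesgue_on \<Omega>)"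
        by (rule nn_integral_eq_integral) (auto intro!: integrable_norm L1_le_L2_norm(1)[OF \<Omega> D])
      then show "(\<integral>\<^sup>+x. ennreal (norm (D i x)) \<partial>lebesgue_on \<Omega>) \<le> ennreal (K * (1/2)^i)"
        by (simp add: D_norm ennreal_leI)
    qed auto
    also have "\<dots> = ennreal (\<Sum>i. K * (1/2)^i)"
      by (rule suminf_ennreal2) (auto simp: K_def intro!: summable_mult summable_geometric)
    also have "\<dots> < \<infinity>" by simp
    finally have "(\<integral>\<^sup>+x. (\<Sum>i. ennreal (norm (D i x))) \<partial>lebesgue_on \<Omega>) \<noteq> \<infinity>" by auto
    then have "AE x in lebesgue_on \<Omega>. (\<Sum>i. ennreal (norm (D i x))) \<noteq> \<infinity>"
      by (intro nn_integral_PInf_AE) auto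
    then show ?thesis
      by eventually_elim (rule summable_suminf_not_top, auto)
  qed
  define f where "f = (\<lambda>x. S (r 0) x + (\<Sum>i. D i x))"
  have f_meas[measurable]: "f \<in> borel_measurable (lebesgue_on \<Omega>)" unfolding f_def by measurable
  have S_eq: "S (r i) x = S (r 0) x + (\<Sum>j<i. D j x)" for i x
    using sum_lessThan_telescope[of "\<lambda>j. S (r j) x" i] by (simp add: D_def)
  have AE_lim: "AE x in lebesgue_on \<Omega>. (\<lambda>i. S (r i) x) \<longlonglongrightarrow> f x"
    using AE_sum
  proof eventually_elim
    case (elim x)
    have "(\<lambda>i. S (r 0) x + (\<Sum>j<i. D j x)) \<longlonglongrightarrow> f x"
      unfolding f_def by (intro tendsto_add tendsto_const summable_LIMSEQ summable_norm_cancel[OF elim])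
    then show ?case by (simp only: S_eq[symmetric])
  qed
  have Fatou: "(\<integral>\<^sup>+x. ennreal ((norm (S n x - f x))\<^sup>2) \<partial>lebesgue_on \<Omega>) \<le> ennreal (s - t n)" for n
  proof -
    have "(\<integral>\<^sup>+x. ennreal ((norm (S n x - f x))\<^sup>2) \<partial>lebesgue_on \<Omega>)
        = (\<integral>\<^sup>+x. liminf (\<lambda>i. ennreal ((norm (S n x - S (r i) x))\<^sup>2)) \<partial>lebesgue_on \<Omega>)"
    proof (rule nn_integral_cong_AE, use AE_lim in eventually_elim)
      case (elim x)
      then have "(\<lambda>i. ennreal ((norm (S n x - S (r i) x))\<^sup>2)) \<longlonglongrightarrow> ennreal ((norm (S n x - f x))\<^sup>2)"
        by (intro tendsto_intros) 
      then show ?case by (rule lim_imp_Liminf[symmetric, rotated]) simp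
    qed
    also have "\<dots> \<le> liminf (\<lambda>i. \<integral>\<^sup>+x. ennreal ((norm (S n x - S (r i) x))\<^sup>2) \<partial>lebesgue_on \<Omega>)"
      by (rule nn_integral_liminf) measurable
    also have "\<dots> \<le> liminf (\<lambda>i. ennreal (s - t n))"
    proof (rule Liminf_mono, rule eventually_sequentiallyI)
      fix i assume "n \<le> i"
      then have n: "n \<le> r i" using r_ge(2)[of i] by simp
      have "(\<integral>\<^sup>+x. ennreal ((norm (S n x - S (r i) x))\<^sup>2) \<partial>lebesgue_on \<Omega>)
          = ennreal (\<integral>x. (norm (S n x - S (r i) x))\<^sup>2 \<partial>lebesgue_on \<Omega>)"
        by (rule nn_integral_eq_integral) (auto intro!: L2_integrable_sq L2_diff S)
      also have "\<dots> \<le> ennreal (s - t n)"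
        using S_norm[OF n] by (intro ennreal_leI) (simp add: L2_norm_power2 norm_minus_commute)
      finally show "(\<integral>\<^sup>+x. ennreal ((norm (S n x - S (r i) x))\<^sup>2) \<partial>lebesgue_on \<Omega>) \<le> ennreal (s - t n)" .
    qed
    also have "\<dots> = ennreal (s - t n)" by (rule Liminf_const) simp
    finally show ?thesis .
  qed
  have diff: "(\<lambda>x. S n x - f x) \<in> L2 \<Omega>" for n
    unfolding L2_iff
  proof
    have "(\<integral>\<^sup>+x. ennreal ((norm (S n x - f x))\<^sup>2) \<partial>lebesgue_on \<Omega>) < \<infinity>"
      using Fatou[of n] by (simp add: le_less_trans[OF _ ennreal_less_top])
    then show "integrable (lebesgue_on \<Omega>) (\<lambda>x. (norm (S n x - f x))\<^sup>2)"
      by (intro integrableI_nonneg) auto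
  qed measurable
  have "f \<in> L2 \<Omega>" using L2_diff[OF S[of 0] diff[of 0]] by simp
  moreover have "(\<lambda>n. L2_norm \<Omega> (\<lambda>x. S n x - f x)) \<longlonglongrightarrow> 0"
    unfolding L2_norm_tendsto_0_iff
  proof (rule tendsto_sandwich[where f="\<lambda>_. 0" and h="\<lambda>n. s - t n"])
    show "(\<lambda>n. s - t n) \<longlonglongrightarrow> 0" using tendsto_diff[OF tendsto_const[of s] t_lim] by simp
    show "\<forall>\<^sub>F n in sequentially. (\<integral>x. (norm (S n x - f x))\<^sup>2 \<partial>lebesgue_on \<Omega>) \<le> s - t n"
    proof (intro always_eventually allI)
      fix n
      have "ennreal (\<integral>x. (norm (S n x - f x))\<^sup>2 \<partial>lebesgue_on \<Omega>) \<le> ennreal (s - t n)"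
        using Fatou[of n] by (subst nn_integral_eq_integral[symmetric]) (auto intro!: L2_integrable_sq diff)
      then show "(\<integral>x. (norm (S n x - f x))\<^sup>2 \<partial>lebesgue_on \<Omega>) \<le> s - t n" using t_le[of n] by (simp add: ennreal_le_iff)
    qed
  qed auto
  ultimately show ?thesis unfolding S_def by blast
qed

lemma L2_limit_coeff:
  assumes e: "orthonormal_L2 \<Omega> e" and f: "f \<in> L2 \<Omega>"
    and lim: "(\<lambda>n. L2_norm \<Omega> (\<lambda>x. (\<Sum>k<n. a k * e k x) - f x)) \<longlonglongrightarrow> 0"
  shows "L2_inner \<Omega> f (e j) = a j"
proof -
  have "(\<lambda>n. L2_inner \<Omega> (\<lambda>x. \<Sum>k<n. a k * e k x) (e j)) \<longlonglongrightarrow> L2_inner \<Omega> f (e j)"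
    by (rule L2_inner_tendsto[OF orthonormal_L2_mem[OF e] f _ lim]) (use e in \<open>simp add: orthonormal_L2_def\<close>)
  moreover have "(\<lambda>n. L2_inner \<Omega> (\<lambda>x. \<Sum>k<n. a k * e k x) (e j)) \<longlonglongrightarrow> a j"
    by (rule tendsto_eventually, rule eventually_sequentiallyI[of "Suc j"])
       (simp add: orthonormal_coeff_sum[OF e])
  ultimately show ?thesis by (rule LIMSEQ_unique)
qed

lemma L2_limit_norm:
  assumes e: "orthonormal_L2 \<Omega> e" and f: "f \<in> L2 \<Omega>"
    and lim: "(\<lambda>n. L2_norm \<Omega> (\<lambda>x. (\<Sum>k<n. a k * e k x) - f x)) \<longlonglongrightarrow> 0"
  shows "(\<lambda>k. (norm (a k))\<^sup>2) sums (L2_norm \<Omega> f)\<^sup>2"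
proof -
  have "(\<lambda>n. L2_inner \<Omega> (\<lambda>x. \<Sum>k<n. a k * e k x) f) \<longlonglongrightarrow> L2_inner \<Omega> f f"
    by (rule L2_inner_tendsto[OF orthonormal_L2_mem[OF e] f f lim])
  moreover have "L2_inner \<Omega> (\<lambda>x. \<Sum>k<n. a k * e k x) f = of_real (\<Sum>k<n. (norm (a k))\<^sup>2)" for n
  proof -
    have "L2_inner \<Omega> (e k) f = cnj (a k)" for k
      by (subst L2_inner_commute) (simp add: L2_limit_coeff[OF e f lim])
    then show ?thesis by (simp add: orthonormal_inner_sum_left[OF e _ f] complex_norm_square del: of_real_power)
  qed
  ultimately show ?thesis unfolding sums_def L2_inner_self by (simp only: tendsto_of_real_iff)
qed

text \<open>The limit provided by \<open>Riesz_Fischer\<close> has the same coefficients as \<open>u\<close>, so completeness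
  identifies it with \<open>u\<close>.\<close>

theorem orthonormal_expansion:
  assumes \<Omega>: "\<Omega> \<in> lmeasurable" and e: "orthonormal_L2 \<Omega> e" and c: "complete_L2 \<Omega> e" and u: "u \<in> L2 \<Omega>"
  shows "(\<lambda>n. L2_norm \<Omega> (\<lambda>x. (\<Sum>k<n. L2_inner \<Omega> u (e k) * e k x) - u x)) \<longlonglongrightarrow> 0"
proof -
  obtain f where f: "f \<in> L2 \<Omega>" and lim: "(\<lambda>n. L2_norm \<Omega> (\<lambda>x. (\<Sum>k<n. L2_inner \<Omega> u (e k) * e k x) - f x)) \<longlonglongrightarrow> 0"
    using Riesz_Fischer[OF \<Omega> e Bessel_summable[OF e u]] by auto
  have ek: "e k \<in> L2 \<Omega>" for k using e by (simp add: orthonormal_L2_def)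
  have "L2_inner \<Omega> (\<lambda>x. f x - u x) (e k) = 0" for k
    by (simp add: L2_inner_diff_left f u ek L2_limit_coeff[OF e f lim])
  then have ae: "AE x in lebesgue_on \<Omega>. f x - u x = 0"
    using c L2_diff[OF f u] unfolding complete_L2_def by blast
  have m: "(\<lambda>x. \<Sum>k<n. L2_inner \<Omega> u (e k) * e k x) \<in> borel_measurable (lebesgue_on \<Omega>)" for n
    by (rule Lp_measurable[OF orthonormal_L2_mem[OF e]])
  have "L2_norm \<Omega> (\<lambda>x. (\<Sum>k<n. L2_inner \<Omega> u (e k) * e k x) - f x) = L2_norm \<Omega> (\<lambda>x. (\<Sum>k<n. L2_inner \<Omega> u (e k) * e k x) - u x)" for n
    by (rule L2_norm_cong_AE) (use ae m[of n] Lp_measurable[OF f] Lp_measurable[OF u] in \<open>auto intro!: borel_measurable_diff\<close>)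
  then show ?thesis using lim by simp
qed

section \<open>Lebesgue spaces on domains of finite measure\<close>

lemma Lp_norm_nonneg: "0 \<le> Lp_norm p \<Omega> f"
  by (simp add: Lp_norm_def)

lemma Lp_norm_powr: "0 < p \<Longrightarrow> Lp_norm p \<Omega> f powr p = (\<integral>x. norm (f x) powr p \<partial>lebesgue_on \<Omega>)"
  by (simp add: Lp_norm_def powr_powr)

lemma Lp_integrable: "f \<in> Lp p \<Omega> \<Longrightarrow> integrable (lebesgue_on \<Omega>) (\<lambda>x. norm (f x) powr p)"
  by (simp add: Lp_def)

lemma Lp_norm_leI:
  assumes "0 < p" "0 \<le> B" "(\<integral>x. norm (f x) powr p \<partial>lebesgue_on \<Omega>) \<le> B powr p"
  shows "Lp_norm p \<Omega> f \<le> B"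
proof -
  have "Lp_norm p \<Omega> f \<le> (B powr p) powr (1/p)"
    unfolding Lp_norm_def using assms by (intro powr_mono2) auto
  then show ?thesis using assms by (simp add: powr_powr)
qed

lemma Lp_scale: "f \<in> Lp p \<Omega> \<Longrightarrow> (\<lambda>x. c * f x) \<in> Lp p \<Omega>"
  by (auto simp: Lp_def norm_mult powr_mult)

lemma Lp_norm_scale: "0 < p \<Longrightarrow> Lp_norm p \<Omega> (\<lambda>x. c * f x) = norm c * Lp_norm p \<Omega> f"
  by (simp add: Lp_norm_def norm_mult powr_mult powr_powr)

lemma powr_add_le:
  fixes a b :: real
  assumes "0 \<le> a" "0 \<le> b" "0 \<le> p"
  shows "(a + b) powr p \<le> 2 powr p * (a powr p + b powr p)"
proof -
  have "(a + b) powr p \<le> (2 * max a b) powr p"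
    using assms by (intro powr_mono2) auto
  also have "\<dots> = 2 powr p * (max a b) powr p"
    using assms by (intro powr_mult) 
  also have "(max a b) powr p \<le> a powr p + b powr p"
    by (auto simp: max_def)
  finally show ?thesis by simp
qed

text \<open>Minkowski's inequality with the constant 4 in place of 1.  A bound on an operator norm
  tolerates the larger constant, which follows from \<open>(a + b)\<^sup>p \<le> 2\<^sup>p (a\<^sup>p + b\<^sup>p)\<close>.\<close>

lemma Lp_quasi_triangle:
  assumes p: "1 \<le> p" and f: "f \<in> Lp p \<Omega>" and g: "g \<in> Lp p \<Omega>"
  shows "(\<lambda>x. f x + g x) \<in> Lp p \<Omega>"
    and "Lp_norm p \<Omega> (\<lambda>x. f x + g x) \<le> 4 * (Lp_norm p \<Omega> f + Lp_norm p \<Omega> g)"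
proof -
  have [measurable]: "f \<in> borel_measurable (lebesgue_on \<Omega>)" "g \<in> borel_measurable (lebesgue_on \<Omega>)"
    using f g by (auto dest: Lp_measurable)
  note fi = Lp_integrable[OF f] and gi = Lp_integrable[OF g]
  have le: "norm (f x + g x) powr p \<le> 2 powr p * (norm (f x) powr p + norm (g x) powr p)" for x
  proof -
    have "norm (f x + g x) powr p \<le> (norm (f x) + norm (g x)) powr p"
      using p by (intro powr_mono2 norm_triangle_ineq) auto
    also have "\<dots> \<le> 2 powr p * (norm (f x) powr p + norm (g x) powr p)"
      using p by (intro powr_add_le) auto
    finally show ?thesis .
  qed
  have i: "integrable (lebesgue_on \<Omega>) (\<lambda>x. norm (f x + g x) powr p)"
    by (rule Bochner_Integration.integrable_bound[of _ "\<lambda>x. 2 powr p * (norm (f x) powr p + norm (g x) powr p)"])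
       (use fi gi le in auto)
  then show "(\<lambda>x. f x + g x) \<in> Lp p \<Omega>" by (simp add: Lp_def)
  define m where "m = Lp_norm p \<Omega> f + Lp_norm p \<Omega> g"
  have m: "0 \<le> m" "Lp_norm p \<Omega> f \<le> m" "Lp_norm p \<Omega> g \<le> m" by (simp_all add: m_def Lp_norm_nonneg)
  have "(\<integral>x. norm (f x + g x) powr p \<partial>lebesgue_on \<Omega>)
      \<le> (\<integral>x. 2 powr p * (norm (f x) powr p + norm (g x) powr p) \<partial>lebesgue_on \<Omega>)"
    by (rule integral_mono) (use i fi gi le in auto)
  also have "\<dots> = 2 powr p * (Lp_norm p \<Omega> f powr p + Lp_norm p \<Omega> g powr p)"
    using fi gi p by (simp add: Lp_norm_powr)
  also have "\<dots> \<le> 2 powr p * (m powr p + m powr p)"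
    using m p by (intro mult_left_mono add_mono powr_mono2) (auto simp: Lp_norm_nonneg)
  also have "\<dots> \<le> 2 powr p * (2 powr p * m powr p)"
    using powr_mono[of 1 p 2] p by (intro mult_left_mono) (auto intro!: mult_right_mono simp flip: mult_2)
  also have "\<dots> = (4 * m) powr p"
    using m by (simp add: powr_mult[symmetric])
  finally show "Lp_norm p \<Omega> (\<lambda>x. f x + g x) \<le> 4 * (Lp_norm p \<Omega> f + Lp_norm p \<Omega> g)"
    using m p unfolding m_def by (intro Lp_norm_leI) auto
qed

lemma powr_le_one_plus:
  fixes a :: real
  assumes "0 \<le> a" "0 \<le> q" "q \<le> p"
  shows "a powr q \<le> 1 + a powr p"
proof (cases "a \<le> 1")
  case True
  then have "a powr q \<le> 1 powr q" using assms by (intro powr_mono2) auto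
  then show ?thesis by (simp add: add_increasing2)
next
  case False
  then have "a powr q \<le> a powr p" using assms by (intro powr_mono) auto
  then show ?thesis by simp
qed

text \<open>On a domain of finite measure the spaces decrease in the exponent: \<open>|f|\<^sup>q \<le> 1 + |f|\<^sup>p\<close>, applied
  to \<open>f\<close> divided by its \<open>L\<^sup>p\<close> norm.\<close>

lemma Lp_nested:
  assumes \<Omega>: "\<Omega> \<in> lmeasurable" and q: "0 < q" "q \<le> p" and f: "f \<in> Lp p \<Omega>"
  shows "f \<in> Lp q \<Omega>"
    and "Lp_norm q \<Omega> f \<le> (measure lebesgue \<Omega> + 1) powr (1/q) * Lp_norm p \<Omega> f"
proof -
  interpret finite_measure "lebesgue_on \<Omega>" by (rule finite_measure_lebesgue_on[OF \<Omega>])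
  have fm[measurable]: "f \<in> borel_measurable (lebesgue_on \<Omega>)" using f by (rule Lp_measurable)
  have fi: "integrable (lebesgue_on \<Omega>) (\<lambda>x. norm (f x) powr p)" using f by (rule Lp_integrable)
  have fq: "integrable (lebesgue_on \<Omega>) (\<lambda>x. norm (f x) powr q)"
    by (rule Bochner_Integration.integrable_bound[of _ "\<lambda>x. 1 + norm (f x) powr p"])
       (use fi powr_le_one_plus[of _ q p] q in auto)
  then show "f \<in> Lp q \<Omega>" by (simp add: Lp_def)
  define N where "N = Lp_norm p \<Omega> f"
  have Np: "N powr p = (\<integral>x. norm (f x) powr p \<partial>lebesgue_on \<Omega>)"
    unfolding N_def using q by (intro Lp_norm_powr) auto
  show "Lp_norm q \<Omega> f \<le> (measure lebesgue \<Omega> + 1) powr (1/q) * Lp_norm p \<Omega> f"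
  proof (cases "N = 0")
    case True
    then have "(\<integral>x. norm (f x) powr p \<partial>lebesgue_on \<Omega>) = 0" using Np by simp
    then have "AE x in lebesgue_on \<Omega>. norm (f x) powr p = 0"
      using integral_nonneg_eq_0_iff_AE[OF fi] by simp
    then have "AE x in lebesgue_on \<Omega>. norm (f x) powr q = 0" by auto
    then have "(\<integral>x. norm (f x) powr q \<partial>lebesgue_on \<Omega>) = 0" by (rule integral_eq_zero_AE)
    then show ?thesis by (simp add: Lp_norm_def)
  next
    case False
    then have N: "N > 0" using Lp_norm_nonneg[of p \<Omega> f] by (simp add: N_def)
    have le: "norm (f x) powr q \<le> N powr q * (1 + norm (f x) powr p / N powr p)" for x
    proof -
      have "(norm (f x) / N) powr q \<le> 1 + (norm (f x) / N) powr p"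
        using q N by (intro powr_le_one_plus) auto
      then show ?thesis using N by (simp add: powr_divide field_simps)
    qed
    have "(\<integral>x. norm (f x) powr q \<partial>lebesgue_on \<Omega>) \<le> (\<integral>x. N powr q * (1 + norm (f x) powr p / N powr p) \<partial>lebesgue_on \<Omega>)"
      by (rule integral_mono) (use fq fi le in auto)
    also have "\<dots> = N powr q * (measure lebesgue \<Omega> + 1)"
      using fi Np N \<Omega> by (simp add: measure_restrict_space fmeasurableD flip: Np)
    also have "\<dots> = ((measure lebesgue \<Omega> + 1) powr (1/q) * N) powr q"
      using N q by (simp add: powr_mult powr_powr mult.commute)
    finally show ?thesis
      using N q unfolding N_def[symmetric] by (intro Lp_norm_leI) auto
  qed
qed

lemma Lp_AE_bounded:
  assumes \<Omega>: "\<Omega> \<in> lmeasurable" and p: "0 < p" and B: "0 \<le> B" and fm: "f \<in> borel_measurable (lebesgue_on \<Omega>)"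
    and le: "AE x in lebesgue_on \<Omega>. norm (f x) \<le> B"
  shows "f \<in> Lp p \<Omega>" and "Lp_norm p \<Omega> f \<le> measure lebesgue \<Omega> powr (1/p) * B"
proof -
  interpret finite_measure "lebesgue_on \<Omega>" by (rule finite_measure_lebesgue_on[OF \<Omega>])
  have le': "AE x in lebesgue_on \<Omega>. norm (f x) powr p \<le> B powr p"
    using le by eventually_elim (use p in \<open>auto intro: powr_mono2\<close>)
  then have i: "integrable (lebesgue_on \<Omega>) (\<lambda>x. norm (f x) powr p)"
    using fm by (intro integrable_const_bound[where B="B powr p"]) auto
  then show "f \<in> Lp p \<Omega>" using fm by (simp add: Lp_def)
  have "(\<integral>x. norm (f x) powr p \<partial>lebesgue_on \<Omega>) \<le> (\<integral>x. B powr p \<partial>lebesgue_on \<Omega>)"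
    by (rule integral_mono_AE[OF i _ le']) simp
  also have "\<dots> = (measure lebesgue \<Omega> powr (1/p) * B) powr p"
    using \<Omega> p B by (simp add: measure_restrict_space fmeasurableD powr_mult powr_powr)
  finally show "Lp_norm p \<Omega> f \<le> measure lebesgue \<Omega> powr (1/p) * B"
    using p B by (intro Lp_norm_leI) auto
qed

text \<open>Convergence in \<open>L\<^sup>2\<close>, hence in \<open>L\<^sup>1\<close>, gives a subsequence that converges almost everywhere.\<close>

lemma L2_limit_bounded:
  assumes \<Omega>: "\<Omega> \<in> lmeasurable" and f: "\<And>n. f n \<in> L2 \<Omega>" and g: "g \<in> L2 \<Omega>"
    and lim: "(\<lambda>n. L2_norm \<Omega> (\<lambda>x. f n x - g x)) \<longlonglongrightarrow> 0"
    and B: "\<And>n x. x \<in> \<Omega> \<Longrightarrow> norm (f n x) \<le> B"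
  shows "AE x in lebesgue_on \<Omega>. norm (g x) \<le> B"
proof -
  have L1: "(\<lambda>n. \<integral>x. norm (f n x - g x) \<partial>lebesgue_on \<Omega>) \<longlonglongrightarrow> 0"
  proof (rule tendsto_sandwich[where f="\<lambda>_. 0" and h="\<lambda>n. sqrt (measure lebesgue \<Omega>) * L2_norm \<Omega> (\<lambda>x. f n x - g x)"])
    show "(\<lambda>n. sqrt (measure lebesgue \<Omega>) * L2_norm \<Omega> (\<lambda>x. f n x - g x)) \<longlonglongrightarrow> 0"
      using tendsto_mult_right_zero[OF lim] by simp
  qed (use L1_le_L2_norm(2)[OF \<Omega> L2_diff[OF f g]] in auto)
  obtain r :: "nat \<Rightarrow> nat" where r: "strict_mono r" "AE x in lebesgue_on \<Omega>. (\<lambda>n. f (r n) x - g x) \<longlonglongrightarrow> 0"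
    using tendsto_L1_AE_subseq[OF L1_le_L2_norm(1)[OF \<Omega> L2_diff[OF f g]] L1] by blast
  have "AE x in lebesgue_on \<Omega>. x \<in> \<Omega>" using \<Omega> by (intro AE_I2) auto
  with r(2) show ?thesis
  proof eventually_elim
    case (elim x)
    then have "(\<lambda>n. f (r n) x) \<longlonglongrightarrow> g x" by (simp add: LIM_zero_iff)
    then show ?case by (intro Lim_norm_ubound[OF sequentially_bot]) (auto simp: B elim)
  qed
qed

section \<open>Resolvents as multipliers\<close>

text \<open>Since \<open>1/(\<mu> - z) = -1/z + \<mu>/(z(\<mu> - z))\<close>, the operator is \<open>-1/z\<close> times the identity plus \<open>1/z\<close>
  times the operator with the square-summable multiplier \<open>\<mu>/(\<mu> - z)\<close>.  As the basis is uniformly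
  bounded, the second operator maps \<open>L\<^sup>2\<close> to \<open>L\<^sup>\<infinity>\<close>, by the Cauchy--Schwarz inequality for its series,
  and \<open>L\<^sup>1\<close> to \<open>L\<^sup>2\<close>, because the coefficients of \<open>u\<close> are at most a constant times \<open>\<parallel>u\<parallel>\<^sub>1\<close>.  The first
  property settles \<open>p \<ge> 2\<close> and the second \<open>p < 2\<close>.\<close>

theorem resolvent_multiplier_Lp_bounded:
  fixes \<Omega> :: "'a::euclidean_space set" and \<mu> :: "nat \<Rightarrow> real"
  assumes \<Omega>: "\<Omega> \<in> lmeasurable" and e: "orthonormal_L2 \<Omega> e" and c: "complete_L2 \<Omega> e"
    and M: "\<And>k x. x \<in> \<Omega> \<Longrightarrow> norm (e k x) \<le> M"
    and \<mu>: "summable (\<lambda>k. (\<mu> k)\<^sup>2)"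
    and d: "0 < d" "\<And>k. d \<le> norm (of_real (\<mu> k) - z)" and z: "z \<noteq> 0" and p: "1 \<le> p"
  shows "\<exists>C. \<forall>u\<in>L2 \<Omega> \<inter> Lp p \<Omega>. \<forall>v\<in>L2 \<Omega>.
           (\<forall>k. L2_inner \<Omega> v (e k) = L2_inner \<Omega> u (e k) / (of_real (\<mu> k) - z)) \<longrightarrow>
           v \<in> Lp p \<Omega> \<and> Lp_norm p \<Omega> v \<le> C * Lp_norm p \<Omega> u"
proof -
  define Q where "Q = (\<Sum>k. (\<mu> k)\<^sup>2)"
  have Q: "0 \<le> Q" "\<And>n. (\<Sum>k<n. (\<mu> k)\<^sup>2) \<le> Q"
    unfolding Q_def by (auto intro!: suminf_nonneg sum_le_suminf \<mu>)
  define m where "m = measure lebesgue \<Omega>"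
  have m: "0 \<le> m" by (simp add: m_def)
  define N where "N = \<bar>M\<bar>"
  have N: "0 \<le> N" "\<And>k x. x \<in> \<Omega> \<Longrightarrow> norm (e k x) \<le> N" by (auto simp: N_def intro: order_trans[OF M abs_ge_self])
  define H where "H = N * sqrt Q / d"
  have H: "0 \<le> H" using N Q d by (simp add: H_def)
  define K where "K = max (m powr (1/p) * (H * (m + 1) powr (1/2))) ((m + 1) powr (1/p) * (H * (m + 1)))"
  define C where "C = 4 * (norm (1/z) * K + norm (1/z))"
  have ek: "e k \<in> L2 \<Omega>" for k using e by (simp add: orthonormal_L2_def)
  have "v \<in> Lp p \<Omega> \<and> Lp_norm p \<Omega> v \<le> C * Lp_norm p \<Omega> u"
    if u2: "u \<in> L2 \<Omega>" and up: "u \<in> Lp p \<Omega>" and v: "v \<in> L2 \<Omega>"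
      and vk: "\<And>k. L2_inner \<Omega> v (e k) = L2_inner \<Omega> u (e k) / (of_real (\<mu> k) - z)" for u v
  proof -
    define b where "b = (\<lambda>k. L2_inner \<Omega> u (e k))"
    \<comment> \<open>\<open>w\<close> is the image of \<open>u\<close> under the operator with multiplier \<open>\<mu>/(\<mu> - z)\<close>\<close>
    define w where "w = (\<lambda>x. u x + z * v x)"
    have w: "w \<in> L2 \<Omega>" unfolding w_def by (intro L2_add L2_scale u2 v)
    define a where "a = (\<lambda>k. L2_inner \<Omega> w (e k))"
    have a_eq: "a k = b k * of_real (\<mu> k) / (of_real (\<mu> k) - z)" for k
    proof -
      have "complex_of_real (\<mu> k) - z \<noteq> 0" using d(2)[of k] d(1) by auto
      moreover have "a k = b k + z * (b k / (of_real (\<mu> k) - z))"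
        unfolding a_def w_def b_def by (simp add: L2_inner_add_left L2_scale u2 v ek L2_inner_scale_left vk)
      ultimately show ?thesis by (simp add: field_simps)
    qed
    have a_le: "norm (a k) \<le> norm (b k) * \<bar>\<mu> k\<bar> / d" for k
      unfolding a_eq norm_divide norm_mult using d by (intro frac_le) auto
    have w_lim: "(\<lambda>n. L2_norm \<Omega> (\<lambda>x. (\<Sum>k<n. a k * e k x) - w x)) \<longlonglongrightarrow> 0"
      unfolding a_def by (rule orthonormal_expansion[OF \<Omega> e c w])
    have Lw: "w \<in> Lp p \<Omega> \<and> Lp_norm p \<Omega> w \<le> K * Lp_norm p \<Omega> u"
    proof (cases "2 \<le> p")
      case True
      have bound: "norm (\<Sum>k<n. a k * e k x) \<le> H * L2_norm \<Omega> u" if "x \<in> \<Omega>" for n x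
      proof -
        have "norm (\<Sum>k<n. a k * e k x) \<le> (\<Sum>k<n. norm (b k) * \<bar>\<mu> k\<bar> / d * N)"
        proof (rule sum_norm_le)
          fix k
          show "norm (a k * e k x) \<le> norm (b k) * \<bar>\<mu> k\<bar> / d * N"
            unfolding norm_mult using d by (intro mult_mono a_le N that) auto
        qed
        also have "\<dots> = (N / d) * (\<Sum>k<n. \<bar>norm (b k)\<bar> * \<bar>\<mu> k\<bar>)" by (simp add: sum_distrib_left mult_ac)
        also have "\<dots> \<le> (N / d) * (L2_set (\<lambda>k. norm (b k)) {..<n} * L2_set \<mu> {..<n})"
          using N d by (intro mult_left_mono L2_set_mult_ineq) auto
        also have "\<dots> \<le> (N / d) * (L2_norm \<Omega> u * sqrt Q)"
        proof (intro mult_left_mono mult_mono)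
          have "L2_set (\<lambda>k. norm (b k)) {..<n} \<le> sqrt ((L2_norm \<Omega> u)\<^sup>2)"
            unfolding L2_set_def b_def by (intro real_sqrt_le_mono Bessel[OF e u2])
          then show "L2_set (\<lambda>k. norm (b k)) {..<n} \<le> L2_norm \<Omega> u" by (simp add: L2_norm_nonneg)
          show "L2_set \<mu> {..<n} \<le> sqrt Q" unfolding L2_set_def by (intro real_sqrt_le_mono Q)
        qed (use N d in \<open>auto simp: L2_norm_nonneg\<close>)
        finally show ?thesis by (simp add: H_def mult_ac)
      qed
      have B: "0 \<le> H * L2_norm \<Omega> u" using H by (simp add: L2_norm_nonneg)
      have ae: "AE x in lebesgue_on \<Omega>. norm (w x) \<le> H * L2_norm \<Omega> u"
        by (rule L2_limit_bounded[OF \<Omega> orthonormal_L2_mem[OF e] w w_lim bound])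
      have wp: "w \<in> Lp p \<Omega>" and "Lp_norm p \<Omega> w \<le> m powr (1/p) * (H * L2_norm \<Omega> u)"
        using Lp_AE_bounded[OF \<Omega> _ B Lp_measurable[OF w] ae, of p] p by (auto simp: m_def)
      note this(2)
      also have "m powr (1/p) * (H * L2_norm \<Omega> u) \<le> m powr (1/p) * (H * ((m + 1) powr (1/2) * Lp_norm p \<Omega> u))"
        using Lp_nested(2)[OF \<Omega> _ True up] H by (intro mult_left_mono) (auto simp: m_def)
      also have "\<dots> \<le> K * Lp_norm p \<Omega> u"
        unfolding K_def mult.assoc[symmetric] by (intro mult_right_mono Lp_norm_nonneg) simp
      finally show ?thesis using wp by blast
    next
      case False
      have u1: "u \<in> Lp 1 \<Omega>" "Lp_norm 1 \<Omega> u \<le> (m + 1) * Lp_norm p \<Omega> u"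
        using Lp_nested[OF \<Omega> _ p up] m by (auto simp: m_def)
      have b_le: "norm (b k) \<le> N * Lp_norm 1 \<Omega> u" for k
      proof -
        have "norm (b k) \<le> (\<integral>x. N * norm (u x) \<partial>lebesgue_on \<Omega>)"
          unfolding b_def L2_inner_def
        proof (rule Bochner_Integration.integral_norm_bound_integral)
          show "integrable (lebesgue_on \<Omega>) (\<lambda>x. u x * cnj (e k x))" by (rule L2_inner_integrable[OF u2 ek])
          show "integrable (lebesgue_on \<Omega>) (\<lambda>x. N * norm (u x))"
            using L1_le_L2_norm(1)[OF \<Omega> u2] by simp
          show "norm (u x * cnj (e k x)) \<le> N * norm (u x)" if "x \<in> space (lebesgue_on \<Omega>)" for x
            using mult_right_mono[OF N(2)[of x k] norm_ge_zero[of "u x"]] that by (simp add: norm_mult mult.commute)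
        qed
        then show ?thesis by (simp add: Lp_norm_def)
      qed
      have "(\<lambda>k. (norm (a k))\<^sup>2) sums (L2_norm \<Omega> w)\<^sup>2" by (rule L2_limit_norm[OF e w w_lim])
      moreover have "(\<Sum>k<n. (norm (a k))\<^sup>2) \<le> (H * Lp_norm 1 \<Omega> u)\<^sup>2" for n
      proof -
        have "(\<Sum>k<n. (norm (a k))\<^sup>2) \<le> (\<Sum>k<n. (N * Lp_norm 1 \<Omega> u / d)\<^sup>2 * (\<mu> k)\<^sup>2)"
        proof (rule sum_mono)
          fix k
          have "norm (a k) \<le> N * Lp_norm 1 \<Omega> u / d * \<bar>\<mu> k\<bar>"
            using d b_le[of k] by (intro order_trans[OF a_le]) (simp add: divide_right_mono mult_right_mono)
          then have "(norm (a k))\<^sup>2 \<le> (N * Lp_norm 1 \<Omega> u / d * \<bar>\<mu> k\<bar>)\<^sup>2" by (intro power_mono) auto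
          then show "(norm (a k))\<^sup>2 \<le> (N * Lp_norm 1 \<Omega> u / d)\<^sup>2 * (\<mu> k)\<^sup>2" by (simp add: power_mult_distrib power_divide)
        qed
        also have "\<dots> \<le> (N * Lp_norm 1 \<Omega> u / d)\<^sup>2 * Q"
          unfolding sum_distrib_left[symmetric] by (intro mult_left_mono Q) auto
        also have "\<dots> = (H * Lp_norm 1 \<Omega> u)\<^sup>2"
          using Q by (simp add: H_def power_mult_distrib power_divide)
        finally show ?thesis .
      qed
      ultimately have "(L2_norm \<Omega> w)\<^sup>2 \<le> (H * Lp_norm 1 \<Omega> u)\<^sup>2"
        unfolding sums_def by (intro LIMSEQ_le_const2) auto
      then have w_le: "L2_norm \<Omega> w \<le> H * Lp_norm 1 \<Omega> u"
        by (rule power2_le_imp_le) (use H Lp_norm_nonneg[of 1 \<Omega> u] in simp)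
      have p2: "0 < p" "p \<le> 2" using False p by auto
      have wp: "w \<in> Lp p \<Omega>" and "Lp_norm p \<Omega> w \<le> (m + 1) powr (1/p) * L2_norm \<Omega> w"
        using Lp_nested[OF \<Omega> p2 w] by (auto simp: m_def)
      note this(2)
      also have "\<dots> \<le> (m + 1) powr (1/p) * (H * ((m + 1) * Lp_norm p \<Omega> u))"
        using w_le u1(2) H m by (intro mult_left_mono order_trans[OF w_le]) auto
      also have "\<dots> \<le> K * Lp_norm p \<Omega> u"
        unfolding K_def mult.assoc[symmetric] by (intro mult_right_mono Lp_norm_nonneg) simp
      finally show ?thesis using wp by blast
    qed
    have v_eq: "v = (\<lambda>x. (1/z) * w x + (-1/z) * u x)"
      unfolding w_def using z by (auto simp: field_simps)
    have wz: "(\<lambda>x. (1/z) * w x) \<in> Lp p \<Omega>" and uz: "(\<lambda>x. (-1/z) * u x) \<in> Lp p \<Omega>"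
      using Lw up by (blast intro: Lp_scale)+
    have "Lp_norm p \<Omega> v \<le> 4 * (norm (1/z) * Lp_norm p \<Omega> w + norm (1/z) * Lp_norm p \<Omega> u)"
    proof -
      have "Lp_norm p \<Omega> (\<lambda>x. (1/z) * w x) = norm (1/z) * Lp_norm p \<Omega> w"
        and "Lp_norm p \<Omega> (\<lambda>x. (-1/z) * u x) = norm (1/z) * Lp_norm p \<Omega> u"
        using p by (subst Lp_norm_scale; simp add: norm_divide)+
      then show ?thesis using Lp_quasi_triangle(2)[OF p wz uz] unfolding v_eq[symmetric] by (simp only:)
    qed
    also have "\<dots> \<le> 4 * (norm (1/z) * (K * Lp_norm p \<Omega> u) + norm (1/z) * Lp_norm p \<Omega> u)"
      using Lw by (intro mult_left_mono add_right_mono) auto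
    also have "\<dots> = C * Lp_norm p \<Omega> u" by (simp add: C_def algebra_simps)
    finally show ?thesis using Lp_quasi_triangle(1)[OF p wz uz] v_eq by metis
  qed
  then show ?thesis by blast
qed

section \<open>Smooth functions\<close>

definition smooth :: "('a::euclidean_space \<Rightarrow> complex) \<Rightarrow> bool" where
  "smooth f \<longleftrightarrow> (\<forall>k. k_times_cont_diff k f)"

lemma partial_eqI: "(f has_derivative f') (at x) \<Longrightarrow> partial b f x = f' b"
  unfolding partial_def using frechet_derivative_at by metis

lemma has_derivative_partial:
  "f differentiable (at x) \<Longrightarrow> (f has_derivative (\<lambda>v. partial v f x)) (at x)"
  unfolding partial_def by (simp add: frechet_derivative_works[symmetric])

lemma k_times_cont_diff_continuous: "k_times_cont_diff k f \<Longrightarrow> continuous_on UNIV f"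
  by (cases k) (auto intro!: continuous_at_imp_continuous_on differentiable_imp_continuous_within)

lemma k_times_cont_diff_Suc: "k_times_cont_diff (Suc k) f \<Longrightarrow> k_times_cont_diff k f"
  by (induction k arbitrary: f)
     (auto intro!: continuous_at_imp_continuous_on differentiable_imp_continuous_within)

lemma k_times_cont_diff_const: "k_times_cont_diff k (\<lambda>x. c)"
proof (induction k arbitrary: c)
  case (Suc k)
  have "partial b (\<lambda>x::'a. c) = (\<lambda>x. 0)" for b
    by (rule ext, rule partial_eqI[of _ "\<lambda>_. 0"]) (rule has_derivative_const)
  then show ?case using Suc[of 0] by simp
qed simp

lemma k_times_cont_diff_add:
  "k_times_cont_diff k f \<Longrightarrow> k_times_cont_diff k g \<Longrightarrow> k_times_cont_diff k (\<lambda>x. f x + g x)"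
proof (induction k arbitrary: f g)
  case (Suc k)
  have "partial b (\<lambda>x. f x + g x) = (\<lambda>x. partial b f x + partial b g x)" for b
    using Suc.prems by (intro ext partial_eqI has_derivative_add has_derivative_partial) auto
  then show ?case using Suc by auto
qed (auto intro: continuous_intros)

lemma k_times_cont_diff_mult:
  "k_times_cont_diff k f \<Longrightarrow> k_times_cont_diff k g \<Longrightarrow> k_times_cont_diff k (\<lambda>x. f x * g x)"
proof (induction k arbitrary: f g)
  case (Suc k)
  have "partial b (\<lambda>x. f x * g x) = (\<lambda>x. f x * partial b g x + partial b f x * g x)" for b
    using Suc.prems by (intro ext partial_eqI has_derivative_mult has_derivative_partial) auto
  moreover have "k_times_cont_diff k f" "k_times_cont_diff k g"
    using Suc.prems k_times_cont_diff_Suc by blast+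
  ultimately show ?case using Suc by (auto intro!: k_times_cont_diff_add)
qed (auto intro: continuous_intros)

lemma smooth_mult: "smooth f \<Longrightarrow> smooth g \<Longrightarrow> smooth (\<lambda>x. f x * g x)"
  by (simp add: smooth_def k_times_cont_diff_mult)

lemma smooth_differentiable: "smooth f \<Longrightarrow> f differentiable (at x)"
  unfolding smooth_def by (metis k_times_cont_diff.simps(2))

lemma smooth_partial: "smooth f \<Longrightarrow> b \<in> Basis \<Longrightarrow> smooth (partial b f)"
  unfolding smooth_def by (metis k_times_cont_diff.simps(2))

lemma smooth_continuous: "smooth f \<Longrightarrow> continuous_on UNIV f"
  unfolding smooth_def using k_times_cont_diff_continuous by blast

text \<open>Smoothness of the profile is expressed by a sequence \<open>D\<close> of successive derivatives, over which the
  induction on the order of differentiability can generalize.\<close>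

lemma smooth_ridge:
  fixes D :: "nat \<Rightarrow> real \<Rightarrow> real" and d :: "'a::euclidean_space"
  assumes D: "\<And>n s. (D n has_real_derivative D (Suc n) s) (at s)"
  shows "smooth (\<lambda>x. complex_of_real (D n (x \<bullet> d + c)))"
proof -
  have der: "((\<lambda>x. complex_of_real (D n (x \<bullet> d + c))) has_derivative
      (\<lambda>v. of_real (v \<bullet> d) * complex_of_real (D (Suc n) (x \<bullet> d + c)))) (at x)" for n x
  proof -
    have "((\<lambda>x. D n (x \<bullet> d + c)) has_derivative (\<lambda>v. D (Suc n) (x \<bullet> d + c) * (v \<bullet> d))) (at x)"
      by (rule has_derivative_compose[where g="D n", OF _ D[unfolded has_field_derivative_def]])
         (auto intro!: derivative_eq_intros)
    then have "((\<lambda>x. complex_of_real (D n (x \<bullet> d + c))) has_derivative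
        (\<lambda>v. complex_of_real (D (Suc n) (x \<bullet> d + c) * (v \<bullet> d)))) (at x)"
      by (rule has_derivative_of_real)
    then show ?thesis by (simp add: mult.commute)
  qed
  have "k_times_cont_diff k (\<lambda>x. complex_of_real (D n (x \<bullet> d + c)))" for k
  proof (induction k arbitrary: n)
    case 0
    show ?case unfolding k_times_cont_diff.simps
      by (rule continuous_at_imp_continuous_on) (use has_derivative_continuous[OF der] in blast)
  next
    case (Suc k)
    have "partial b (\<lambda>x. complex_of_real (D n (x \<bullet> d + c))) =
        (\<lambda>x. of_real (b \<bullet> d) * complex_of_real (D (Suc n) (x \<bullet> d + c)))" for b
      by (rule ext, rule partial_eqI[OF der])
    moreover have "(\<lambda>x. complex_of_real (D n (x \<bullet> d + c))) differentiable (at x)" for x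
      using der unfolding differentiable_def by blast
    ultimately show ?case using Suc by (auto intro!: k_times_cont_diff_mult k_times_cont_diff_const)
  qed
  then show ?thesis by (simp add: smooth_def)
qed

section \<open>A flat function\<close>

primrec flat_poly :: "nat \<Rightarrow> real poly" where
  "flat_poly 0 = 1"
| "flat_poly (Suc n) = [:0, 0, 1:] * (flat_poly n - pderiv (flat_poly n))"

text \<open>The \<open>n\<close>-th derivative of the function \<open>exp (-1/x)\<close> extended by zero to the negative axis.\<close>

definition flat :: "nat \<Rightarrow> real \<Rightarrow> real" where
  "flat n x = (if x > 0 then poly (flat_poly n) (1/x) * exp (- (1/x)) else 0)"

lemma poly_times_exp_minus_tendsto: "((\<lambda>y. poly q y * exp (- y)) \<longlongrightarrow> (0::real)) at_top"
proof -
  have "((\<lambda>y. \<Sum>i\<le>degree q. coeff q i * (y ^ i / exp y)) \<longlongrightarrow> (\<Sum>i\<le>degree q. coeff q i * 0)) at_top"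
    by (intro tendsto_intros tendsto_power_div_exp_0)
  then show ?thesis by (simp add: poly_altdef sum_distrib_right sum_divide_distrib exp_minus field_simps)
qed

lemma flat_derivative: "(flat n has_real_derivative flat (Suc n) x) (at x)"
proof -
  consider "x > 0" | "x < 0" | "x = 0" by linarith
  then show ?thesis
  proof cases
    case 1
    have "((\<lambda>x. poly (flat_poly n) (1/x) * exp (- (1/x))) has_real_derivative flat (Suc n) x) (at x)"
      using 1 by (auto intro!: derivative_eq_intros simp: flat_def field_simps power2_eq_square)
    then show ?thesis
    proof (rule has_field_derivative_transform_within_open[of _ _ _ "{0<..}"])
    qed (use 1 in \<open>auto simp: flat_def\<close>)
  next
    case 2
    have "((\<lambda>x. 0) has_real_derivative flat (Suc n) x) (at x)"
      using 2 by (simp add: flat_def)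
    then show ?thesis
    proof (rule has_field_derivative_transform_within_open[of _ _ _ "{..<0}"])
    qed (use 2 in \<open>auto simp: flat_def\<close>)
  next
    case 3
    have "((\<lambda>h. flat n h / h) \<longlongrightarrow> 0) (at 0)"
    proof (rule filterlim_split_at_real)
      have "eventually (\<lambda>h. flat n h / h = 0) (at_left (0::real))"
        unfolding eventually_at_filter by (auto simp: flat_def)
      then show "((\<lambda>h. flat n h / h) \<longlongrightarrow> 0) (at_left 0)" by (rule tendsto_eventually)
      have "((\<lambda>y. flat n (inverse y) / inverse y) \<longlongrightarrow> 0) at_top"
      proof (rule Lim_transform_eventually)
        show "((\<lambda>y. poly (pCons 0 (flat_poly n)) y * exp (- y)) \<longlongrightarrow> 0) at_top"
          by (rule poly_times_exp_minus_tendsto)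
        show "\<forall>\<^sub>F y in at_top. poly (pCons 0 (flat_poly n)) y * exp (- y) = flat n (inverse y) / inverse y"
          using eventually_gt_at_top[of 0] by eventually_elim (auto simp: flat_def field_simps)
      qed
      then show "((\<lambda>h. flat n h / h) \<longlongrightarrow> 0) (at_right 0)"
        by (simp add: filterlim_at_right_to_top)
    qed
    then show ?thesis using 3 by (simp add: DERIV_def flat_def)
  qed
qed

lemma flat_0_le: "0 \<le> flat 0 x" "flat 0 x \<le> 1"
  by (auto simp: flat_def)

lemma flat_1: "flat (Suc 0) x = (if x > 0 then (1/x)\<^sup>2 * exp (- (1/x)) else 0)"
  by (simp add: flat_def power2_eq_square)

lemma flat_0_tendsto: "(flat 0 \<longlongrightarrow> 1) at_top"
proof (rule Lim_transform_eventually)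
  have "((\<lambda>x::real. exp (- (1/x))) \<longlongrightarrow> exp (- 0)) at_top"
    by (intro tendsto_exp tendsto_minus) (simp add: tendsto_inverse_0_at_top[OF filterlim_ident] divide_inverse)
  then show "((\<lambda>x::real. exp (- (1/x))) \<longlongrightarrow> 1) at_top" by simp
  show "\<forall>\<^sub>F x in at_top. exp (- (1/x)) = flat 0 x"
    using eventually_gt_at_top[of 0] by eventually_elim (auto simp: flat_def)
qed

text \<open>In terms of \<open>t = 1/x\<close> the product is \<open>(t + t\<^sup>2) exp (-t)\<close>.  It arises as \<open>s \<chi>'(s)\<close> for the cutoff
  \<open>\<chi>(s) = flat 0 (s/\<epsilon> - 1)\<close>, with \<open>x = s/\<epsilon> - 1\<close>.\<close>

lemma flat_1_weighted: "0 \<le> (x + 1) * flat (Suc 0) x" "(x + 1) * flat (Suc 0) x \<le> 3"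
proof -
  show "0 \<le> (x + 1) * flat (Suc 0) x" by (auto simp: flat_1)
  show "(x + 1) * flat (Suc 0) x \<le> 3"
  proof (cases "x > 0")
    case True
    define t where "t = 1/x"
    have t: "t > 0" "x * t = 1" using True by (auto simp: t_def)
    have e: "1 + t + t\<^sup>2 / 2 \<le> exp t" by (rule exp_lower_Taylor_quadratic) (use t in simp)
    have "(x + 1) * flat (Suc 0) x = (x * t * t + t\<^sup>2) * exp (- t)"
      using True by (simp add: flat_1 t_def power2_eq_square field_simps)
    also have "\<dots> = (t + t\<^sup>2) / exp t" using t by (simp add: exp_minus field_simps)
    also have "\<dots> \<le> 3" 
    proof -
      have "t + t\<^sup>2 \<le> 3 * (1 + t + t\<^sup>2/2)" using t by (simp add: field_simps)
      also have "\<dots> \<le> 3 * exp t" using e by simp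
      finally show ?thesis by (simp add: divide_le_eq)
    qed
    finally show ?thesis .
  qed (simp add: flat_1)
qed

lemma flat_1_weighted_tendsto: "((\<lambda>x. (x + 1) * flat (Suc 0) x) \<longlongrightarrow> 0) at_top"
proof (rule tendsto_sandwich[where f="\<lambda>_. 0" and h="\<lambda>x. inverse x + (inverse x)\<^sup>2"])
  show "\<forall>\<^sub>F x in at_top. (x + 1) * flat (Suc 0) x \<le> inverse x + (inverse x)\<^sup>2"
    using eventually_gt_at_top[of 0]
  proof eventually_elim
    case (elim x)
    have "(x + 1) * flat (Suc 0) x \<le> (x + 1) * ((1/x)\<^sup>2 * 1)"
      unfolding flat_1 using elim by (auto intro!: mult_left_mono)
    also have "\<dots> = inverse x + (inverse x)\<^sup>2" using elim by (simp add: field_simps power2_eq_square)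
    finally show ?case .
  qed
  have "((\<lambda>x::real. inverse x + (inverse x)\<^sup>2) \<longlongrightarrow> 0 + 0\<^sup>2) at_top"
    by (intro tendsto_add tendsto_power tendsto_inverse_0_at_top filterlim_ident)
  then show "((\<lambda>x::real. inverse x + (inverse x)\<^sup>2) \<longlongrightarrow> 0) at_top" by simp
qed (auto intro!: always_eventually flat_1_weighted)

section \<open>Integrals of derivatives\<close>

text \<open>Integrals of difference quotients vanish by translation invariance, and dominated convergence
  passes this on to the directional derivative.\<close>

lemma integral_directional_derivative_zero:
  fixes F G :: "'a::euclidean_space \<Rightarrow> complex"
  assumes F: "F \<in> borel_measurable borel" and G: "G \<in> borel_measurable borel"
    and supp: "\<And>x. R < norm x \<Longrightarrow> F x = 0" and bound: "\<And>x. norm (F x) \<le> B"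
    and Lip: "\<And>x h. norm (F (x + h *\<^sub>R d) - F x) \<le> L * \<bar>h\<bar>"
    and lim: "AE x in lborel. (\<lambda>n. of_nat (Suc n) * (F (x + (1 / real (Suc n)) *\<^sub>R d) - F x)) \<longlonglongrightarrow> G x"
  shows "integral\<^sup>L lborel G = 0"
proof -
  have [measurable]: "F \<in> borel_measurable borel" "G \<in> borel_measurable borel" by fact+
  have ball: "emeasure lborel (cball (0::'a) r) < \<infinity>" for r
    using emeasure_bounded_finite[OF bounded_cball, of 0 r] by simp
  have Fi: "integrable lborel F"
  proof (rule integrableI_bounded_set[where A="cball 0 R" and B=B])
    show "AE x in lborel. x \<notin> cball 0 R \<longrightarrow> F x = 0" using supp by (auto simp: dist_norm)
  qed (use ball bound in auto)
  have shift: "integrable lborel (\<lambda>x. F (x + c))" "(\<integral>x. F (x + c) \<partial>lborel) = integral\<^sup>L lborel F" for c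
  proof -
    have "integrable (distr lborel borel ((+) c)) F" using Fi by (simp add: lborel_distr_plus)
    then show "integrable lborel (\<lambda>x. F (x + c))" by (subst (asm) integrable_distr_eq) (auto simp: add.commute)
    have "integral\<^sup>L (distr lborel borel ((+) c)) F = (\<integral>x. F (c + x) \<partial>lborel)"
      by (rule integral_distr) auto
    then show "(\<integral>x. F (x + c) \<partial>lborel) = integral\<^sup>L lborel F" by (simp add: lborel_distr_plus add.commute)
  qed
  define q where "q = (\<lambda>n x. of_nat (Suc n) * (F (x + (1 / real (Suc n)) *\<^sub>R d) - F x))"
  have q0: "(\<integral>x. q n x \<partial>lborel) = 0" for n
    unfolding q_def using shift[of "(1 / real (Suc n)) *\<^sub>R d"] Fi by simp
  have "(\<lambda>n. \<integral>x. q n x \<partial>lborel) \<longlonglongrightarrow> integral\<^sup>L lborel G"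
  proof (rule integral_dominated_convergence[where w="\<lambda>x. indicator (cball 0 (R + norm d)) x * L"])
    show "integrable lborel (\<lambda>x::'a. indicator (cball 0 (R + norm d)) x * L)"
      using ball by (intro integrable_mult_left) (auto simp: integrable_indicator_iff)
    show "AE x in lborel. (\<lambda>n. q n x) \<longlonglongrightarrow> G x" using lim by (simp add: q_def)
    show "AE x in lborel. norm (q n x) \<le> indicator (cball 0 (R + norm d)) x * L" for n
    proof (rule AE_I2)
      fix x :: 'a
      show "norm (q n x) \<le> indicator (cball 0 (R + norm d)) x * L"
      proof (cases "norm x \<le> R + norm d")
        case True
        have "norm (q n x) \<le> real (Suc n) * (L * \<bar>1 / real (Suc n)\<bar>)"
          unfolding q_def norm_mult norm_of_nat by (intro mult_left_mono Lip) auto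
        also have "\<dots> = L" by (simp add: field_simps del: of_nat_Suc)
        finally show ?thesis using True by (simp add: dist_norm)
      next
        case False
        have "norm ((1 / real (Suc n)) *\<^sub>R d) \<le> norm d"
          by (simp add: divide_le_eq mult_left_mono) (use norm_ge_zero[of d] in \<open>simp add: algebra_simps\<close>)
        moreover have "norm x \<le> norm (x + (1 / real (Suc n)) *\<^sub>R d) + norm ((1 / real (Suc n)) *\<^sub>R d)"
          using norm_triangle_ineq4[of "x + (1 / real (Suc n)) *\<^sub>R d" "(1 / real (Suc n)) *\<^sub>R d"] by simp
        ultimately have "R < norm (x + (1 / real (Suc n)) *\<^sub>R d)" using False by linarith
        moreover have "R < norm x" using False norm_ge_zero[of d] by linarith
        ultimately show ?thesis using False by (simp add: q_def supp dist_norm)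
      qed
    qed
  qed (auto simp: q_def)
  then show ?thesis using q0 by (simp add: LIMSEQ_const_iff)
qed

lemma difference_quotient_tendsto_partial:
  assumes "f differentiable (at x)"
  shows "(\<lambda>n. of_nat (Suc n) * (f (x + (1 / real (Suc n)) *\<^sub>R d) - f x)) \<longlonglongrightarrow> partial d f x"
proof (cases "d = 0")
  case True
  have "partial 0 f x = 0"
    using has_derivative_partial[OF assms] by (auto dest!: has_derivative_linear linear_0)
  then show ?thesis using True by simp
next
  case False
  define D where "D = (\<lambda>v. partial v f x)"
  have D: "(f has_derivative D) (at x)" unfolding D_def by (rule has_derivative_partial[OF assms])
  define h where "h = (\<lambda>n. (1 / real (Suc n)) *\<^sub>R d)"
  have h0: "h \<longlonglongrightarrow> 0"
    unfolding h_def using tendsto_scaleR[OF LIMSEQ_inverse_real_of_nat tendsto_const[of d]] by (simp add: divide_inverse)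
  then have "filterlim h (at 0) sequentially"
    using False by (auto simp: filterlim_at h_def intro!: always_eventually)
  then have "(\<lambda>n. norm (f (x + h n) - f x - D (h n)) / norm (h n)) \<longlonglongrightarrow> 0"
    using D unfolding has_derivative_at by (auto intro: filterlim_compose)
  then have "(\<lambda>n. norm d * (norm (f (x + h n) - f x - D (h n)) / norm (h n))) \<longlonglongrightarrow> 0"
    by (rule tendsto_mult_right_zero)
  moreover have "norm d * (norm (f (x + h n) - f x - D (h n)) / norm (h n))
      = norm (of_nat (Suc n) * (f (x + h n) - f x) - D d)" for n
  proof -
    have "D (h n) = D d / of_nat (Suc n)"
      using linear_scale[OF has_derivative_linear[OF D], of "1 / real (Suc n)" d]
      by (simp add: h_def scaleR_conv_of_real)
    then have "of_nat (Suc n) * (f (x + h n) - f x) - D d = of_nat (Suc n) * (f (x + h n) - f x - D (h n))"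
      by (simp add: right_diff_distrib del: of_nat_Suc)
    then have "norm (of_nat (Suc n) * (f (x + h n) - f x) - D d) = real (Suc n) * norm (f (x + h n) - f x - D (h n))"
      by (simp add: norm_mult del: of_nat_Suc)
    moreover have "norm (h n) = norm d / real (Suc n)" by (simp add: h_def)
    ultimately show ?thesis using False by simp
  qed
  ultimately have "(\<lambda>n. norm (of_nat (Suc n) * (f (x + h n) - f x) - D d)) \<longlonglongrightarrow> 0" by simp
  then show ?thesis unfolding D_def h_def by (simp add: tendsto_norm_zero_iff LIM_zero_iff)
qed

lemma partial_bound_imp_Lipschitz:
  assumes f: "\<And>x. f differentiable (at x)" and L: "\<And>x. norm (partial d f x) \<le> L"
  shows "norm (f (x + h *\<^sub>R d) - f x) \<le> L * \<bar>h\<bar>"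
proof -
  have der: "((\<lambda>t. f (x + t *\<^sub>R d)) has_derivative (\<lambda>s. partial (s *\<^sub>R d) f (x + t *\<^sub>R d))) (at t)" for t
    by (rule has_derivative_compose[where g=f, OF _ has_derivative_partial[OF f]])
       (auto intro!: derivative_eq_intros)
  have "norm (f (x + h *\<^sub>R d) - f (x + 0 *\<^sub>R d)) \<le> L * norm (h - 0)"
  proof (rule differentiable_bound[of UNIV "\<lambda>t. f (x + t *\<^sub>R d)"])
    show "((\<lambda>t. f (x + t *\<^sub>R d)) has_derivative (\<lambda>s. partial (s *\<^sub>R d) f (x + t *\<^sub>R d))) (at t within UNIV)" for t
      using der by simp
    show "onorm (\<lambda>s. partial (s *\<^sub>R d) f (x + t *\<^sub>R d)) \<le> L" for t
    proof (rule onorm_le)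
      fix s :: real
      have "partial (s *\<^sub>R d) f (x + t *\<^sub>R d) = s *\<^sub>R partial d f (x + t *\<^sub>R d)"
        by (rule linear_scale[OF has_derivative_linear[OF has_derivative_partial[OF f]]])
      then show "norm (partial (s *\<^sub>R d) f (x + t *\<^sub>R d)) \<le> L * norm s"
        using mult_right_mono[OF L[of "x + t *\<^sub>R d"] abs_ge_zero[of s]] by (simp add: mult.commute)
    qed
  qed auto
  then show ?thesis by simp
qed

lemma partial_outside_support:
  assumes "compact K" "\<And>x. x \<notin> K \<Longrightarrow> f x = 0" "x \<notin> K"
  shows "partial b f x = 0"
proof (rule partial_eqI[where f'="\<lambda>_. 0", simplified])
  show "(f has_derivative (\<lambda>_. 0)) (at x)"
  proof (rule has_derivative_transform_within_open[where s="-K"])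
    show "((\<lambda>_. 0) has_derivative (\<lambda>_. 0)) (at x)" by (rule has_derivative_const)
  qed (use assms in \<open>auto simp: compact_imp_closed\<close>)
qed

lemma continuous_support_bounded:
  fixes f :: "'a::euclidean_space \<Rightarrow> complex"
  assumes "continuous_on UNIV f" "compact K" "\<And>x. x \<notin> K \<Longrightarrow> f x = 0"
  obtains B where "0 \<le> B" "\<And>x. norm (f x) \<le> B"
proof -
  have "bounded (f ` K)"
    using assms by (intro compact_imp_bounded compact_continuous_image) (auto intro: continuous_on_subset)
  then obtain B where B: "\<And>x. x \<in> K \<Longrightarrow> norm (f x) \<le> B" by (auto simp: bounded_iff)
  have "norm (f x) \<le> max 0 B" for x
    using B[of x] assms(3)[of x] by (cases "x \<in> K") auto
  then show ?thesis using that[of "max 0 B"] by auto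
qed

lemma integral_partial_zero:
  fixes f :: "'a::euclidean_space \<Rightarrow> complex"
  assumes f: "smooth f" and K: "compact K" "\<And>x. x \<notin> K \<Longrightarrow> f x = 0" and b: "b \<in> Basis"
  shows "integral\<^sup>L lborel (partial b f) = 0"
proof -
  have d: "f differentiable (at x)" for x by (rule smooth_differentiable[OF f])
  have cf: "continuous_on UNIV f" and cp: "continuous_on UNIV (partial b f)"
    using f smooth_partial[OF f b] by (auto intro: smooth_continuous)
  obtain B where B: "\<And>x. norm (f x) \<le> B" using continuous_support_bounded[OF cf K] by blast
  obtain L where L: "\<And>x. norm (partial b f x) \<le> L"
    using continuous_support_bounded[OF cp K(1) partial_outside_support[OF K]] by blast
  obtain R where R: "\<And>x. x \<in> K \<Longrightarrow> norm x \<le> R" using compact_imp_bounded[OF K(1)] by (auto simp: bounded_iff)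
  show ?thesis
  proof (rule integral_directional_derivative_zero[of f "partial b f" R B b L])
    show "f x = 0" if "R < norm x" for x using K(2) R[of x] that by fastforce
    show "AE x in lborel. (\<lambda>n. of_nat (Suc n) * (f (x + (1 / real (Suc n)) *\<^sub>R b) - f x)) \<longlonglongrightarrow> partial b f x"
      by (intro AE_I2 difference_quotient_tendsto_partial d)
  qed (use B cf cp partial_bound_imp_Lipschitz[OF d L] in \<open>auto intro: borel_measurable_continuous_onI\<close>)
qed

section \<open>The Dirichlet form\<close>

lemma integral_lebesgue_on_eq_lborel:
  fixes f :: "'a::euclidean_space \<Rightarrow> complex"
  assumes \<Omega>: "\<Omega> \<in> sets lebesgue" and f: "f \<in> borel_measurable borel" and z: "\<And>x. x \<notin> \<Omega> \<Longrightarrow> f x = 0"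
  shows "integral\<^sup>L (lebesgue_on \<Omega>) f = integral\<^sup>L lborel f"
proof -
  have "integral\<^sup>L (lebesgue_on \<Omega>) f = integral\<^sup>L lebesgue (\<lambda>x. if x \<in> \<Omega> then f x else 0)"
    using Lebesgue_Measure.integral_restrict_UNIV[OF \<Omega>, of f] by simp
  also have "(\<lambda>x. if x \<in> \<Omega> then f x else 0) = f" using z by auto
  also have "integral\<^sup>L lebesgue f = integral\<^sup>L lborel f" by (rule integral_completion) (use f in simp)
  finally show ?thesis .
qed

lemma continuous_compact_support_integrable:
  fixes f :: "'a::euclidean_space \<Rightarrow> complex"
  assumes f: "continuous_on UNIV f" and K: "compact K" "\<And>x. x \<notin> K \<Longrightarrow> f x = 0"
  shows "integrable lborel f"
proof -
  obtain B where B: "\<And>x. norm (f x) \<le> B" using continuous_support_bounded[OF f K] by blast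
  show ?thesis
  proof (rule integrableI_bounded_set[where A=K and B=B])
    show "emeasure lborel K < \<infinity>" by (rule emeasure_bounded_finite[OF compact_imp_bounded[OF K(1)]])
    show "f \<in> borel_measurable lborel" using borel_measurable_continuous_onI[OF f] by simp
  qed (use K B in \<open>auto simp: compact_imp_closed\<close>)
qed

lemma continuous_measurable_lebesgue_on:
  fixes f :: "'a::euclidean_space \<Rightarrow> 'b::euclidean_space"
  assumes "continuous_on UNIV f" "\<Omega> \<in> sets lebesgue"
  shows "f \<in> borel_measurable (lebesgue_on \<Omega>)"
  using assms by (meson continuous_imp_measurable_on_sets_lebesgue continuous_on_subset subset_UNIV)

lemma k_times_cont_diff_cnj: "k_times_cont_diff k f \<Longrightarrow> k_times_cont_diff k (\<lambda>x. cnj (f x))"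
proof (induction k arbitrary: f)
  case (Suc k)
  have d: "((\<lambda>x. cnj (f x)) has_derivative (\<lambda>v. cnj (partial v f x))) (at x)" for x
    using Suc.prems by (intro bounded_linear.has_derivative[OF bounded_linear_cnj] has_derivative_partial) auto
  have "partial b (\<lambda>x. cnj (f x)) = (\<lambda>x. cnj (partial b f x))" for b
    by (intro ext partial_eqI d)
  moreover have "(\<lambda>x. cnj (f x)) differentiable (at x)" for x
    using d unfolding differentiable_def by blast
  ultimately show ?case using Suc by auto
qed (auto intro: continuous_intros)

lemma smooth_cnj: "smooth f \<Longrightarrow> smooth (\<lambda>x. cnj (f x))"
  by (simp add: smooth_def k_times_cont_diff_cnj)

lemma smooth_const: "smooth (\<lambda>x. c)"
  by (simp add: smooth_def k_times_cont_diff_const)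

lemma test_function_smooth: "\<phi> \<in> test_functions \<Omega> \<Longrightarrow> smooth \<phi>"
  by (simp add: test_functions_def smooth_def)

lemma test_function_support:
  assumes "\<phi> \<in> test_functions \<Omega>"
  obtains K where "compact K" "K \<subseteq> \<Omega>" "\<And>x. x \<notin> K \<Longrightarrow> \<phi> x = 0"
  using assms by (auto simp: test_functions_def)

lemma compact_support_L2:
  assumes \<Omega>: "\<Omega> \<in> lmeasurable" and f: "continuous_on UNIV f" and K: "compact K" "\<And>x. x \<notin> K \<Longrightarrow> f x = 0"
  shows "f \<in> L2 \<Omega>"
proof -
  obtain B where B: "\<And>x. norm (f x) \<le> B" using continuous_support_bounded[OF f K] by blast
  show ?thesis
    by (rule Lp_bounded[OF \<Omega>, where B=B])
       (use f \<Omega> B in \<open>auto intro!: continuous_measurable_lebesgue_on\<close>)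
qed

lemma test_function_L2:
  assumes "\<Omega> \<in> lmeasurable" "\<phi> \<in> test_functions \<Omega>"
  shows "\<phi> \<in> L2 \<Omega>" and "b \<in> Basis \<Longrightarrow> partial b \<phi> \<in> L2 \<Omega>"
proof -
  obtain K where K: "compact K" "\<And>x. x \<notin> K \<Longrightarrow> \<phi> x = 0" by (rule test_function_support[OF assms(2)]) iprover
  have s: "smooth \<phi>" by (rule test_function_smooth[OF assms(2)])
  show "\<phi> \<in> L2 \<Omega>" by (rule compact_support_L2[OF assms(1) smooth_continuous[OF s] K])
  show "partial b \<phi> \<in> L2 \<Omega>" if "b \<in> Basis"
    by (rule compact_support_L2[OF assms(1) smooth_continuous[OF smooth_partial[OF s that]] K(1) partial_outside_support[OF K]])
qed

text \<open>The products under the integrals have compact support inside the domain, so no boundary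
  term arises.\<close>

lemma Green_first_identity:
  fixes f :: "'a::euclidean_space \<Rightarrow> complex"
  assumes \<Omega>: "\<Omega> \<in> sets lebesgue" and f: "smooth f" and \<phi>: "\<phi> \<in> test_functions \<Omega>"
  shows "(\<Sum>b\<in>Basis. L2_inner \<Omega> (partial b f) (partial b \<phi>)) = - L2_inner \<Omega> (\<lambda>x. \<Sum>b\<in>Basis. partial b (partial b f) x) \<phi>"
proof -
  obtain K where K: "compact K" "K \<subseteq> \<Omega>" "\<And>x. x \<notin> K \<Longrightarrow> \<phi> x = 0" using test_function_support[OF \<phi>] by blast
  have s: "smooth \<phi>" by (rule test_function_smooth[OF \<phi>])
  have inner: "L2_inner \<Omega> g \<psi> = (\<integral>x. g x * cnj (\<psi> x) \<partial>lborel)" and int: "integrable lborel (\<lambda>x. g x * cnj (\<psi> x))"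
    if "continuous_on UNIV g" "continuous_on UNIV \<psi>" "\<And>x. x \<notin> K \<Longrightarrow> \<psi> x = 0" for g \<psi> :: "'a \<Rightarrow> complex"
  proof -
    have c: "continuous_on UNIV (\<lambda>x. g x * cnj (\<psi> x))" using that by (auto intro!: continuous_intros)
    show "L2_inner \<Omega> g \<psi> = (\<integral>x. g x * cnj (\<psi> x) \<partial>lborel)"
      unfolding L2_inner_def
      by (rule integral_lebesgue_on_eq_lborel[OF \<Omega>])
         (use c K that in \<open>auto intro: borel_measurable_continuous_onI\<close>)
    show "integrable lborel (\<lambda>x. g x * cnj (\<psi> x))"
      by (rule continuous_compact_support_integrable[OF c K(1)]) (simp add: that)
  qed
  have one: "L2_inner \<Omega> (partial b f) (partial b \<phi>) = - (\<integral>x. partial b (partial b f) x * cnj (\<phi> x) \<partial>lborel)"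
    if b: "b \<in> Basis" for b
  proof -
    have fb: "smooth (partial b f)" by (rule smooth_partial[OF f b])
    have sm: "smooth (\<lambda>x. partial b f x * cnj (\<phi> x))" by (intro smooth_mult smooth_cnj fb s)
    have "partial b (\<lambda>x. partial b f x * cnj (\<phi> x)) =
        (\<lambda>x. partial b f x * cnj (partial b \<phi> x) + partial b (partial b f) x * cnj (\<phi> x))"
      by (intro ext partial_eqI has_derivative_mult bounded_linear.has_derivative[OF bounded_linear_cnj]
          has_derivative_partial smooth_differentiable fb s)
    moreover have "integral\<^sup>L lborel (partial b (\<lambda>x. partial b f x * cnj (\<phi> x))) = 0"
      by (rule integral_partial_zero[OF sm K(1) _ b]) (simp add: K)
    moreover have i1: "integrable lborel (\<lambda>x. partial b f x * cnj (partial b \<phi> x))"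
      by (rule int) (use fb smooth_partial[OF s b] smooth_continuous partial_outside_support[OF K(1,3)] in auto)
    moreover have i2: "integrable lborel (\<lambda>x. partial b (partial b f) x * cnj (\<phi> x))"
      by (rule int) (use smooth_partial[OF fb b] s smooth_continuous K in auto)
    ultimately have "(\<integral>x. partial b f x * cnj (partial b \<phi> x) \<partial>lborel) + (\<integral>x. partial b (partial b f) x * cnj (\<phi> x) \<partial>lborel) = 0"
      by simp
    moreover have "L2_inner \<Omega> (partial b f) (partial b \<phi>) = (\<integral>x. partial b f x * cnj (partial b \<phi> x) \<partial>lborel)"
      by (rule inner) (use fb smooth_partial[OF s b] smooth_continuous partial_outside_support[OF K(1,3)] in auto)
    ultimately show ?thesis by (simp add: eq_neg_iff_add_eq_0)
  qed
  have cf: "continuous_on UNIV (partial b (partial b f))" if "b \<in> Basis" for b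
    by (intro smooth_continuous smooth_partial f that)
  have "L2_inner \<Omega> (\<lambda>x. \<Sum>b\<in>Basis. partial b (partial b f) x) \<phi>
      = (\<integral>x. (\<Sum>b\<in>Basis. partial b (partial b f) x * cnj (\<phi> x)) \<partial>lborel)"
    using cf s by (subst inner) (auto intro!: continuous_on_sum smooth_continuous[OF s] K simp: sum_distrib_right)
  also have "\<dots> = (\<Sum>b\<in>Basis. \<integral>x. partial b (partial b f) x * cnj (\<phi> x) \<partial>lborel)"
    by (rule Bochner_Integration.integral_sum) (auto intro!: int cf smooth_continuous[OF s] K)
  finally show ?thesis by (simp add: one sum_negf)
qed

text \<open>Symmetry of the Dirichlet form: each weak equation extends from test functions to their
  limits in \<open>H\<^sup>1\<^sub>0\<close>, so both sides equal \<open>\<langle>\<nabla>u, \<nabla>v\<rangle>\<close>.\<close>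

lemma minus_laplacian_symmetric:
  assumes \<Omega>: "\<Omega> \<in> lmeasurable" and u: "minus_laplacian \<Omega> u f" and v: "minus_laplacian \<Omega> v h"
  shows "L2_inner \<Omega> f v = L2_inner \<Omega> u h"
proof -
  obtain g where f: "f \<in> L2 \<Omega>" and g: "H10 \<Omega> u g"
    and weq: "\<And>\<phi>. \<phi> \<in> test_functions \<Omega> \<Longrightarrow> (\<Sum>b\<in>Basis. L2_inner \<Omega> (g b) (partial b \<phi>)) = L2_inner \<Omega> f \<phi>"
    using u unfolding minus_laplacian_def by blast
  obtain k where h: "h \<in> L2 \<Omega>" and k: "H10 \<Omega> v k"
    and veq: "\<And>\<phi>. \<phi> \<in> test_functions \<Omega> \<Longrightarrow> (\<Sum>b\<in>Basis. L2_inner \<Omega> (k b) (partial b \<phi>)) = L2_inner \<Omega> h \<phi>"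
    using v unfolding minus_laplacian_def by blast
  have extend: "(\<Sum>b\<in>Basis. L2_inner \<Omega> (g b) (k b)) = L2_inner \<Omega> f v"
    if f: "f \<in> L2 \<Omega>" and g: "\<And>b. b \<in> Basis \<Longrightarrow> g b \<in> L2 \<Omega>" and k: "H10 \<Omega> v k"
      and weq: "\<And>\<phi>. \<phi> \<in> test_functions \<Omega> \<Longrightarrow> (\<Sum>b\<in>Basis. L2_inner \<Omega> (g b) (partial b \<phi>)) = L2_inner \<Omega> f \<phi>"
    for f v :: "'a \<Rightarrow> complex" and g k :: "'a \<Rightarrow> 'a \<Rightarrow> complex"
  proof -
    obtain \<phi> where \<phi>: "\<And>n. \<phi> n \<in> test_functions \<Omega>"
      and l0: "(\<lambda>n. L2_norm \<Omega> (\<lambda>x. \<phi> n x - v x)) \<longlonglongrightarrow> 0"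
      and l1: "\<And>b. b \<in> Basis \<Longrightarrow> (\<lambda>n. L2_norm \<Omega> (\<lambda>x. partial b (\<phi> n) x - k b x)) \<longlonglongrightarrow> 0"
      using k unfolding H10_def by blast
    have vL: "v \<in> L2 \<Omega>" and kL: "\<And>b. b \<in> Basis \<Longrightarrow> k b \<in> L2 \<Omega>" using k unfolding H10_def by auto
    have "(\<lambda>n. L2_inner \<Omega> f (\<phi> n)) \<longlonglongrightarrow> L2_inner \<Omega> f v"
      by (rule L2_inner_tendsto_right[OF test_function_L2(1)[OF \<Omega> \<phi>] vL f l0])
    moreover have "(\<lambda>n. \<Sum>b\<in>Basis. L2_inner \<Omega> (g b) (partial b (\<phi> n))) \<longlonglongrightarrow> (\<Sum>b\<in>Basis. L2_inner \<Omega> (g b) (k b))"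
      by (intro tendsto_sum L2_inner_tendsto_right test_function_L2(2)[OF \<Omega> \<phi>] kL g l1)
    ultimately show ?thesis unfolding weq[OF \<phi>] by (rule LIMSEQ_unique[rotated])
  qed
  have "(\<Sum>b\<in>Basis. L2_inner \<Omega> (g b) (k b)) = L2_inner \<Omega> f v"
    by (rule extend[OF f _ k weq]) (use g in \<open>simp add: H10_def\<close>)
  moreover have "(\<Sum>b\<in>Basis. L2_inner \<Omega> (k b) (g b)) = L2_inner \<Omega> h u"
    by (rule extend[OF h _ g veq]) (use k in \<open>simp add: H10_def\<close>)
  then have "cnj (\<Sum>b\<in>Basis. L2_inner \<Omega> (k b) (g b)) = cnj (L2_inner \<Omega> h u)" by (rule arg_cong)
  then have "(\<Sum>b\<in>Basis. L2_inner \<Omega> (g b) (k b)) = L2_inner \<Omega> u h"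
    by (simp add: L2_inner_commute[symmetric])
  ultimately show ?thesis by simp
qed

section \<open>Orthogonality to continuous functions\<close>

text \<open>Continuous approximations of the sign of \<open>g\<close>, clamped to \<open>[-1, 1]\<close>, turn the tested integrals into
  \<open>\<integral>|g|\<close> in the limit.\<close>

lemma AE_zero_if_orthogonal_to_continuous_real:
  fixes g :: "'a::euclidean_space \<Rightarrow> real"
  assumes \<Omega>: "\<Omega> \<in> sets lebesgue" and g: "integrable (lebesgue_on \<Omega>) g"
    and orth: "\<And>h. continuous_on UNIV h \<Longrightarrow> (\<integral>x. g x * h x \<partial>lebesgue_on \<Omega>) = 0"
  shows "AE x in lebesgue_on \<Omega>. g x = 0"
proof -
  have gm[measurable]: "g \<in> borel_measurable (lebesgue_on \<Omega>)" using g by (rule borel_measurable_integrable)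
  have sm: "(\<lambda>x. sgn (g x)) \<in> borel_measurable (lebesgue_on \<Omega>)" by measurable
  then have "(\<lambda>x. sgn (g x)) measurable_on \<Omega>" by (simp add: measurable_on_iff_borel_measurable[OF \<Omega>])
  then obtain N h where N: "negligible N" and h: "\<And>n. continuous_on UNIV (h n)"
    and lim: "\<And>x. x \<notin> N \<Longrightarrow> (\<lambda>n. h n x) \<longlonglongrightarrow> (if x \<in> \<Omega> then sgn (g x) else 0)"
    unfolding measurable_on_def by blast
  define k where "k = (\<lambda>n x. max (-1) (min 1 (h n x)))"
  have k: "continuous_on UNIV (k n)" for n
    unfolding k_def using h by (intro continuous_intros) auto
  have "AE x in lebesgue. x \<notin> N" using N by (intro AE_not_in) (simp add: negligible_iff_null_sets)
  then have AEN: "AE x in lebesgue_on \<Omega>. x \<notin> N" using \<Omega> by (subst AE_restrict_space_iff) auto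
  have "(\<lambda>n. \<integral>x. g x * k n x \<partial>lebesgue_on \<Omega>) \<longlonglongrightarrow> (\<integral>x. \<bar>g x\<bar> \<partial>lebesgue_on \<Omega>)"
  proof (rule integral_dominated_convergence[where w="\<lambda>x. \<bar>g x\<bar>"])
    show "AE x in lebesgue_on \<Omega>. (\<lambda>n. g x * k n x) \<longlonglongrightarrow> \<bar>g x\<bar>"
      using AEN AE_space
    proof eventually_elim
      case (elim x)
      then have "(\<lambda>n. h n x) \<longlonglongrightarrow> sgn (g x)" using lim[of x] by simp
      then have "(\<lambda>n. g x * k n x) \<longlonglongrightarrow> g x * max (-1) (min 1 (sgn (g x)))"
        unfolding k_def by (intro tendsto_intros)
      moreover have "g x * max (-1) (min 1 (sgn (g x))) = \<bar>g x\<bar>" by (simp add: sgn_if)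
      ultimately show ?case by simp
    qed
    show "AE x in lebesgue_on \<Omega>. norm (g x * k n x) \<le> \<bar>g x\<bar>" for n
    proof (rule AE_I2)
      fix x
      have "\<bar>k n x\<bar> \<le> 1" by (auto simp: k_def)
      then show "norm (g x * k n x) \<le> \<bar>g x\<bar>" by (simp add: abs_mult mult_left_le)
    qed
    show "(\<lambda>x. g x * k n x) \<in> borel_measurable (lebesgue_on \<Omega>)" for n
      using continuous_measurable_lebesgue_on[OF k \<Omega>] by (intro borel_measurable_times gm) auto
  qed (use g in auto)
  then have "(\<integral>x. \<bar>g x\<bar> \<partial>lebesgue_on \<Omega>) = 0" by (simp add: orth[OF k] LIMSEQ_const_iff)
  then show ?thesis
    using integral_nonneg_eq_0_iff_AE[of "lebesgue_on \<Omega>" "\<lambda>x. \<bar>g x\<bar>"] g by simp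
qed

lemma AE_zero_if_orthogonal_to_continuous:
  fixes g :: "'a::euclidean_space \<Rightarrow> complex"
  assumes \<Omega>: "\<Omega> \<in> lmeasurable" "bounded \<Omega>" and g: "integrable (lebesgue_on \<Omega>) g"
    and orth: "\<And>h::'a \<Rightarrow> real. continuous_on UNIV h \<Longrightarrow> (\<integral>x. g x * of_real (h x) \<partial>lebesgue_on \<Omega>) = 0"
  shows "AE x in lebesgue_on \<Omega>. g x = 0"
proof -
  have S: "\<Omega> \<in> sets lebesgue" using \<Omega> by auto
  have int: "integrable (lebesgue_on \<Omega>) (\<lambda>x. g x * of_real (h x))" if h: "continuous_on UNIV h" for h :: "'a \<Rightarrow> real"
  proof -
    have "bounded (h ` closure \<Omega>)"
      using h \<Omega> by (intro compact_imp_bounded compact_continuous_image) (auto intro: continuous_on_subset)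
    then obtain B where B: "\<And>x. x \<in> closure \<Omega> \<Longrightarrow> norm (h x) \<le> B" by (auto simp: bounded_iff)
    show ?thesis
    proof (rule Bochner_Integration.integrable_bound[of _ "\<lambda>x. \<bar>B\<bar> * norm (g x)"])
      show "integrable (lebesgue_on \<Omega>) (\<lambda>x. \<bar>B\<bar> * norm (g x))" using g by simp
      show "(\<lambda>x. g x * of_real (h x)) \<in> borel_measurable (lebesgue_on \<Omega>)"
        using continuous_measurable_lebesgue_on[OF h S] borel_measurable_integrable[OF g] by simp
      show "AE x in lebesgue_on \<Omega>. norm (g x * of_real (h x)) \<le> norm (\<bar>B\<bar> * norm (g x))"
        using AE_space
      proof eventually_elim
        case (elim x)
        then have "x \<in> closure \<Omega>" using closure_subset[of \<Omega>] by auto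
        then have "\<bar>h x\<bar> \<le> \<bar>B\<bar>" using B[of x] by auto
        from mult_left_mono[OF this norm_ge_zero[of "g x"]]
        show ?case by (simp add: norm_mult abs_mult mult.commute)
      qed
    qed
  qed
  have "AE x in lebesgue_on \<Omega>. Re (g x) = 0"
  proof (rule AE_zero_if_orthogonal_to_continuous_real[OF S])
    show "(\<integral>x. Re (g x) * h x \<partial>lebesgue_on \<Omega>) = 0" if "continuous_on UNIV h" for h
      using integral_Re[OF int[OF that]] orth[OF that] by simp
  qed (use g in auto)
  moreover have "AE x in lebesgue_on \<Omega>. Im (g x) = 0"
  proof (rule AE_zero_if_orthogonal_to_continuous_real[OF S])
    show "(\<integral>x. Im (g x) * h x \<partial>lebesgue_on \<Omega>) = 0" if "continuous_on UNIV h" for h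
      using integral_Im[OF int[OF that]] orth[OF that] by simp
  qed (use g in auto)
  ultimately show ?thesis by eventually_elim (simp add: complex_eq_iff)
qed

section \<open>Cut-off sines\<close>

lemma smooth_sin: "smooth (\<lambda>x. complex_of_real (sin (x \<bullet> d + e)))"
proof -
  have "((\<lambda>s. sin (s + real n * (pi/2))) has_real_derivative sin (s + real (Suc n) * (pi/2))) (at s)" for n s
  proof -
    have "sin (s + real (Suc n) * (pi/2)) = sin ((s + real n * (pi/2)) + pi/2)"
      by (simp add: algebra_simps add_divide_distrib)
    also have "\<dots> = cos (s + real n * (pi/2))" by (simp add: sin_add)
    finally show ?thesis by (auto intro!: derivative_eq_intros)
  qed
  from smooth_ridge[of "\<lambda>n s. sin (s + real n * (pi/2))" 0 d e, OF this] show ?thesis by simp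
qed

lemma smooth_flat: "smooth (\<lambda>x. complex_of_real (flat 0 (x \<bullet> d + e)))"
  by (rule smooth_ridge[of flat 0 d e, OF flat_derivative])

text \<open>Meant for frequencies with \<open>sin (\<kappa> a) = 0\<close>; the cutoff acts near the end points of \<open>[0, a]\<close> at the
  scale \<open>1/(i+1)\<close>.\<close>

definition sine_cutoff :: "real \<Rightarrow> real \<Rightarrow> nat \<Rightarrow> real \<Rightarrow> real" where
  "sine_cutoff a \<kappa> i s = sin (\<kappa> * s) * (flat 0 (real (Suc i) * s - 1) * flat 0 (real (Suc i) * (a - s) - 1))"

definition sine_cutoff_deriv :: "real \<Rightarrow> real \<Rightarrow> nat \<Rightarrow> real \<Rightarrow> real" where
  "sine_cutoff_deriv a \<kappa> i s =
     \<kappa> * cos (\<kappa> * s) * (flat 0 (real (Suc i) * s - 1) * flat 0 (real (Suc i) * (a - s) - 1))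
     + sin (\<kappa> * s) * (real (Suc i) * flat (Suc 0) (real (Suc i) * s - 1)) * flat 0 (real (Suc i) * (a - s) - 1)
     - sin (\<kappa> * s) * (real (Suc i) * flat (Suc 0) (real (Suc i) * (a - s) - 1)) * flat 0 (real (Suc i) * s - 1)"

lemma sine_cutoff_derivative:
  "(sine_cutoff a \<kappa> i has_real_derivative sine_cutoff_deriv a \<kappa> i s) (at s)"
  unfolding sine_cutoff_def[abs_def] sine_cutoff_deriv_def
  by (auto intro!: derivative_eq_intros DERIV_chain2[OF flat_derivative] simp del: of_nat_Suc) (simp add: algebra_simps del: of_nat_Suc)

lemma abs_sin_reflect:
  fixes \<kappa> a s :: real
  assumes "sin (\<kappa> * a) = 0"
  shows "\<bar>sin (\<kappa> * s)\<bar> = \<bar>sin (\<kappa> * (a - s))\<bar>"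
proof -
  have "\<bar>cos (\<kappa> * a)\<bar> = 1"
    using sin_cos_squared_add[of "\<kappa> * a"] assms by (simp add: abs_square_eq_1)
  moreover have "sin (\<kappa> * (a - s)) = - cos (\<kappa> * a) * sin (\<kappa> * s)"
    using assms by (simp add: right_diff_distrib sin_diff)
  ultimately show ?thesis by (simp add: abs_mult)
qed

text \<open>The derivative of the cutoff grows like the reciprocal of the distance to the end point, which
  the zero of the sine compensates.\<close>

lemma sine_times_flat_derivative:
  assumes "0 \<le> \<kappa>" "0 \<le> r"
  shows "\<bar>sin (\<kappa> * r) * (real (Suc i) * flat (Suc 0) (real (Suc i) * r - 1))\<bar>
     \<le> \<kappa> * ((real (Suc i) * r - 1 + 1) * flat (Suc 0) (real (Suc i) * r - 1))"
proof -
  have f: "0 \<le> flat (Suc 0) y" for y by (simp add: flat_1)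
  have "\<bar>sin (\<kappa> * r)\<bar> \<le> \<kappa> * r" using abs_sin_x_le_abs_x[of "\<kappa> * r"] assms by simp
  then have "\<bar>sin (\<kappa> * r)\<bar> * (real (Suc i) * flat (Suc 0) (real (Suc i) * r - 1)) \<le> \<kappa> * r * (real (Suc i) * flat (Suc 0) (real (Suc i) * r - 1))"
    by (rule mult_right_mono) (simp add: f)
  then show ?thesis by (simp add: abs_mult f mult_ac del: of_nat_Suc)
qed

lemma filterlim_scaled_at_top: "0 < r \<Longrightarrow> filterlim (\<lambda>i. real (Suc i) * r - 1) at_top sequentially"
proof -
  assume "0 < r"
  then have "filterlim (\<lambda>i. r * real (Suc i)) at_top sequentially"
    by (intro filterlim_tendsto_pos_mult_at_top[OF tendsto_const] filterlim_compose[OF filterlim_real_sequentially filterlim_Suc])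
  then have "filterlim (\<lambda>i. - 1 + r * real (Suc i)) at_top sequentially"
    by (rule filterlim_tendsto_add_at_top[OF tendsto_const])
  then show ?thesis by (simp add: mult.commute)
qed

lemma sine_times_flat_derivative_tendsto:
  assumes "0 \<le> \<kappa>" "0 < r" and g: "\<And>i. \<bar>g i\<bar> = \<bar>sin (\<kappa> * r)\<bar>"
  shows "(\<lambda>i. g i * (real (Suc i) * flat (Suc 0) (real (Suc i) * r - 1))) \<longlonglongrightarrow> 0"
proof (rule Lim_null_comparison)
  show "\<forall>\<^sub>F i in sequentially. norm (g i * (real (Suc i) * flat (Suc 0) (real (Suc i) * r - 1)))
      \<le> \<kappa> * ((real (Suc i) * r - 1 + 1) * flat (Suc 0) (real (Suc i) * r - 1))"
    using sine_times_flat_derivative[of \<kappa> r] assms by (simp add: abs_mult)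
  have "(\<lambda>i. (real (Suc i) * r - 1 + 1) * flat (Suc 0) (real (Suc i) * r - 1)) \<longlonglongrightarrow> 0"
    by (rule filterlim_compose[OF flat_1_weighted_tendsto filterlim_scaled_at_top[OF assms(2)]])
  then show "(\<lambda>i. \<kappa> * ((real (Suc i) * r - 1 + 1) * flat (Suc 0) (real (Suc i) * r - 1))) \<longlonglongrightarrow> 0"
    by (rule tendsto_mult_right_zero)
qed

lemma flat_0_scaled_tendsto: "0 < r \<Longrightarrow> (\<lambda>i. flat 0 (real (Suc i) * r - 1)) \<longlonglongrightarrow> 1"
  by (rule filterlim_compose[OF flat_0_tendsto filterlim_scaled_at_top])

lemma sine_cutoff_bound: "\<bar>sine_cutoff a \<kappa> i s\<bar> \<le> 1"
  unfolding sine_cutoff_def abs_mult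
  by (intro mult_le_one) (auto simp: flat_0_le)

lemma sine_cutoff_deriv_bound:
  assumes \<kappa>: "0 \<le> \<kappa>" "sin (\<kappa> * a) = 0" and s: "0 < s" "s < a"
  shows "\<bar>sine_cutoff_deriv a \<kappa> i s\<bar> \<le> 7 * \<kappa>"
proof -
  define F where "F = flat 0 (real (Suc i) * s - 1)"
  define G where "G = flat 0 (real (Suc i) * (a - s) - 1)"
  define P where "P = real (Suc i) * flat (Suc 0) (real (Suc i) * s - 1)"
  define Q where "Q = real (Suc i) * flat (Suc 0) (real (Suc i) * (a - s) - 1)"
  have FG: "\<bar>F\<bar> \<le> 1" "\<bar>G\<bar> \<le> 1" by (simp_all add: F_def G_def flat_0_le)
  have "\<bar>sin (\<kappa> * s) * P\<bar> \<le> \<kappa> * 3"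
    unfolding P_def using s \<kappa>
    by (intro order_trans[OF sine_times_flat_derivative] mult_left_mono flat_1_weighted) auto
  then have 1: "\<bar>sin (\<kappa> * s) * P * G\<bar> \<le> \<kappa> * 3 * 1"
    unfolding abs_mult[of _ G] using FG \<kappa> by (intro mult_mono) auto
  have "\<bar>sin (\<kappa> * (a - s)) * Q\<bar> \<le> \<kappa> * 3"
    unfolding Q_def using s \<kappa>
    by (intro order_trans[OF sine_times_flat_derivative] mult_left_mono flat_1_weighted) auto
  then have "\<bar>sin (\<kappa> * s) * Q\<bar> \<le> \<kappa> * 3" by (simp add: abs_mult abs_sin_reflect[OF \<kappa>(2), of s])
  then have 2: "\<bar>sin (\<kappa> * s) * Q * F\<bar> \<le> \<kappa> * 3 * 1"
    unfolding abs_mult[of _ F] using FG \<kappa> by (intro mult_mono) auto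
  have "\<bar>\<kappa> * cos (\<kappa> * s)\<bar> \<le> \<kappa> * 1" unfolding abs_mult using \<kappa> by (intro mult_mono) auto
  moreover have "\<bar>F * G\<bar> \<le> 1" unfolding abs_mult using FG by (intro mult_le_one) auto
  ultimately have 3: "\<bar>\<kappa> * cos (\<kappa> * s) * (F * G)\<bar> \<le> \<kappa> * 1 * 1"
    unfolding abs_mult[of _ "F * G"] using \<kappa> by (intro mult_mono) auto
  have "sine_cutoff_deriv a \<kappa> i s = \<kappa> * cos (\<kappa> * s) * (F * G) + sin (\<kappa> * s) * P * G - sin (\<kappa> * s) * Q * F"
    unfolding sine_cutoff_deriv_def F_def G_def P_def Q_def by (rule refl)
  then show ?thesis using 1 2 3 by linarith
qed

lemma sine_cutoff_tendsto:
  assumes s: "0 < s" "s < a"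
  shows "(\<lambda>i. sine_cutoff a \<kappa> i s) \<longlonglongrightarrow> sin (\<kappa> * s)"
proof -
  have "(\<lambda>i. sine_cutoff a \<kappa> i s) \<longlonglongrightarrow> sin (\<kappa> * s) * (1 * 1)"
    unfolding sine_cutoff_def using s by (intro tendsto_intros flat_0_scaled_tendsto) auto
  then show ?thesis by simp
qed

lemma sine_cutoff_deriv_tendsto:
  assumes \<kappa>: "0 \<le> \<kappa>" "sin (\<kappa> * a) = 0" and s: "0 < s" "s < a"
  shows "(\<lambda>i. sine_cutoff_deriv a \<kappa> i s) \<longlonglongrightarrow> \<kappa> * cos (\<kappa> * s)"
proof -
  have "(\<lambda>i. sine_cutoff_deriv a \<kappa> i s) \<longlonglongrightarrow> \<kappa> * cos (\<kappa> * s) * (1 * 1) + 0 * 1 - 0 * 1"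
    unfolding sine_cutoff_deriv_def
    using s \<kappa> by (intro tendsto_add tendsto_diff tendsto_mult tendsto_const flat_0_scaled_tendsto
       sine_times_flat_derivative_tendsto[where \<kappa>=\<kappa>] abs_sin_reflect) auto
  then show ?thesis by simp
qed

definition coord :: "'a::euclidean_space \<Rightarrow> 'a \<Rightarrow> 'a \<Rightarrow> real" where
  "coord c d x = (x - c) \<bullet> d"

lemma coord_derivative: "(coord c d has_derivative (\<lambda>v. v \<bullet> d)) (at x)"
  unfolding coord_def[abs_def] by (auto intro!: derivative_eq_intros)

lemma continuous_on_coord [continuous_intros]: "continuous_on S (coord c d)"
  unfolding coord_def[abs_def] by (intro continuous_intros)

definition tensor :: "'a::euclidean_space \<Rightarrow> 'a \<Rightarrow> 'a \<Rightarrow> (real \<Rightarrow> real) \<Rightarrow> (real \<Rightarrow> real) \<Rightarrow> 'a \<Rightarrow> complex" where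
  "tensor c d1 d2 h k x = complex_of_real (h (coord c d1 x) * k (coord c d2 x))"

lemma tensor_derivative:
  assumes h: "(h has_real_derivative h') (at (coord c d1 x))" and k: "(k has_real_derivative k') (at (coord c d2 x))"
  shows "(tensor c d1 d2 h k has_derivative
     (\<lambda>v. complex_of_real ((v \<bullet> d1) * (h' * k (coord c d2 x)) + (v \<bullet> d2) * (h (coord c d1 x) * k')))) (at x)"
proof -
  have 1: "((\<lambda>x. h (coord c d1 x)) has_derivative (\<lambda>v. h' * (v \<bullet> d1))) (at x)"
    by (rule has_derivative_compose[OF coord_derivative h[unfolded has_field_derivative_def]])
  have 2: "((\<lambda>x. k (coord c d2 x)) has_derivative (\<lambda>v. k' * (v \<bullet> d2))) (at x)"
    by (rule has_derivative_compose[OF coord_derivative k[unfolded has_field_derivative_def]])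
  have "((\<lambda>x. complex_of_real (h (coord c d1 x) * k (coord c d2 x))) has_derivative
     (\<lambda>v. complex_of_real (h (coord c d1 x) * (k' * (v \<bullet> d2)) + h' * (v \<bullet> d1) * k (coord c d2 x)))) (at x)"
    by (rule has_derivative_of_real[OF has_derivative_mult[OF 1 2]])
  then show ?thesis unfolding tensor_def[abs_def] by (simp only: mult_ac add.commute)
qed

lemma smooth_sin_coord: "smooth (\<lambda>x. complex_of_real (sin (\<kappa> * coord c d x)))"
  using smooth_sin[of "\<kappa> *\<^sub>R d" "- \<kappa> * (c \<bullet> d)"] by (simp add: coord_def inner_diff_left algebra_simps)

lemma smooth_sine_cutoff: "smooth (\<lambda>x. complex_of_real (sine_cutoff a \<kappa> i (coord c d x)))"
proof -
  have "smooth (\<lambda>x. complex_of_real (flat 0 (real (Suc i) * coord c d x - 1)))"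
    using smooth_flat[of "real (Suc i) *\<^sub>R d" "- real (Suc i) * (c \<bullet> d) - 1"]
    by (simp add: coord_def inner_diff_left algebra_simps)
  moreover have "smooth (\<lambda>x. complex_of_real (flat 0 (real (Suc i) * (a - coord c d x) - 1)))"
    using smooth_flat[of "- real (Suc i) *\<^sub>R d" "real (Suc i) * (a + c \<bullet> d) - 1"]
    by (simp add: coord_def inner_diff_left algebra_simps)
  ultimately show ?thesis
    unfolding sine_cutoff_def of_real_mult by (intro smooth_mult smooth_sin_coord)
qed

section \<open>Eigenfunctions on a rectangle\<close>

locale rectangle =
  fixes \<Omega> :: "(real^2) set" and c d1 d2 :: "real^2" and a b :: real
  assumes unit: "norm d1 = 1" "norm d2 = 1" and orth: "d1 \<bullet> d2 = 0" and pos: "0 < a" "0 < b"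
    and Omega_eq: "\<Omega> = {c + s *\<^sub>R d1 + t *\<^sub>R d2 | s t. 0 < s \<and> s < a \<and> 0 < t \<and> t < b}"
begin

abbreviation "X \<equiv> coord c d1"
abbreviation "Y \<equiv> coord c d2"

lemma inner_dirs: "d1 \<bullet> d1 = 1" "d2 \<bullet> d2 = 1" "d1 \<bullet> d2 = 0" "d2 \<bullet> d1 = 0"
  using unit orth by (auto simp: dot_square_norm inner_commute)

lemma swap: "rectangle \<Omega> c d2 d1 b a"
proof
  have comm: "c + s *\<^sub>R d1 + t *\<^sub>R d2 = c + t *\<^sub>R d2 + s *\<^sub>R d1" for s t by (simp add: algebra_simps)
  then show "\<Omega> = {c + s *\<^sub>R d2 + t *\<^sub>R d1 |s t. 0 < s \<and> s < b \<and> 0 < t \<and> t < a}"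
    unfolding Omega_eq comm by blast
qed (use unit orth pos in \<open>auto simp: inner_commute\<close>)

lemma decompose: "x = c + X x *\<^sub>R d1 + Y x *\<^sub>R d2"
proof -
  define w where "w = x - (c + X x *\<^sub>R d1 + Y x *\<^sub>R d2)"
  have w: "w \<bullet> d1 = 0" "w \<bullet> d2 = 0"
    by (auto simp: w_def coord_def inner_diff_left inner_add_left inner_dirs)
  have "w = 0"
  proof (rule ccontr)
    assume "w \<noteq> 0"
    have ne: "d1 \<noteq> 0" "d2 \<noteq> 0" using unit by auto
    have "d1 \<noteq> d2" "w \<noteq> d1" "w \<noteq> d2" using inner_dirs w by auto
    then have "card {w, d1, d2} = 3" by simp
    moreover have "independent {w, d1, d2}"
      using w inner_dirs \<open>w \<noteq> 0\<close> ne
      by (intro pairwise_orthogonal_independent) (auto simp: pairwise_def orthogonal_def inner_commute)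
    then have "card {w, d1, d2} \<le> DIM(real^2)" by (rule independent_card_le)
    ultimately show False by simp
  qed
  then show ?thesis by (simp add: w_def)
qed

lemma mem_iff: "x \<in> \<Omega> \<longleftrightarrow> 0 < X x \<and> X x < a \<and> 0 < Y x \<and> Y x < b"
proof
  assume "x \<in> \<Omega>"
  then obtain s t where "x = c + s *\<^sub>R d1 + t *\<^sub>R d2" "0 < s" "s < a" "0 < t" "t < b"
    unfolding Omega_eq by auto
  then show "0 < X x \<and> X x < a \<and> 0 < Y x \<and> Y x < b"
    by (simp add: coord_def inner_add_left inner_dirs)
next
  assume "0 < X x \<and> X x < a \<and> 0 < Y x \<and> Y x < b"
  then show "x \<in> \<Omega>" unfolding Omega_eq using decompose[of x] by blast
qed

lemma Omega_halfspaces: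
  "\<Omega> = {x. d1 \<bullet> x > c \<bullet> d1} \<inter> {x. d1 \<bullet> x < a + c \<bullet> d1} \<inter> {x. d2 \<bullet> x > c \<bullet> d2} \<inter> {x. d2 \<bullet> x < b + c \<bullet> d2}"
  by (auto simp: mem_iff coord_def inner_diff_left inner_diff_right inner_commute)

lemma open_Omega: "open \<Omega>"
  unfolding Omega_halfspaces by (intro open_Int open_halfspace_gt open_halfspace_lt)

lemma convex_Omega: "convex \<Omega>"
  unfolding Omega_halfspaces by (intro convex_Int convex_halfspace_gt convex_halfspace_lt)

lemma norm_le_coords: "norm x \<le> norm c + \<bar>X x\<bar> + \<bar>Y x\<bar>"
proof -
  have "norm x = norm (c + X x *\<^sub>R d1 + Y x *\<^sub>R d2)" by (subst decompose) (rule refl)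
  also have "\<dots> \<le> norm c + norm (X x *\<^sub>R d1) + norm (Y x *\<^sub>R d2)" by (intro norm_triangle_le add_right_mono norm_triangle_ineq)
  finally show ?thesis by (simp add: unit)
qed

lemma compact_coord_box: "compact {x. s \<le> X x \<and> X x \<le> s' \<and> t \<le> Y x \<and> Y x \<le> t'}"
proof -
  have "norm x \<le> norm c + (\<bar>s\<bar> + \<bar>s'\<bar>) + (\<bar>t\<bar> + \<bar>t'\<bar>)"
    if "s \<le> X x \<and> X x \<le> s' \<and> t \<le> Y x \<and> Y x \<le> t'" for x
    using norm_le_coords[of x] that by linarith
  then have "bounded {x. s \<le> X x \<and> X x \<le> s' \<and> t \<le> Y x \<and> Y x \<le> t'}"
    unfolding bounded_iff by blast
  moreover have "closed {x. s \<le> X x \<and> X x \<le> s' \<and> t \<le> Y x \<and> Y x \<le> t'}"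
    by (intro closed_Collect_conj closed_Collect_le continuous_intros)
  ultimately show ?thesis by (simp add: compact_eq_bounded_closed)
qed

lemma bounded_Omega: "bounded \<Omega>"
  by (rule bounded_subset[OF compact_imp_bounded[OF compact_coord_box[of 0 a 0 b]]]) (auto simp: mem_iff)

lemma lmeasurable_Omega: "\<Omega> \<in> lmeasurable"
  by (rule lmeasurable_open[OF bounded_Omega open_Omega])

lemma sets_Omega: "\<Omega> \<in> sets lebesgue"
  using lmeasurable_Omega by auto

lemma measure_Omega_pos: "0 < measure lebesgue \<Omega>"
proof -
  have "c + (a/2) *\<^sub>R d1 + (b/2) *\<^sub>R d2 \<in> \<Omega>" using pos by (simp add: mem_iff coord_def inner_add_left inner_dirs)
  then have "\<not> negligible \<Omega>" using open_not_negligible[OF open_Omega] by blast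
  then show ?thesis
    using negligible_iff_measure[of \<Omega>] lmeasurable_Omega measure_nonneg[of lebesgue \<Omega>] by (auto simp: less_le)
qed

text \<open>Dominated convergence reduces membership in \<open>H\<^sup>1\<^sub>0\<close> of a product of functions of one coordinate
  each to pointwise convergence of the factors and of their derivatives.\<close>

lemma H10_tensor:
  fixes h h' k k' :: "real \<Rightarrow> real" and hs hs' ks ks' :: "nat \<Rightarrow> real \<Rightarrow> real"
  assumes test: "\<And>i. tensor c d1 d2 (hs i) (ks i) \<in> test_functions \<Omega>"
    and hd: "\<And>i s. (hs i has_real_derivative hs' i s) (at s)" and kd: "\<And>i s. (ks i has_real_derivative ks' i s) (at s)"
    and cont: "continuous_on UNIV h" "continuous_on UNIV h'" "continuous_on UNIV k" "continuous_on UNIV k'"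
    and hB: "\<And>i s. 0 < s \<Longrightarrow> s < a \<Longrightarrow> \<bar>hs i s\<bar> \<le> B \<and> \<bar>hs' i s\<bar> \<le> B \<and> \<bar>h s\<bar> \<le> B \<and> \<bar>h' s\<bar> \<le> B"
    and kB: "\<And>i t. 0 < t \<Longrightarrow> t < b \<Longrightarrow> \<bar>ks i t\<bar> \<le> B \<and> \<bar>ks' i t\<bar> \<le> B \<and> \<bar>k t\<bar> \<le> B \<and> \<bar>k' t\<bar> \<le> B"
    and hl: "\<And>s. 0 < s \<Longrightarrow> s < a \<Longrightarrow> (\<lambda>i. hs i s) \<longlonglongrightarrow> h s \<and> (\<lambda>i. hs' i s) \<longlonglongrightarrow> h' s"
    and kl: "\<And>t. 0 < t \<Longrightarrow> t < b \<Longrightarrow> (\<lambda>i. ks i t) \<longlonglongrightarrow> k t \<and> (\<lambda>i. ks' i t) \<longlonglongrightarrow> k' t"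
  shows "H10 \<Omega> (tensor c d1 d2 h k)
     (\<lambda>e x. complex_of_real ((e \<bullet> d1) * (h' (X x) * k (Y x)) + (e \<bullet> d2) * (h (X x) * k' (Y x))))"
proof -
  define G where "G = (\<lambda>f f' g g' e x. complex_of_real ((e \<bullet> d1) * (f' (X x) * g (Y x)) + (e \<bullet> d2) * (f (X x) * g' (Y x))))"
  have B: "0 \<le> B" using hB[of "a/2"] pos by force
  have mem: "0 < X x" "X x < a" "0 < Y x" "Y x < b" if "x \<in> \<Omega>" for x
    using that by (auto simp: mem_iff)
  have mult_B: "\<bar>u * v\<bar> \<le> B * B" if "\<bar>u\<bar> \<le> B" "\<bar>v\<bar> \<le> B" for u v
    unfolding abs_mult using that B by (intro mult_mono) auto
  have G_bound: "norm (G f f' g g' e x) \<le> 2 * (B * B)"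
    if e: "e \<in> Basis" and b: "\<bar>f (X x)\<bar> \<le> B" "\<bar>f' (X x)\<bar> \<le> B" "\<bar>g (Y x)\<bar> \<le> B" "\<bar>g' (Y x)\<bar> \<le> B"
    for f f' g g' e x
  proof -
    have ed: "\<bar>e \<bullet> d1\<bar> \<le> 1" "\<bar>e \<bullet> d2\<bar> \<le> 1"
      using Cauchy_Schwarz_ineq2[of e d1] Cauchy_Schwarz_ineq2[of e d2] e unit by auto
    have "\<bar>(e \<bullet> d1) * (f' (X x) * g (Y x))\<bar> \<le> 1 * (B * B)" "\<bar>(e \<bullet> d2) * (f (X x) * g' (Y x))\<bar> \<le> 1 * (B * B)"
      unfolding abs_mult[of "e \<bullet> _"] using ed b B by (intro mult_mono mult_B; simp)+
    then show ?thesis unfolding G_def norm_of_real by linarith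
  qed
  have G_cont: "continuous_on UNIV (G f f' g g' e)"
    if "continuous_on UNIV f" "continuous_on UNIV f'" "continuous_on UNIV g" "continuous_on UNIV g'" for f f' g g' e
    unfolding G_def
    by (intro continuous_intros continuous_on_compose2[OF that(1)] continuous_on_compose2[OF that(2)]
        continuous_on_compose2[OF that(3)] continuous_on_compose2[OF that(4)]) auto
  have T_cont: "continuous_on UNIV (tensor c d1 d2 f g)" if "continuous_on UNIV f" "continuous_on UNIV g" for f g
    unfolding tensor_def[abs_def]
    by (intro continuous_intros continuous_on_compose2[OF that(1)] continuous_on_compose2[OF that(2)]) auto
  have T_bound: "norm (tensor c d1 d2 f g x) \<le> B * B" if "\<bar>f (X x)\<bar> \<le> B" "\<bar>g (Y x)\<bar> \<le> B" for f g x
    unfolding tensor_def norm_of_real using that by (rule mult_B)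
  have part: "partial e (tensor c d1 d2 (hs i) (ks i)) x = G (hs i) (hs' i) (ks i) (ks' i) e x" for e i x
    unfolding G_def by (rule partial_eqI[OF tensor_derivative[OF hd kd]])
  have sm: "smooth (tensor c d1 d2 (hs i) (ks i))" for i by (rule test_function_smooth[OF test])
  note meas = continuous_measurable_lebesgue_on[OF _ sets_Omega]
  have "H10 \<Omega> (tensor c d1 d2 h k) (G h h' k k')"
    unfolding H10_def
  proof (intro conjI ballI exI[of _ "\<lambda>i. tensor c d1 d2 (hs i) (ks i)"] allI)
    show "tensor c d1 d2 h k \<in> L2 \<Omega>"
      by (rule Lp_bounded[OF lmeasurable_Omega, where B="B * B"])
         (use T_cont cont T_bound hB kB mem in \<open>auto intro!: meas\<close>)
    show "G h h' k k' e \<in> L2 \<Omega>" if e: "e \<in> Basis" for e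
      by (rule Lp_bounded[OF lmeasurable_Omega, where B="2 * (B * B)"])
         (use G_cont cont G_bound[OF e] hB kB mem in \<open>auto intro!: meas\<close>)
    show "tensor c d1 d2 (hs i) (ks i) \<in> test_functions \<Omega>" for i by (rule test)
    show "(\<lambda>i. L2_norm \<Omega> (\<lambda>x. tensor c d1 d2 (hs i) (ks i) x - tensor c d1 d2 h k x)) \<longlonglongrightarrow> 0"
    proof (rule L2_tendsto_dominated[OF lmeasurable_Omega, where B="B * B + B * B"])
      show "norm (tensor c d1 d2 (hs i) (ks i) x - tensor c d1 d2 h k x) \<le> B * B + B * B" if "x \<in> \<Omega>" for i x
        using hB[of "X x" i] kB[of "Y x" i] mem[OF that]
        by (intro order_trans[OF norm_triangle_ineq4] add_mono T_bound) auto
      show "AE x in lebesgue_on \<Omega>. (\<lambda>i. tensor c d1 d2 (hs i) (ks i) x) \<longlonglongrightarrow> tensor c d1 d2 h k x"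
      proof (rule AE_I2)
        fix x assume "x \<in> space (lebesgue_on \<Omega>)"
        then have "x \<in> \<Omega>" by simp
        then show "(\<lambda>i. tensor c d1 d2 (hs i) (ks i) x) \<longlonglongrightarrow> tensor c d1 d2 h k x"
          unfolding tensor_def using hl kl mem by (intro tendsto_intros) auto
      qed
    qed (use T_cont cont smooth_continuous[OF sm] in \<open>auto intro!: meas\<close>)
    show "(\<lambda>i. L2_norm \<Omega> (\<lambda>x. partial e (tensor c d1 d2 (hs i) (ks i)) x - G h h' k k' e x)) \<longlonglongrightarrow> 0" if e: "e \<in> Basis" for e
    proof (rule L2_tendsto_dominated[OF lmeasurable_Omega, where B="2 * (B * B) + 2 * (B * B)"])
      show "norm (partial e (tensor c d1 d2 (hs i) (ks i)) x - G h h' k k' e x) \<le> 2 * (B * B) + 2 * (B * B)" if "x \<in> \<Omega>" for i x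
        unfolding part using hB[of "X x" i] kB[of "Y x" i] mem[OF that] e
        by (intro order_trans[OF norm_triangle_ineq4] add_mono G_bound) auto
      show "AE x in lebesgue_on \<Omega>. (\<lambda>i. partial e (tensor c d1 d2 (hs i) (ks i)) x) \<longlonglongrightarrow> G h h' k k' e x"
      proof (rule AE_I2)
        fix x assume "x \<in> space (lebesgue_on \<Omega>)"
        then have "x \<in> \<Omega>" by simp
        then show "(\<lambda>i. partial e (tensor c d1 d2 (hs i) (ks i)) x) \<longlonglongrightarrow> G h h' k k' e x"
          unfolding part G_def using hl kl mem by (intro tendsto_intros) auto
      qed
    qed (use G_cont cont smooth_continuous[OF smooth_partial[OF sm e]] in \<open>auto intro!: meas\<close>)
  qed
  then show ?thesis by (simp only: G_def)
qed

definition sine_product :: "real \<Rightarrow> real \<Rightarrow> real \<Rightarrow> real^2 \<Rightarrow> complex" where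
  "sine_product N \<kappa> \<nu> = tensor c d1 d2 (\<lambda>s. N * sin (\<kappa> * s)) (\<lambda>t. sin (\<nu> * t))"

lemma smooth_sine_product: "smooth (sine_product N \<kappa> \<nu>)"
  unfolding sine_product_def tensor_def[abs_def] of_real_mult
  by (intro smooth_mult smooth_const smooth_sin_coord)

lemma sine_product_H10:
  assumes \<kappa>: "0 \<le> \<kappa>" "sin (\<kappa> * a) = 0" and \<nu>: "0 \<le> \<nu>" "sin (\<nu> * b) = 0"
  shows "H10 \<Omega> (sine_product N \<kappa> \<nu>) (\<lambda>e. partial e (sine_product N \<kappa> \<nu>))"
proof -
  define B where "B = (\<bar>N\<bar> + 1) * (1 + 7 * \<kappa> + 7 * \<nu>)"
  have B1: "\<bar>N * u\<bar> \<le> B" "\<bar>u\<bar> \<le> B" if "\<bar>u\<bar> \<le> 1 + 7 * \<kappa> + 7 * \<nu>" for u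
  proof -
    have "\<bar>N\<bar> * \<bar>u\<bar> \<le> (\<bar>N\<bar> + 1) * (1 + 7 * \<kappa> + 7 * \<nu>)" using that \<kappa> \<nu> by (intro mult_mono) auto
    then show "\<bar>N * u\<bar> \<le> B" by (simp add: B_def abs_mult)
    have "1 * \<bar>u\<bar> \<le> (\<bar>N\<bar> + 1) * (1 + 7 * \<kappa> + 7 * \<nu>)" using that \<kappa> \<nu> by (intro mult_mono) auto
    then show "\<bar>u\<bar> \<le> B" by (simp add: B_def)
  qed
  have part: "partial e (sine_product N \<kappa> \<nu>) x = complex_of_real ((e \<bullet> d1) * (N * (\<kappa> * cos (\<kappa> * X x)) * sin (\<nu> * Y x))
      + (e \<bullet> d2) * (N * sin (\<kappa> * X x) * (\<nu> * cos (\<nu> * Y x))))" for e x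
    unfolding sine_product_def by (rule partial_eqI[OF tensor_derivative]) (auto intro!: derivative_eq_intros)
  have cos_b: "\<bar>\<kappa> * cos s\<bar> \<le> 7 * \<kappa>" "\<bar>\<nu> * cos s\<bar> \<le> 7 * \<nu>" for s
    using mult_left_mono[OF abs_cos_le_one[of s] \<kappa>(1)] mult_left_mono[OF abs_cos_le_one[of s] \<nu>(1)] \<kappa> \<nu>
    by (auto simp: abs_mult)
  have grad: "(\<lambda>e. partial e (sine_product N \<kappa> \<nu>)) = (\<lambda>e x. complex_of_real ((e \<bullet> d1) * (N * (\<kappa> * cos (\<kappa> * X x)) * sin (\<nu> * Y x))
      + (e \<bullet> d2) * (N * sin (\<kappa> * X x) * (\<nu> * cos (\<nu> * Y x)))))"
    by (intro ext part)
  show ?thesis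
    unfolding grad unfolding sine_product_def
  proof (rule H10_tensor[of "\<lambda>i s. N * sine_cutoff a \<kappa> i s" "\<lambda>i. sine_cutoff b \<nu> i"
        "\<lambda>i s. N * sine_cutoff_deriv a \<kappa> i s" "\<lambda>i. sine_cutoff_deriv b \<nu> i" _ _ _ _ B])
    fix i
    show "tensor c d1 d2 (\<lambda>s. N * sine_cutoff a \<kappa> i s) (sine_cutoff b \<nu> i) \<in> test_functions \<Omega>"
    proof -
      define r where "r = 1 / real (Suc i)"
      define K where "K = {x. r \<le> X x \<and> X x \<le> a - r \<and> r \<le> Y x \<and> Y x \<le> b - r}"
      have r: "0 < r" by (simp add: r_def)
      have "smooth (tensor c d1 d2 (\<lambda>s. N * sine_cutoff a \<kappa> i s) (sine_cutoff b \<nu> i))"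
        unfolding tensor_def[abs_def] of_real_mult by (intro smooth_mult smooth_const smooth_sine_cutoff)
      moreover have "compact K" unfolding K_def by (rule compact_coord_box)
      moreover have "K \<subseteq> \<Omega>" using r by (auto simp: K_def mem_iff)
      moreover have "tensor c d1 d2 (\<lambda>s. N * sine_cutoff a \<kappa> i s) (sine_cutoff b \<nu> i) x = 0" if "x \<notin> K" for x
      proof -
        have z: "flat 0 (real (Suc i) * s - 1) = 0" if "s < r" for s
          using that by (simp add: flat_def r_def field_simps)
        from that consider "X x < r" | "a - X x < r" | "Y x < r" | "b - Y x < r" unfolding K_def by force
        then show ?thesis by cases (auto simp: tensor_def sine_cutoff_def z simp del: of_nat_Suc)
      qed
      ultimately show ?thesis unfolding test_functions_def smooth_def by blast
    qed
  next
    fix i s assume s: "0 < s" "s < a"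
    show "\<bar>N * sine_cutoff a \<kappa> i s\<bar> \<le> B \<and> \<bar>N * sine_cutoff_deriv a \<kappa> i s\<bar> \<le> B \<and> \<bar>N * sin (\<kappa> * s)\<bar> \<le> B \<and> \<bar>N * (\<kappa> * cos (\<kappa> * s))\<bar> \<le> B"
      using sine_cutoff_bound[of a \<kappa> i s] sine_cutoff_deriv_bound[OF \<kappa> s, of i] cos_b(1)[of "\<kappa> * s"] abs_sin_le_one[of "\<kappa> * s"] \<kappa> \<nu>
      by (intro conjI B1) linarith+
    show "(\<lambda>i. N * sine_cutoff a \<kappa> i s) \<longlonglongrightarrow> N * sin (\<kappa> * s) \<and> (\<lambda>i. N * sine_cutoff_deriv a \<kappa> i s) \<longlonglongrightarrow> N * (\<kappa> * cos (\<kappa> * s))"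
      by (intro conjI tendsto_mult tendsto_const sine_cutoff_tendsto sine_cutoff_deriv_tendsto \<kappa> s)
  next
    fix i s assume s: "0 < s" "s < b"
    show "\<bar>sine_cutoff b \<nu> i s\<bar> \<le> B \<and> \<bar>sine_cutoff_deriv b \<nu> i s\<bar> \<le> B \<and> \<bar>sin (\<nu> * s)\<bar> \<le> B \<and> \<bar>\<nu> * cos (\<nu> * s)\<bar> \<le> B"
      using sine_cutoff_bound[of b \<nu> i s] sine_cutoff_deriv_bound[OF \<nu> s, of i] cos_b(2)[of "\<nu> * s"] abs_sin_le_one[of "\<nu> * s"] \<kappa> \<nu>
      by (intro conjI B1) linarith+
    show "(\<lambda>i. sine_cutoff b \<nu> i s) \<longlonglongrightarrow> sin (\<nu> * s) \<and> (\<lambda>i. sine_cutoff_deriv b \<nu> i s) \<longlonglongrightarrow> \<nu> * cos (\<nu> * s)"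
      by (intro conjI sine_cutoff_tendsto sine_cutoff_deriv_tendsto \<nu> s)
  next
    fix i s
    show "((\<lambda>s. N * sine_cutoff a \<kappa> i s) has_real_derivative N * sine_cutoff_deriv a \<kappa> i s) (at s)"
      by (rule DERIV_cmult[OF sine_cutoff_derivative])
    show "(sine_cutoff b \<nu> i has_real_derivative sine_cutoff_deriv b \<nu> i s) (at s)"
      by (rule sine_cutoff_derivative)
  qed (intro continuous_intros)+
qed

lemma laplacian_sine_product:
  "(\<Sum>e\<in>Basis. partial e (partial e (sine_product N \<kappa> \<nu>)) x) = - of_real (\<kappa>\<^sup>2 + \<nu>\<^sup>2) * sine_product N \<kappa> \<nu> x"
proof -
  define S where "S = N * sin (\<kappa> * X x) * sin (\<nu> * Y x)"
  define C where "C = N * (\<kappa> * cos (\<kappa> * X x)) * (\<nu> * cos (\<nu> * Y x))"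
  have part: "partial e (sine_product N \<kappa> \<nu>) = (\<lambda>x. complex_of_real (e \<bullet> d1) * tensor c d1 d2 (\<lambda>s. N * (\<kappa> * cos (\<kappa> * s))) (\<lambda>t. sin (\<nu> * t)) x
      + complex_of_real (e \<bullet> d2) * tensor c d1 d2 (\<lambda>s. N * sin (\<kappa> * s)) (\<lambda>t. \<nu> * cos (\<nu> * t)) x)" for e
  proof
    fix x
    have "partial e (sine_product N \<kappa> \<nu>) x = complex_of_real ((e \<bullet> d1) * (N * (\<kappa> * cos (\<kappa> * X x)) * sin (\<nu> * Y x))
      + (e \<bullet> d2) * (N * sin (\<kappa> * X x) * (\<nu> * cos (\<nu> * Y x))))"
      unfolding sine_product_def by (rule partial_eqI[OF tensor_derivative]) (auto intro!: derivative_eq_intros)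
    then show "partial e (sine_product N \<kappa> \<nu>) x = complex_of_real (e \<bullet> d1) * tensor c d1 d2 (\<lambda>s. N * (\<kappa> * cos (\<kappa> * s))) (\<lambda>t. sin (\<nu> * t)) x
      + complex_of_real (e \<bullet> d2) * tensor c d1 d2 (\<lambda>s. N * sin (\<kappa> * s)) (\<lambda>t. \<nu> * cos (\<nu> * t)) x"
      by (simp add: tensor_def)
  qed
  have "partial e (partial e (sine_product N \<kappa> \<nu>)) x =
      complex_of_real (e \<bullet> d1) * complex_of_real ((e \<bullet> d1) * (N * (\<kappa> * (- \<kappa> * sin (\<kappa> * X x))) * sin (\<nu> * Y x)) + (e \<bullet> d2) * (N * (\<kappa> * cos (\<kappa> * X x)) * (\<nu> * cos (\<nu> * Y x))))
      + complex_of_real (e \<bullet> d2) * complex_of_real ((e \<bullet> d1) * (N * (\<kappa> * cos (\<kappa> * X x)) * (\<nu> * cos (\<nu> * Y x))) + (e \<bullet> d2) * (N * sin (\<kappa> * X x) * (\<nu> * (- \<nu> * sin (\<nu> * Y x)))))" for e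
    unfolding part
    by (rule partial_eqI, intro has_derivative_add has_derivative_mult_right tensor_derivative)
       (auto intro!: derivative_eq_intros)
  moreover have "(e \<bullet> d1) * ((e \<bullet> d1) * (N * (\<kappa> * (- \<kappa> * sin (\<kappa> * X x))) * sin (\<nu> * Y x)) + (e \<bullet> d2) * (N * (\<kappa> * cos (\<kappa> * X x)) * (\<nu> * cos (\<nu> * Y x))))
      + (e \<bullet> d2) * ((e \<bullet> d1) * (N * (\<kappa> * cos (\<kappa> * X x)) * (\<nu> * cos (\<nu> * Y x))) + (e \<bullet> d2) * (N * sin (\<kappa> * X x) * (\<nu> * (- \<nu> * sin (\<nu> * Y x)))))
      = - \<kappa>\<^sup>2 * S * ((d1 \<bullet> e) * (d1 \<bullet> e)) + 2 * C * ((d1 \<bullet> e) * (d2 \<bullet> e)) - \<nu>\<^sup>2 * S * ((d2 \<bullet> e) * (d2 \<bullet> e))" for e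
    unfolding inner_commute[of d1 e] inner_commute[of d2 e] S_def C_def by (simp add: algebra_simps power2_eq_square)
  ultimately have "partial e (partial e (sine_product N \<kappa> \<nu>)) x =
      complex_of_real (- \<kappa>\<^sup>2 * S * ((d1 \<bullet> e) * (d1 \<bullet> e)) + 2 * C * ((d1 \<bullet> e) * (d2 \<bullet> e)) - \<nu>\<^sup>2 * S * ((d2 \<bullet> e) * (d2 \<bullet> e)))" for e
    by (simp only: of_real_mult[symmetric] of_real_add[symmetric])
  then have "(\<Sum>e\<in>Basis. partial e (partial e (sine_product N \<kappa> \<nu>)) x) =
      complex_of_real (\<Sum>e\<in>Basis. - \<kappa>\<^sup>2 * S * ((d1 \<bullet> e) * (d1 \<bullet> e)) + 2 * C * ((d1 \<bullet> e) * (d2 \<bullet> e)) - \<nu>\<^sup>2 * S * ((d2 \<bullet> e) * (d2 \<bullet> e)))"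
    by (simp only: of_real_sum)
  also have "\<dots> = complex_of_real (- \<kappa>\<^sup>2 * S * (d1 \<bullet> d1) + 2 * C * (d1 \<bullet> d2) - \<nu>\<^sup>2 * S * (d2 \<bullet> d2))"
    by (simp only: sum.distrib sum_subtractf sum_distrib_left[symmetric] euclidean_inner[symmetric])
  also have "\<dots> = - of_real (\<kappa>\<^sup>2 + \<nu>\<^sup>2) * sine_product N \<kappa> \<nu> x"
    by (simp add: inner_dirs S_def sine_product_def tensor_def algebra_simps)
  finally show ?thesis .
qed

lemma sine_product_eigenfunction:
  assumes \<kappa>: "0 \<le> \<kappa>" "sin (\<kappa> * a) = 0" and \<nu>: "0 \<le> \<nu>" "sin (\<nu> * b) = 0"
  shows "minus_laplacian \<Omega> (sine_product N \<kappa> \<nu>) (\<lambda>x. of_real (\<kappa>\<^sup>2 + \<nu>\<^sup>2) * sine_product N \<kappa> \<nu> x)"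
proof -
  note H = sine_product_H10[OF assms, of N]
  have L: "(\<lambda>x. of_real (\<kappa>\<^sup>2 + \<nu>\<^sup>2) * sine_product N \<kappa> \<nu> x) \<in> L2 \<Omega>"
    using H unfolding H10_def by (intro L2_scale) blast
  have "(\<Sum>e\<in>Basis. L2_inner \<Omega> (partial e (sine_product N \<kappa> \<nu>)) (partial e \<phi>))
      = L2_inner \<Omega> (\<lambda>x. of_real (\<kappa>\<^sup>2 + \<nu>\<^sup>2) * sine_product N \<kappa> \<nu> x) \<phi>" if "\<phi> \<in> test_functions \<Omega>" for \<phi>
    unfolding Green_first_identity[OF sets_Omega smooth_sine_product that] laplacian_sine_product L2_inner_scale_left
    by (simp only: mult_minus_left minus_minus)
  then show ?thesis unfolding minus_laplacian_def using H L by blast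
qed

end

section \<open>Orthonormality and completeness of the sines\<close>

lemma abs_sin_diff_le: "\<bar>sin x - sin y\<bar> \<le> \<bar>x - y\<bar>" for x y :: real
proof -
  have "\<bar>sin x - sin y\<bar> = 2 * (\<bar>sin ((x - y) / 2)\<bar> * \<bar>cos ((x + y) / 2)\<bar>)"
    by (simp add: sin_diff_sin abs_mult)
  also have "\<dots> \<le> 2 * (\<bar>(x - y) / 2\<bar> * 1)"
    by (intro mult_left_mono mult_mono abs_sin_x_le_abs_x abs_cos_le_one) auto
  finally show ?thesis by simp
qed

lemma summable_inverse_squares_prod_decode:
  "summable (\<lambda>k. case prod_decode k of (m, n) \<Rightarrow> 1 / (real (Suc m))\<^sup>2 * (1 / (real (Suc n))\<^sup>2))"
proof (rule summableI_nonneg_bounded[where x="(pi\<^sup>2/6)\<^sup>2"])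
  let ?g = "\<lambda>(m, n). 1 / (real (Suc m))\<^sup>2 * (1 / (real (Suc n))\<^sup>2)"
  fix N :: nat
  have sub: "prod_decode ` {..<N} \<subseteq> {..<N} \<times> {..<N}"
  proof
    fix y assume "y \<in> prod_decode ` {..<N}"
    then obtain k where k: "k < N" "y = prod_decode k" by auto
    obtain m n where mn: "y = (m, n)" by (cases y)
    then have "k = prod_encode (m, n)" using k by (metis prod_decode_inverse)
    then show "y \<in> {..<N} \<times> {..<N}"
      using k le_prod_encode_1[of m n] le_prod_encode_2[of n m] mn by auto
  qed
  have le: "(\<Sum>m<N. 1 / (real (Suc m))\<^sup>2) \<le> pi\<^sup>2/6"
    using sum_le_suminf[of "\<lambda>n. 1 / (real (Suc n))\<^sup>2" "{..<N}"] inverse_squares_sums by (simp add: sums_iff)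
  have "(\<Sum>k<N. ?g (prod_decode k)) = sum ?g (prod_decode ` {..<N})"
    by (simp only: sum.reindex[OF inj_prod_decode] o_def)
  also have "\<dots> \<le> sum ?g ({..<N} \<times> {..<N})"
    by (rule sum_mono2[OF _ sub]) auto
  also have "\<dots> = (\<Sum>m<N. 1 / (real (Suc m))\<^sup>2)\<^sup>2"
    unfolding power2_eq_square[of "\<Sum>m<N. 1 / (real (Suc m))\<^sup>2"] sum_product sum.cartesian_product by simp
  also have "\<dots> \<le> (pi\<^sup>2/6)\<^sup>2" by (intro power_mono le sum_nonneg) auto
  finally show "(\<Sum>k<N. ?g (prod_decode k)) \<le> (pi\<^sup>2/6)\<^sup>2" .
qed (auto split: prod.split)

context rectangle
begin

lemma coord_shift: "X (x + h *\<^sub>R d1) = X x + h" "Y (x + h *\<^sub>R d1) = Y x"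
  by (simp_all add: coord_def inner_diff_left inner_add_left inner_dirs)

text \<open>The integrand is \<open>1/\<kappa>\<close> times the derivative in direction \<open>d1\<close> of \<open>sin (\<kappa> X) cos (\<nu> Y)\<close>
  extended by zero, which is Lipschitz in that direction although it jumps in the other one.\<close>

lemma integral_cos_product_zero_X:
  assumes \<kappa>: "\<kappa> \<noteq> 0" "sin (\<kappa> * a) = 0"
  shows "(\<integral>x. cos (\<kappa> * X x) * cos (\<nu> * Y x) \<partial>lebesgue_on \<Omega>) = 0"
proof -
  define u where "u = tensor c d1 d2 (\<lambda>s. sin (\<kappa> * s)) (\<lambda>t. cos (\<nu> * t))"
  define u' where "u' = tensor c d1 d2 (\<lambda>s. \<kappa> * cos (\<kappa> * s)) (\<lambda>t. cos (\<nu> * t))"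
  define F where "F = (\<lambda>x. if x \<in> \<Omega> then u x else 0)"
  define G where "G = (\<lambda>x. if x \<in> \<Omega> then u' x else 0)"
  define H where "H = (\<lambda>t. if 0 < t \<and> t < b then cos (\<nu> * t) else 0)"
  have F_eq: "F x = complex_of_real (sin (\<kappa> * max 0 (min a (X x))) * H (Y x))" for x
  proof (cases "x \<in> \<Omega>")
    case True
    then show ?thesis by (simp add: F_def u_def tensor_def H_def mem_iff)
  next
    case False
    then consider "X x \<le> 0" | "X x \<ge> a" | "H (Y x) = 0" unfolding mem_iff H_def by force
    then show ?thesis using False \<kappa> pos by cases (auto simp: F_def)
  qed
  have H1: "\<bar>H t\<bar> \<le> 1" for t by (simp add: H_def)
  have Lip: "norm (F (x + h *\<^sub>R d1) - F x) \<le> \<bar>\<kappa>\<bar> * \<bar>h\<bar>" for x h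
  proof -
    have "norm (F (x + h *\<^sub>R d1) - F x)
        = \<bar>(sin (\<kappa> * max 0 (min a (X x + h))) - sin (\<kappa> * max 0 (min a (X x)))) * H (Y x)\<bar>"
      unfolding F_eq coord_shift of_real_diff[symmetric] norm_of_real by (simp add: left_diff_distrib)
    also have "\<dots> \<le> \<bar>\<kappa> * max 0 (min a (X x + h)) - \<kappa> * max 0 (min a (X x))\<bar> * 1"
      unfolding abs_mult by (intro mult_mono abs_sin_diff_le H1) auto
    also have "\<dots> = \<bar>\<kappa>\<bar> * \<bar>max 0 (min a (X x + h)) - max 0 (min a (X x))\<bar>"
      by (simp add: abs_mult flip: right_diff_distrib)
    also have "\<dots> \<le> \<bar>\<kappa>\<bar> * \<bar>h\<bar>" by (intro mult_left_mono) (auto simp: max_def min_def)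
    finally show ?thesis .
  qed
  have ub: "norm (u x) \<le> 1" for x
    unfolding u_def tensor_def norm_of_real abs_mult by (intro mult_le_one) auto
  have u_der: "(u has_derivative (\<lambda>v. complex_of_real ((v \<bullet> d1) * (\<kappa> * cos (\<kappa> * X x) * cos (\<nu> * Y x))
      + (v \<bullet> d2) * (sin (\<kappa> * X x) * (- \<nu> * sin (\<nu> * Y x)))))) (at x)" for x
    unfolding u_def by (rule tensor_derivative) (auto intro!: derivative_eq_intros)
  have "continuous_on UNIV u" by (intro continuous_at_imp_continuous_on ballI has_derivative_continuous[OF u_der])
  moreover have "continuous_on UNIV u'"
    unfolding u'_def tensor_def[abs_def] by (intro continuous_intros)
  moreover have "\<Omega> \<in> sets borel" using open_Omega by simp
  ultimately have meas: "F \<in> borel_measurable borel" "G \<in> borel_measurable borel"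
    unfolding F_def G_def
    by (intro measurable_If_set borel_measurable_const; simp add: borel_measurable_continuous_onI)+
  obtain R where R: "\<And>x. x \<in> \<Omega> \<Longrightarrow> norm x \<le> R" using bounded_Omega by (auto simp: bounded_iff)
  have "negligible (frontier \<Omega>)" by (rule negligible_convex_frontier[OF convex_Omega])
  then have "AE x in lebesgue. x \<notin> frontier \<Omega>" by (intro AE_not_in) (simp add: negligible_iff_null_sets)
  then have AE_front: "AE x in lborel. x \<notin> frontier \<Omega>" by (simp add: AE_completion_iff)
  have "integral\<^sup>L lborel G = 0"
  proof (rule integral_directional_derivative_zero[where F=F and R=R and B=1 and d=d1 and L="\<bar>\<kappa>\<bar>"])
    show "F x = 0" if "R < norm x" for x using R[of x] that by (auto simp: F_def)
    show "norm (F x) \<le> 1" for x by (simp add: F_def ub)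
    show "AE x in lborel. (\<lambda>n. of_nat (Suc n) * (F (x + (1 / real (Suc n)) *\<^sub>R d1) - F x)) \<longlonglongrightarrow> G x"
      using AE_front
    proof eventually_elim
      case (elim x)
      have "\<exists>D. (F has_derivative D) (at x) \<and> D d1 = G x"
      proof (cases "x \<in> \<Omega>")
        case True
        have D0: "(F has_derivative (\<lambda>v. complex_of_real ((v \<bullet> d1) * (\<kappa> * cos (\<kappa> * X x) * cos (\<nu> * Y x))
            + (v \<bullet> d2) * (sin (\<kappa> * X x) * (- \<nu> * sin (\<nu> * Y x)))))) (at x)"
          by (rule has_derivative_transform_within_open[OF u_der open_Omega True]) (simp add: F_def)
        show ?thesis
          by (rule exI, rule conjI, rule D0) (simp add: True G_def u'_def tensor_def inner_dirs)
      next
        case False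
        then have "x \<in> - closure \<Omega>" using elim open_Omega by (simp add: frontier_def interior_open)
        then have "(F has_derivative (\<lambda>v. 0)) (at x)"
          using closure_subset[of \<Omega>]
          by (intro has_derivative_transform_within_open[OF has_derivative_const[of 0], of "- closure \<Omega>"])
             (auto simp: F_def)
        then show ?thesis using False by (intro exI[of _ "\<lambda>_. 0"]) (simp add: G_def)
      qed
      then obtain D where D: "(F has_derivative D) (at x)" "D d1 = G x" by blast
      then have "F differentiable (at x)" unfolding differentiable_def by blast
      from difference_quotient_tendsto_partial[OF this, of d1] show ?case
        unfolding partial_eqI[OF D(1)] D(2) .
    qed
  qed (use meas Lip in auto)
  then have "integral\<^sup>L (lebesgue_on \<Omega>) G = 0"
    using integral_lebesgue_on_eq_lborel[OF sets_Omega meas(2)] by (simp add: G_def)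
  moreover have "integral\<^sup>L (lebesgue_on \<Omega>) G = (\<integral>x. complex_of_real (\<kappa> * (cos (\<kappa> * X x) * cos (\<nu> * Y x))) \<partial>lebesgue_on \<Omega>)"
    by (rule Bochner_Integration.integral_cong) (auto simp: G_def u'_def tensor_def)
  ultimately show ?thesis using \<kappa>(1) by (simp only: integral_complex_of_real) simp
qed

lemma integral_cos_product:
  assumes "sin (\<kappa> * a) = 0" "sin (\<nu> * b) = 0"
  shows "(\<integral>x. cos (\<kappa> * X x) * cos (\<nu> * Y x) \<partial>lebesgue_on \<Omega>) = (if \<kappa> = 0 \<and> \<nu> = 0 then measure lebesgue \<Omega> else 0)"
proof -
  interpret sw: rectangle \<Omega> c d2 d1 b a by (rule swap)
  consider "\<kappa> \<noteq> 0" | "\<nu> \<noteq> 0" | "\<kappa> = 0" "\<nu> = 0" by blast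
  then show ?thesis
  proof cases
    case 1
    then show ?thesis using integral_cos_product_zero_X assms by simp
  next
    case 2
    then show ?thesis using sw.integral_cos_product_zero_X[OF 2 assms(2), of \<kappa>] by (simp add: mult.commute)
  next
    case 3
    then show ?thesis using lmeasurable_Omega by (simp add: measure_restrict_space sets_Omega)
  qed
qed

lemma continuous_L2:
  assumes "continuous_on UNIV f"
  shows "f \<in> L2 \<Omega>"
proof -
  let ?S = "{x. 0 \<le> X x \<and> X x \<le> a \<and> 0 \<le> Y x \<and> Y x \<le> b}"
  have "bounded (f ` ?S)"
    using compact_coord_box[of 0 a 0 b] assms
    by (intro compact_imp_bounded compact_continuous_image) (auto intro: continuous_on_subset)
  then obtain B where B: "\<And>x. x \<in> ?S \<Longrightarrow> norm (f x) \<le> B" by (auto simp: bounded_iff)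
  show ?thesis
    by (rule Lp_bounded[OF lmeasurable_Omega, where B=B])
       (use B assms in \<open>auto simp: mem_iff intro!: continuous_measurable_lebesgue_on sets_Omega\<close>)
qed

definition freqX :: "nat \<Rightarrow> real" where "freqX m = real m * pi / a"
definition freqY :: "nat \<Rightarrow> real" where "freqY n = real n * pi / b"

lemma sin_freq: "sin (freqX m * a) = 0" "sin (freqY n * b) = 0"
  using pos by (simp_all add: freqX_def freqY_def)

lemma cos_freq_neq: "sin ((freqX m + freqX m') * a) = 0" "sin ((freqY m + freqY m') * b) = 0"
  "sin ((freqX m - freqX m') * a) = 0" "sin ((freqY m - freqY m') * b) = 0"
  by (simp_all add: distrib_right left_diff_distrib sin_add sin_diff sin_freq)

lemma freq_inj: "freqX m = freqX m' \<longleftrightarrow> m = m'" "freqY m = freqY m' \<longleftrightarrow> m = m'"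
  using pos by (auto simp: freqX_def freqY_def)

lemma freq_pos: "0 < freqX (Suc m)" "0 < freqY (Suc m)"
  using pos by (auto simp: freqX_def freqY_def)

text \<open>The product-to-sum formula leaves four integrals of products of cosines, all of which vanish
  unless both frequency differences are zero.\<close>

lemma sine_product_inner:
  "L2_inner \<Omega> (sine_product N (freqX (Suc m)) (freqY (Suc n))) (sine_product N (freqX (Suc m')) (freqY (Suc n')))
    = (if m = m' \<and> n = n' then of_real (N\<^sup>2 * measure lebesgue \<Omega> / 4) else 0)"
proof -
  define A B where "A = freqX (Suc m) - freqX (Suc m')" and "B = freqX (Suc m) + freqX (Suc m')"
  define C D where "C = freqY (Suc n) - freqY (Suc n')" and "D = freqY (Suc n) + freqY (Suc n')"
  have zeros: "sin (A * a) = 0" "sin (B * a) = 0" "sin (C * b) = 0" "sin (D * b) = 0"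
    unfolding A_def B_def C_def D_def by (simp_all only: cos_freq_neq)
  have ne: "B \<noteq> 0" "D \<noteq> 0" "A = 0 \<longleftrightarrow> m = m'" "C = 0 \<longleftrightarrow> n = n'"
    using freq_pos[of m] freq_pos[of m'] freq_pos[of n] freq_pos[of n'] by (auto simp: A_def B_def C_def D_def freq_inj)
  have int: "integrable (lebesgue_on \<Omega>) (\<lambda>x. cos (\<kappa> * X x) * cos (\<nu> * Y x))" for \<kappa> \<nu>
  proof -
    have "integrable (lebesgue_on \<Omega>) (\<lambda>x. complex_of_real (cos (\<kappa> * X x) * cos (\<nu> * Y x)))"
      by (intro L1_le_L2_norm(1)[OF lmeasurable_Omega] continuous_L2 continuous_intros)
    from integrable_Re[OF this] show ?thesis by (simp only: Re_complex_of_real)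
  qed
  have eq: "sine_product N (freqX (Suc m)) (freqY (Suc n)) x * cnj (sine_product N (freqX (Suc m')) (freqY (Suc n')) x)
      = complex_of_real (N\<^sup>2 / 4 * (cos (A * X x) * cos (C * Y x) - cos (A * X x) * cos (D * Y x)
          - cos (B * X x) * cos (C * Y x) + cos (B * X x) * cos (D * Y x)))" for x
  proof -
    have sX: "sin (freqX (Suc m) * X x) * sin (freqX (Suc m') * X x) = (cos (A * X x) - cos (B * X x)) / 2"
      unfolding A_def B_def by (simp add: sin_times_sin algebra_simps)
    have sY: "sin (freqY (Suc n) * Y x) * sin (freqY (Suc n') * Y x) = (cos (C * Y x) - cos (D * Y x)) / 2"
      unfolding C_def D_def by (simp add: sin_times_sin algebra_simps)
    have "N * sin (freqX (Suc m) * X x) * sin (freqY (Suc n) * Y x) * (N * sin (freqX (Suc m') * X x) * sin (freqY (Suc n') * Y x))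
       = N * N * (sin (freqX (Suc m) * X x) * sin (freqX (Suc m') * X x)) * (sin (freqY (Suc n) * Y x) * sin (freqY (Suc n') * Y x))"
      by (simp only: mult_ac)
    also have "\<dots>= N * N * ((cos (A * X x) - cos (B * X x)) / 2) * ((cos (C * Y x) - cos (D * Y x)) / 2)"
      by (simp only: sX sY)
    also have "\<dots> = N\<^sup>2 / 4 * (cos (A * X x) * cos (C * Y x) - cos (A * X x) * cos (D * Y x)
          - cos (B * X x) * cos (C * Y x) + cos (B * X x) * cos (D * Y x))"
      by (simp add: field_simps power2_eq_square)
    finally show ?thesis unfolding sine_product_def tensor_def complex_cnj_complex_of_real of_real_mult[symmetric] by (simp only:)
  qed
  have "L2_inner \<Omega> (sine_product N (freqX (Suc m)) (freqY (Suc n))) (sine_product N (freqX (Suc m')) (freqY (Suc n')))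
    = of_real (\<integral>x. N\<^sup>2 / 4 * (cos (A * X x) * cos (C * Y x) - cos (A * X x) * cos (D * Y x)
          - cos (B * X x) * cos (C * Y x) + cos (B * X x) * cos (D * Y x)) \<partial>lebesgue_on \<Omega>)"
    unfolding L2_inner_def eq integral_complex_of_real ..
  also have "\<dots> = of_real (N\<^sup>2 / 4 * (if m = m' \<and> n = n' then measure lebesgue \<Omega> else 0))"
    using ne by (simp add: int integral_cos_product zeros)
  also have "\<dots> = (if m = m' \<and> n = n' then of_real (N\<^sup>2 * measure lebesgue \<Omega> / 4) else 0)" by simp
  finally show ?thesis .
qed

definition normalizer :: real where "normalizer = 2 / sqrt (measure lebesgue \<Omega>)"

text \<open>The sines with number 0 vanish, hence the successors.\<close>

definition basis_fun :: "nat \<Rightarrow> real^2 \<Rightarrow> complex" where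
  "basis_fun k = (case prod_decode k of (m, n) \<Rightarrow> sine_product normalizer (freqX (Suc m)) (freqY (Suc n)))"

definition basis_ev :: "nat \<Rightarrow> real" where
  "basis_ev k = (case prod_decode k of (m, n) \<Rightarrow> (freqX (Suc m))\<^sup>2 + (freqY (Suc n))\<^sup>2)"

lemma normalizer: "0 < normalizer" "normalizer\<^sup>2 * measure lebesgue \<Omega> / 4 = 1"
  using measure_Omega_pos by (auto simp: normalizer_def power_divide)

lemma basis_eigenfunction: "minus_laplacian \<Omega> (basis_fun k) (\<lambda>x. of_real (basis_ev k) * basis_fun k x)"
  unfolding basis_fun_def basis_ev_def
  by (cases "prod_decode k") (simp only: prod.case, intro sine_product_eigenfunction sin_freq less_imp_le[OF freq_pos(1)] less_imp_le[OF freq_pos(2)])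

lemma basis_orthonormal: "orthonormal_L2 \<Omega> basis_fun"
  unfolding orthonormal_L2_def
proof (intro conjI allI)
  show "basis_fun k \<in> L2 \<Omega>" for k
    unfolding basis_fun_def by (cases "prod_decode k") (auto intro!: continuous_L2 smooth_continuous smooth_sine_product)
  show "L2_inner \<Omega> (basis_fun j) (basis_fun k) = (if j = k then 1 else 0)" for j k
  proof -
    obtain m n m' n' where d: "prod_decode j = (m, n)" "prod_decode k = (m', n')" by fastforce
    then have "j = k \<longleftrightarrow> m = m' \<and> n = n'" by (metis prod_decode_inverse prod.inject)
    then show ?thesis unfolding basis_fun_def d prod.case sine_product_inner normalizer(2) by simp
  qed
qed

lemma basis_bound: "norm (basis_fun k x) \<le> normalizer"
proof -
  obtain m n where "prod_decode k = (m, n)" by fastforce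
  then have "norm (basis_fun k x) = normalizer * (\<bar>sin (freqX (Suc m) * X x)\<bar> * \<bar>sin (freqY (Suc n) * Y x)\<bar>)"
    using normalizer(1) by (simp add: basis_fun_def sine_product_def tensor_def norm_mult)
  also have "\<dots> \<le> normalizer * 1"
    using normalizer(1) by (intro mult_left_mono mult_le_one) auto
  finally show ?thesis by simp
qed

lemma basis_ev_pos: "0 < basis_ev k"
  unfolding basis_ev_def using freq_pos
  by (auto split: prod.split intro!: add_pos_pos zero_less_power simp del: zero_less_power2)

text \<open>By the arithmetic-geometric mean inequality the eigenvalues grow at least like the product of the
  two indices.\<close>

lemma summable_inverse_ev: "summable (\<lambda>k. (1 / basis_ev k)\<^sup>2)"
proof (rule summable_comparison_test')
  show "summable (\<lambda>k. (a * b / pi\<^sup>2)\<^sup>2 * (case prod_decode k of (m, n) \<Rightarrow> 1 / (real (Suc m))\<^sup>2 * (1 / (real (Suc n))\<^sup>2)))"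
    by (intro summable_mult summable_inverse_squares_prod_decode)
  show "norm ((1 / basis_ev k)\<^sup>2) \<le> (a * b / pi\<^sup>2)\<^sup>2 * (case prod_decode k of (m, n) \<Rightarrow> 1 / (real (Suc m))\<^sup>2 * (1 / (real (Suc n))\<^sup>2))" for k
  proof -
    obtain m n where d: "prod_decode k = (m, n)" by fastforce
    have "freqX (Suc m) * freqY (Suc n) \<le> basis_ev k"
      using sum_squares_bound[of "freqX (Suc m)" "freqY (Suc n)"] freq_pos[of m] freq_pos[of n]
        mult_pos_pos[OF freq_pos(1)[of m] freq_pos(2)[of n]]
      unfolding basis_ev_def d prod.case by linarith
    then have "1 / basis_ev k \<le> 1 / (freqX (Suc m) * freqY (Suc n))"
      using freq_pos by (intro divide_left_mono mult_pos_pos basis_ev_pos) auto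
    also have "\<dots> = a * b / pi\<^sup>2 * (1 / real (Suc m) * (1 / real (Suc n)))"
      using pos by (simp add: freqX_def freqY_def power2_eq_square field_simps del: of_nat_Suc)
    finally have "(1 / basis_ev k)\<^sup>2 \<le> (a * b / pi\<^sup>2 * (1 / real (Suc m) * (1 / real (Suc n))))\<^sup>2"
      using basis_ev_pos[of k] by (intro power_mono) auto
    then show ?thesis by (simp add: d power_mult_distrib power_divide del: of_nat_Suc)
  qed
qed

text \<open>The number 0, which yields the zero function, is admitted so that the recurrence for
  \<open>cos (\<pi>X/a) sin (m\<pi>X/a)\<close> stays inside the span for \<open>m = 1\<close>.\<close>

inductive sine_span :: "(real^2 \<Rightarrow> real) \<Rightarrow> bool" where
  sine: "sine_span (\<lambda>x. sin (freqX m * X x) * sin (freqY n * Y x))"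
| add: "sine_span f \<Longrightarrow> sine_span g \<Longrightarrow> sine_span (\<lambda>x. f x + g x)"
| scale: "sine_span f \<Longrightarrow> sine_span (\<lambda>x. r * f x)"

lemma sine_span_continuous: "sine_span f \<Longrightarrow> continuous_on UNIV f"
  by (induction rule: sine_span.induct) (auto intro!: continuous_intros)

lemma cos_times_sine_step: "cos A * sin (B + A) = (1/2) * sin (B + 2 * A) + (1/2) * sin (B::real)"
proof -
  have "sin (B + 2 * A) = sin ((B + A) + A)" "sin B = sin ((B + A) - A)" by (simp_all add: algebra_simps)
  then show ?thesis by (simp only: sin_add[of "B + A" A] sin_diff[of "B + A" A]) (simp add: algebra_simps)
qed

lemma freq_Suc: "freqX (Suc m) * s = freqX m * s + pi / a * s" "freqX (Suc (Suc m)) * s = freqX m * s + 2 * (pi / a * s)"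
  "freqY (Suc m) * s = freqY m * s + pi / b * s" "freqY (Suc (Suc m)) * s = freqY m * s + 2 * (pi / b * s)"
  using pos by (simp_all add: freqX_def freqY_def field_simps)

lemma sine_span_mult_cos:
  "sine_span f \<Longrightarrow> sine_span (\<lambda>x. cos (pi / a * X x) * f x)"
  "sine_span f \<Longrightarrow> sine_span (\<lambda>x. cos (pi / b * Y x) * f x)"
proof -
  show "sine_span f \<Longrightarrow> sine_span (\<lambda>x. cos (pi / a * X x) * f x)"
  proof (induction rule: sine_span.induct)
    case (sine m n)
    show ?case
    proof (cases m)
      case 0
      then show ?thesis using sine_span.sine[of 0 n] by (simp add: freqX_def)
    next
      case (Suc m')
      have "cos (pi / a * X x) * (sin (freqX (Suc m') * X x) * sin (freqY n * Y x)) =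
          (1/2) * (sin (freqX (Suc (Suc m')) * X x) * sin (freqY n * Y x)) + (1/2) * (sin (freqX m' * X x) * sin (freqY n * Y x))" for x
        unfolding freq_Suc mult.assoc[symmetric] cos_times_sine_step by (simp add: algebra_simps)
      then show ?thesis unfolding Suc by (simp only:) (intro sine_span.intros)
    qed
  next
    case (add f g)
    then show ?case by (simp only: distrib_left sine_span.add)
  next
    case (scale f r)
    then show ?case by (simp only: mult.left_commute[of _ r] sine_span.scale)
  qed
  show "sine_span f \<Longrightarrow> sine_span (\<lambda>x. cos (pi / b * Y x) * f x)"
  proof (induction rule: sine_span.induct)
    case (sine m n)
    show ?case
    proof (cases n)
      case 0
      then show ?thesis using sine_span.sine[of m 0] by (simp add: freqY_def)
    next
      case (Suc n')
      have "cos (pi / b * Y x) * (sin (freqX m * X x) * sin (freqY (Suc n') * Y x)) =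
          (1/2) * (sin (freqX m * X x) * sin (freqY (Suc (Suc n')) * Y x)) + (1/2) * (sin (freqX m * X x) * sin (freqY n' * Y x))" for x
        unfolding freq_Suc mult.left_commute[of "cos (pi / b * Y x)"] cos_times_sine_step by (simp add: algebra_simps)
      then show ?thesis unfolding Suc by (simp only:) (intro sine_span.intros)
    qed
  next
    case (add f g)
    then show ?case by (simp only: distrib_left sine_span.add)
  next
    case (scale f r)
    then show ?case by (simp only: mult.left_commute[of _ r] sine_span.scale)
  qed
qed

text \<open>The span of the sines is not an algebra, but multiplication by \<open>cos (\<pi>X/a)\<close> and \<open>cos (\<pi>Y/b)\<close>
  preserves it.  These two cosines separate the points of the closed rectangle, so by the
  Stone--Weierstrass theorem a function orthogonal to all sines is, after multiplication by the first
  sine, orthogonal to all continuous functions.\<close>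

lemma basis_complete: "complete_L2 \<Omega> basis_fun"
  unfolding complete_L2_def
proof (intro ballI impI)
  fix f assume f: "f \<in> L2 \<Omega>" and orth: "\<forall>k. L2_inner \<Omega> f (basis_fun k) = 0"
  have cont_L2: "(\<lambda>x. complex_of_real (\<psi> x)) \<in> L2 \<Omega>" if "continuous_on UNIV \<psi>" for \<psi>
    by (intro continuous_L2 continuous_intros that)
  have span0: "(\<integral>x. f x * complex_of_real (\<psi> x) \<partial>lebesgue_on \<Omega>) = 0" if "sine_span \<psi>" for \<psi>
    using that
  proof (induction rule: sine_span.induct)
    case (sine m n)
    show ?case
    proof (cases "m = 0 \<or> n = 0")
      case True
      then show ?thesis by (auto simp: freqX_def freqY_def)
    next
      case False
      then obtain m' n' where mn: "m = Suc m'" "n = Suc n'" by (metis not0_implies_Suc)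
      have "L2_inner \<Omega> f (basis_fun (prod_encode (m', n'))) = 0" using orth by blast
      then have "(\<integral>x. of_real normalizer * (f x * complex_of_real (sin (freqX m * X x) * sin (freqY n * Y x))) \<partial>lebesgue_on \<Omega>) = 0"
        unfolding L2_inner_def basis_fun_def sine_product_def tensor_def mn by (simp add: mult_ac)
      then show ?thesis using normalizer(1) by simp
    qed
  next
    case (add g h)
    have i: "integrable (lebesgue_on \<Omega>) (\<lambda>x. f x * complex_of_real (\<psi> x))" if "sine_span \<psi>" for \<psi>
      by (rule L2_mult_integrable[OF f cont_L2[OF sine_span_continuous[OF that]]])
    show ?case using add i[OF add(1)] i[OF add(2)] by (simp add: distrib_left)
  next
    case (scale g r)
    then show ?case by (simp add: mult.left_commute)
  qed
  define s where "s = (\<lambda>x. sin (freqX 1 * X x) * sin (freqY 1 * Y x))"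
  have s: "sine_span s" unfolding s_def by (rule sine_span.sine)
  have s_cont: "continuous_on UNIV s" by (rule sine_span_continuous[OF s])
  define g where "g = (\<lambda>x. f x * complex_of_real (s x))"
  have g: "integrable (lebesgue_on \<Omega>) g"
    unfolding g_def by (rule L2_mult_integrable[OF f cont_L2[OF s_cont]])
  define S where "S = {x. 0 \<le> X x \<and> X x \<le> a \<and> 0 \<le> Y x \<and> Y x \<le> b}"
  have S: "compact S" unfolding S_def by (rule compact_coord_box)
  \<comment> \<open>the multipliers of the span form an algebra, unlike the span itself\<close>
  define P where "P = (\<lambda>h. continuous_on UNIV h \<and> (\<forall>\<psi>. sine_span \<psi> \<longrightarrow> sine_span (\<lambda>x. h x * \<psi> x)))"
  have approx: "\<exists>p. P p \<and> (\<forall>x\<in>S. \<bar>h x - p x\<bar> < \<epsilon>)" if h: "continuous_on UNIV h" and \<epsilon>: "0 < \<epsilon>" for h \<epsilon>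
  proof (rule Stone_Weierstrass_HOL[OF S])
    show "P (\<lambda>x. r)" for r unfolding P_def by (auto intro: sine_span.scale)
    show "continuous_on S f" if "P f" for f using that unfolding P_def by (auto intro: continuous_on_subset)
    show "P (\<lambda>x. f x + g x)" if "P f \<and> P g" for f g
      using that unfolding P_def by (auto simp: distrib_right intro!: continuous_intros sine_span.add)
    show "P (\<lambda>x. f x * g x)" if "P f \<and> P g" for f g
      using that unfolding P_def by (auto simp: mult.assoc intro!: continuous_intros)
    show "\<exists>f. P f \<and> f x \<noteq> f y" if xy: "x \<in> S \<and> y \<in> S \<and> x \<noteq> y" for x y
    proof (cases "X x = X y")
      case False
      have "pi / a * t \<le> pi \<and> 0 \<le> pi / a * t" if "0 \<le> t" "t \<le> a" for t
        using that pos mult_right_mono[of t a pi] by (simp add: field_simps)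
      then have "cos (pi / a * X x) \<noteq> cos (pi / a * X y)"
        using cos_inj_pi[of "pi / a * X x" "pi / a * X y"] xy False pos unfolding S_def by auto
      moreover have "P (\<lambda>x. cos (pi / a * X x))"
        unfolding P_def by (intro conjI allI impI sine_span_mult_cos continuous_intros)
      ultimately show ?thesis by blast
    next
      case True
      then have "Y x \<noteq> Y y" using decompose[of x] decompose[of y] xy by metis
      have "pi / b * t \<le> pi \<and> 0 \<le> pi / b * t" if "0 \<le> t" "t \<le> b" for t
        using that pos mult_right_mono[of t b pi] by (simp add: field_simps)
      then have "cos (pi / b * Y x) \<noteq> cos (pi / b * Y y)"
        using cos_inj_pi[of "pi / b * Y x" "pi / b * Y y"] xy \<open>Y x \<noteq> Y y\<close> pos unfolding S_def by auto
      moreover have "P (\<lambda>x. cos (pi / b * Y x))"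
        unfolding P_def by (intro conjI allI impI sine_span_mult_cos continuous_intros)
      ultimately show ?thesis by blast
    qed
    show "continuous_on S h" using h by (auto intro: continuous_on_subset)
  qed (rule \<epsilon>)
  have "AE x in lebesgue_on \<Omega>. g x = 0"
  proof (rule AE_zero_if_orthogonal_to_continuous[OF lmeasurable_Omega bounded_Omega g])
    fix h :: "real^2 \<Rightarrow> real" assume h: "continuous_on UNIV h"
    define I where "I = (\<integral>x. norm (g x) \<partial>lebesgue_on \<Omega>)"
    have "0 \<le> I" by (simp add: I_def)
    have int: "integrable (lebesgue_on \<Omega>) (\<lambda>x. g x * complex_of_real (k x))" if "continuous_on UNIV k" for k
    proof -
      have "integrable (lebesgue_on \<Omega>) (\<lambda>x. f x * complex_of_real (s x * k x))"
        by (intro L2_mult_integrable[OF f cont_L2] continuous_intros s_cont that)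
      then show ?thesis by (simp add: g_def mult.assoc)
    qed
    have le: "norm (\<integral>x. g x * complex_of_real (h x) \<partial>lebesgue_on \<Omega>) \<le> \<epsilon> * I" if \<epsilon>: "0 < \<epsilon>" for \<epsilon>
    proof -
      obtain p where p: "P p" and close: "\<And>x. x \<in> S \<Longrightarrow> \<bar>h x - p x\<bar> < \<epsilon>" using approx[OF h \<epsilon>] by blast
      have pc: "continuous_on UNIV p" using p by (simp add: P_def)
      have "sine_span (\<lambda>x. p x * s x)" using p s by (simp add: P_def)
      from span0[OF this] have p0: "(\<integral>x. g x * complex_of_real (p x) \<partial>lebesgue_on \<Omega>) = 0"
        by (simp add: g_def mult_ac)
      have "(\<integral>x. g x * complex_of_real (h x) \<partial>lebesgue_on \<Omega>) = (\<integral>x. g x * complex_of_real (h x - p x) \<partial>lebesgue_on \<Omega>)"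
        using int[OF h] int[OF pc] p0 by (simp add: right_diff_distrib)
      moreover have "norm (\<integral>x. g x * complex_of_real (h x - p x) \<partial>lebesgue_on \<Omega>) \<le> (\<integral>x. \<epsilon> * norm (g x) \<partial>lebesgue_on \<Omega>)"
      proof (rule Bochner_Integration.integral_norm_bound_integral)
        show "integrable (lebesgue_on \<Omega>) (\<lambda>x. g x * complex_of_real (h x - p x))"
          by (rule int) (intro continuous_intros h pc)
        show "integrable (lebesgue_on \<Omega>) (\<lambda>x. \<epsilon> * norm (g x))" using g by simp
        fix x assume "x \<in> space (lebesgue_on \<Omega>)"
        then have "x \<in> S" by (simp add: S_def mem_iff)
        then have "\<bar>h x - p x\<bar> \<le> \<epsilon>" using close by (simp add: less_imp_le)
        from mult_left_mono[OF this norm_ge_zero[of "g x"]]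
        show "norm (g x * complex_of_real (h x - p x)) \<le> \<epsilon> * norm (g x)"
          unfolding norm_mult norm_of_real by (simp add: mult.commute)
      qed
      ultimately show ?thesis by (simp add: I_def)
    qed
    have "norm (\<integral>x. g x * complex_of_real (h x) \<partial>lebesgue_on \<Omega>) \<le> 0 + \<delta>" if \<delta>: "0 < \<delta>" for \<delta>
    proof -
      have "norm (\<integral>x. g x * complex_of_real (h x) \<partial>lebesgue_on \<Omega>) \<le> \<delta> / (I + 1) * I"
        using \<open>0 \<le> I\<close> \<delta> by (intro le) auto
      also have "\<dots> \<le> \<delta>" using \<open>0 \<le> I\<close> \<delta> by (simp add: field_simps)
      finally show ?thesis by simp
    qed
    then have "norm (\<integral>x. g x * complex_of_real (h x) \<partial>lebesgue_on \<Omega>) \<le> 0" by (rule field_le_epsilon)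
    then show "(\<integral>x. g x * complex_of_real (h x) \<partial>lebesgue_on \<Omega>) = 0" by simp
  qed
  then show "AE x in lebesgue_on \<Omega>. f x = 0"
    using AE_space
  proof eventually_elim
    case (elim x)
    then have x: "0 < X x" "X x < a" "0 < Y x" "Y x < b" by (auto simp: mem_iff)
    have "0 < sin (freqX 1 * X x)" "0 < sin (freqY 1 * Y x)"
      using x pos by (intro sin_gt_zero; simp add: freqX_def freqY_def field_simps)+
    then have "s x \<noteq> 0" by (simp add: s_def)
    then show ?case using elim by (simp add: g_def)
  qed
qed

lemma basis_laplacian_eigenbasis: "laplacian_eigenbasis \<Omega> basis_fun basis_ev"
  using basis_eigenfunction basis_orthonormal basis_complete
  unfolding laplacian_eigenbasis_def orthonormal_L2_def complete_L2_def by blast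

end

section \<open>The resolvent of the inverse Laplacian\<close>

lemma eigenbasis_orthonormal:
  assumes "laplacian_eigenbasis \<Omega> e ev"
  shows "orthonormal_L2 \<Omega> e" "complete_L2 \<Omega> e"
  using assms unfolding laplacian_eigenbasis_def orthonormal_L2_def complete_L2_def minus_laplacian_def H10_def
  by auto

text \<open>Inserting an eigenfunction into the norm bound that defines the resolvent set bounds the distance
  of \<open>z\<close> to \<open>1 / l\<close> from below, uniformly in the eigenvalue \<open>l\<close>.\<close>

lemma eigenvalue_bound:
  assumes bound: "\<And>v w. inverse_laplacian_minus \<Omega> z v w \<Longrightarrow> L2_norm \<Omega> v \<le> C * L2_norm \<Omega> w"
    and e: "minus_laplacian \<Omega> e (\<lambda>x. of_real l * e x)" and l: "0 < l" and n: "L2_norm \<Omega> e = 1"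
  shows "1 \<le> C * norm (of_real (1 / l) - z)"
proof -
  have eL: "e \<in> L2 \<Omega>" using e unfolding minus_laplacian_def H10_def by blast
  have "inverse_laplacian_minus \<Omega> z (\<lambda>x. of_real l * e x) (\<lambda>x. (1 - z * of_real l) * e x)"
    unfolding inverse_laplacian_minus_def inverse_laplacian_def
    using e eL by (intro conjI exI[of _ e] L2_scale) (auto simp: algebra_simps)
  from bound[OF this] have "l \<le> C * norm (1 - z * of_real l)"
    using l by (simp add: L2_norm_scale n)
  also have "1 - z * of_real l = of_real l * (of_real (1 / l) - z)"
    using l by (simp add: field_simps)
  also have "C * norm (of_real l * (of_real (1 / l) - z)) = l * (C * norm (of_real (1 / l) - z))"
    using l by (simp add: norm_mult)
  finally show ?thesis using l by simp
qed

text \<open>Eigenfunctions to different eigenvalues are orthogonal, so the resolvent computed in any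
  eigenbasis acts on the coefficients of any other as the same multiplier.\<close>

lemma resolvent_coefficient:
  assumes \<Omega>: "\<Omega> \<in> lmeasurable" and u: "u \<in> L2 \<Omega>" and res: "resolvent_inverse_laplacian \<Omega> z u v"
    and s: "minus_laplacian \<Omega> s (\<lambda>x. of_real l * s x)"
  shows "L2_inner \<Omega> v s = L2_inner \<Omega> u s / (of_real (1 / l) - z)"
proof -
  obtain e ev where basis: "laplacian_eigenbasis \<Omega> e ev" and v: "v \<in> L2 \<Omega>"
    and lim: "(\<lambda>n. L2_norm \<Omega> (\<lambda>x. (\<Sum>k<n. L2_inner \<Omega> u (e k) / (of_real (1 / ev k) - z) * e k x) - v x)) \<longlonglongrightarrow> 0"
    using res unfolding resolvent_inverse_laplacian_def by blast
  note on = eigenbasis_orthonormal[OF basis]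
  have sL: "s \<in> L2 \<Omega>" using s unfolding minus_laplacian_def H10_def by blast
  have orth: "L2_inner \<Omega> (e k) s = 0 \<or> ev k = l" for k
  proof -
    have "minus_laplacian \<Omega> (e k) (\<lambda>x. of_real (ev k) * e k x)"
      using basis by (simp add: laplacian_eigenbasis_def)
    from minus_laplacian_symmetric[OF \<Omega> this s]
    have "of_real (ev k) * L2_inner \<Omega> (e k) s = of_real l * L2_inner \<Omega> (e k) s"
      by (simp add: L2_inner_scale_left L2_inner_scale_right)
    then show ?thesis by auto
  qed
  define m where "m = complex_of_real (1 / l) - z"
  have lim_u: "(\<lambda>n. L2_inner \<Omega> (\<lambda>x. \<Sum>k<n. L2_inner \<Omega> u (e k) * e k x) s / m) \<longlonglongrightarrow> L2_inner \<Omega> u s / m"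
    unfolding divide_inverse
    by (intro tendsto_mult tendsto_const L2_inner_tendsto[OF orthonormal_L2_mem[OF on(1)] u sL]
        orthonormal_expansion[OF \<Omega> on u])
  have eq: "L2_inner \<Omega> (\<lambda>x. \<Sum>k<n. L2_inner \<Omega> u (e k) / (of_real (1 / ev k) - z) * e k x) s
      = L2_inner \<Omega> (\<lambda>x. \<Sum>k<n. L2_inner \<Omega> u (e k) * e k x) s / m" for n
    unfolding orthonormal_inner_sum_left[OF on(1) finite_lessThan sL] sum_divide_distrib
  proof (rule sum.cong[OF refl])
    fix k
    show "L2_inner \<Omega> u (e k) / (of_real (1 / ev k) - z) * L2_inner \<Omega> (e k) s = L2_inner \<Omega> u (e k) * L2_inner \<Omega> (e k) s / m"
      using orth[of k] by (auto simp: m_def)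
  qed
  have lim_v: "(\<lambda>n. L2_inner \<Omega> (\<lambda>x. \<Sum>k<n. L2_inner \<Omega> u (e k) / (of_real (1 / ev k) - z) * e k x) s) \<longlonglongrightarrow> L2_inner \<Omega> v s"
    by (rule L2_inner_tendsto[OF orthonormal_L2_mem[OF on(1)] v sL lim])
  show ?thesis unfolding m_def[symmetric] by (rule LIMSEQ_unique[OF lim_v[unfolded eq] lim_u])
qed

lemma resolvent_exists:
  assumes \<Omega>: "\<Omega> \<in> lmeasurable" and basis: "laplacian_eigenbasis \<Omega> e ev" and u: "u \<in> L2 \<Omega>"
    and d: "0 < d" "\<And>k. d \<le> norm (of_real (1 / ev k) - z)"
  shows "\<exists>v. resolvent_inverse_laplacian \<Omega> z u v"
proof -
  note on = eigenbasis_orthonormal[OF basis]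
  have "summable (\<lambda>k. (norm (L2_inner \<Omega> u (e k) / (of_real (1 / ev k) - z)))\<^sup>2)"
  proof (rule summable_comparison_test')
    show "summable (\<lambda>k. (norm (L2_inner \<Omega> u (e k)))\<^sup>2 / d\<^sup>2)"
      by (intro summable_divide Bessel_summable[OF on(1) u])
    show "norm ((norm (L2_inner \<Omega> u (e k) / (of_real (1 / ev k) - z)))\<^sup>2) \<le> (norm (L2_inner \<Omega> u (e k)))\<^sup>2 / d\<^sup>2" for k
    proof -
      have "norm (L2_inner \<Omega> u (e k) / (of_real (1 / ev k) - z)) \<le> norm (L2_inner \<Omega> u (e k)) / d"
        unfolding norm_divide using d(1) d(2)[of k] by (intro frac_le) auto
      then have "(norm (L2_inner \<Omega> u (e k) / (of_real (1 / ev k) - z)))\<^sup>2 \<le> (norm (L2_inner \<Omega> u (e k)) / d)\<^sup>2"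
        by (intro power_mono) auto
      then show ?thesis by (simp only: power_divide real_norm_def abs_power2)
    qed
  qed
  from Riesz_Fischer[OF \<Omega> on(1) this] show ?thesis
    unfolding resolvent_inverse_laplacian_def using basis by blast
qed

theorem mainTheorem2:
  fixes \<Omega> :: "(real^2) set" and p :: real and z :: complex
  assumes "open_rectangle \<Omega>"
    and "1 < p"
    and "z \<notin> spectrum_inverse_laplacian \<Omega>"
  shows "\<exists>C. \<forall>u \<in> L2 \<Omega> \<inter> Lp p \<Omega>.
           (\<exists>v. resolvent_inverse_laplacian \<Omega> z u v) \<and>
           (\<forall>v. resolvent_inverse_laplacian \<Omega> z u v \<longrightarrow>
                v \<in> Lp p \<Omega> \<and> Lp_norm p \<Omega> v \<le> C * Lp_norm p \<Omega> u)"
proof -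
  obtain c d1 d2 a b where "rectangle \<Omega> c d1 d2 a b"
    using assms(1) unfolding open_rectangle_def rectangle_def by blast
  then interpret rectangle \<Omega> c d1 d2 a b .
  obtain C0 where C0: "\<And>v w. inverse_laplacian_minus \<Omega> z v w \<Longrightarrow> L2_norm \<Omega> v \<le> C0 * L2_norm \<Omega> w"
    using assms(3) unfolding spectrum_inverse_laplacian_def by blast
  have norm1: "L2_norm \<Omega> (basis_fun k) = 1" for k
  proof -
    have "complex_of_real ((L2_norm \<Omega> (basis_fun k))\<^sup>2) = 1"
      unfolding L2_inner_self[symmetric] using basis_orthonormal by (simp add: orthonormal_L2_def)
    then have "(L2_norm \<Omega> (basis_fun k))\<^sup>2 = 1" by (simp only: of_real_eq_1_iff)
    then show ?thesis using L2_norm_nonneg[of \<Omega> "basis_fun k"] by (simp add: power2_eq_1_iff)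
  qed
  have one: "1 \<le> C0 * norm (of_real (1 / basis_ev k) - z)" for k
    by (rule eigenvalue_bound[OF C0 basis_eigenfunction basis_ev_pos norm1])
  have C0_pos: "0 < C0"
  proof (rule ccontr)
    assume "\<not> 0 < C0"
    then have "C0 * norm (of_real (1 / basis_ev 0) - z) \<le> 0" by (intro mult_nonpos_nonneg) auto
    then show False using one[of 0] by linarith
  qed
  define d where "d = 1 / C0"
  have d: "0 < d" "\<And>k. d \<le> norm (of_real (1 / basis_ev k) - z)"
    using one C0_pos by (auto simp: d_def field_simps)
  \<comment> \<open>0 is the limit of the points \<open>1 / basis_ev k\<close>, from which \<open>z\<close> keeps the distance \<open>d\<close>\<close>
  have z: "z \<noteq> 0"
  proof
    assume "z = 0"
    then have "d \<le> 1 / basis_ev k" for k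
      using d(2)[of k] basis_ev_pos[of k] by (simp add: norm_divide)
    then have "d\<^sup>2 \<le> (1 / basis_ev k)\<^sup>2" for k
      using d(1) by (intro power_mono) auto
    moreover have "(\<lambda>k. (1 / basis_ev k)\<^sup>2) \<longlonglongrightarrow> 0" by (rule summable_LIMSEQ_zero[OF summable_inverse_ev])
    ultimately have "d\<^sup>2 \<le> 0" by (intro LIMSEQ_le_const[of "\<lambda>k. (1 / basis_ev k)\<^sup>2"]) blast+
    then show False using d(1) by simp
  qed
  obtain C where C: "\<And>u v. u \<in> L2 \<Omega> \<inter> Lp p \<Omega> \<Longrightarrow> v \<in> L2 \<Omega> \<Longrightarrow>
      (\<And>k. L2_inner \<Omega> v (basis_fun k) = L2_inner \<Omega> u (basis_fun k) / (of_real (1 / basis_ev k) - z)) \<Longrightarrow>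
      v \<in> Lp p \<Omega> \<and> Lp_norm p \<Omega> v \<le> C * Lp_norm p \<Omega> u"
    using resolvent_multiplier_Lp_bounded[OF lmeasurable_Omega basis_orthonormal basis_complete basis_bound
        summable_inverse_ev d z less_imp_le[OF assms(2)]] by blast
  show ?thesis
  proof (intro exI[of _ C] ballI conjI allI impI)
    fix u assume u: "u \<in> L2 \<Omega> \<inter> Lp p \<Omega>"
    show "\<exists>v. resolvent_inverse_laplacian \<Omega> z u v"
      using resolvent_exists[OF lmeasurable_Omega basis_laplacian_eigenbasis _ d] u by blast
    fix v assume v: "resolvent_inverse_laplacian \<Omega> z u v"
    have "v \<in> L2 \<Omega>" using v by (simp add: resolvent_inverse_laplacian_def)
    from C[OF u this] show "v \<in> Lp p \<Omega>" "Lp_norm p \<Omega> v \<le> C * Lp_norm p \<Omega> u"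
      using resolvent_coefficient[OF lmeasurable_Omega _ v basis_eigenfunction] u by blast+
  qed
qed

end
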